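(* Let $k$ be a field and let $X\subset \mathbb{P}^{n+1}_k$ be a smooth cubic hypersurface of dimension $n\geq 2$ over $k$. Then the following are equivalent: (1) $X$ is unirational over $k$. (2) $X$ has a $k$-point, i.e. $X(k)\neq\emptyset$.
   Context: The field $k$ is arbitrary (any characteristic, finite or infinite, perfect or not). A $k$-variety $X$ is called unirational over $k$ if there is a dominant rational map $\mathbb{A}^m \dashrightarrow X$ defined over $k$ for some $m$ (no separability is required; the variant of the definition requiring $m=\dim X$ is equivalent). Smooth means smooth over $k$. *)

theory Defs
  imports
    "HOL-Library.Poly_Mapping"
    "HOL-Algebra.Algebraic_Closure_Type"
begin

(* Polynomials in variables indexed by nat: finitely supported maps from exponent vectors
   to coefficients, with the convolution product of Poly_Mapping.  A polynomial ring in
   finitely many variables is singled out by mp_in. *)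

type_synonym 'a mpoly = "(nat \<Rightarrow>\<^sub>0 nat) \<Rightarrow>\<^sub>0 'a"

definition mp_in :: "nat set \<Rightarrow> ('a::zero) mpoly \<Rightarrow> bool" where
  "mp_in V p \<longleftrightarrow> (\<forall>e \<in> Poly_Mapping.keys p. Poly_Mapping.keys e \<subseteq> V)"

definition mp_eval :: "('a::comm_semiring_1) mpoly \<Rightarrow> (nat \<Rightarrow> 'a) \<Rightarrow> 'a" where
  "mp_eval p x = (\<Sum>e \<in> Poly_Mapping.keys p.
     Poly_Mapping.lookup p e * (\<Prod>i \<in> Poly_Mapping.keys e. x i ^ Poly_Mapping.lookup e i))"

definition mp_homogeneous :: "nat \<Rightarrow> ('a::zero) mpoly \<Rightarrow> bool" where
  "mp_homogeneous d p \<longleftrightarrow>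
     (\<forall>e \<in> Poly_Mapping.keys p. (\<Sum>i \<in> Poly_Mapping.keys e. Poly_Mapping.lookup e i) = d)"

(* Formal partial derivative.  If the variable i does not occur in the monomial e, the
   truncated subtraction is harmless because the coefficient is then 0. *)

definition mp_pderiv :: "nat \<Rightarrow> ('a::comm_semiring_1) mpoly \<Rightarrow> 'a mpoly" where
  "mp_pderiv i p = (\<Sum>e \<in> Poly_Mapping.keys p.
     Poly_Mapping.single (e - Poly_Mapping.single i 1)
       (of_nat (Poly_Mapping.lookup e i) * Poly_Mapping.lookup p e))"

(* Base change to the algebraic closure. *)

definition mp_ac :: "('k::field) mpoly \<Rightarrow> 'k alg_closure mpoly" where
  "mp_ac p = Poly_Mapping.map to_ac p"

(* Points of A^m and P^N with coordinates in a field, the latter given by homogeneous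
   coordinates x 0, ..., x N.  Proportional vectors describe the same point of P^N and are
   not identified: every condition on points of P^N below is invariant under scaling.
   Coordinates outside the range are fixed to be 0. *)

definition affine_points :: "nat \<Rightarrow> (nat \<Rightarrow> 'a::field) set" where
  "affine_points m = {t. \<forall>i\<ge>m. t i = 0}"

definition proj_points :: "nat \<Rightarrow> (nat \<Rightarrow> 'a::field) set" where
  "proj_points N = {x. (\<exists>i\<le>N. x i \<noteq> 0) \<and> (\<forall>i>N. x i = 0)}"

definition hypersurface_points :: "nat \<Rightarrow> ('a::field) mpoly \<Rightarrow> (nat \<Rightarrow> 'a) set" where
  "hypersurface_points N F = {x \<in> proj_points N. mp_eval F x = 0}"

definition hypersurface_eq :: "nat \<Rightarrow> nat \<Rightarrow> ('a::field) mpoly \<Rightarrow> bool" where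
  "hypersurface_eq N d F \<longleftrightarrow> F \<noteq> 0 \<and> mp_in {..N} F \<and> mp_homogeneous d F"

(* Smoothness over k of the subscheme F = 0 of P^N: the Jacobian criterion at all geometric
   points.  (Over an imperfect field this is stronger than regularity.) *)

definition smooth_hypersurface :: "nat \<Rightarrow> ('k::field) mpoly \<Rightarrow> bool" where
  "smooth_hypersurface N F \<longleftrightarrow>
     (\<forall>x \<in> hypersurface_points N (mp_ac F). \<exists>i\<le>N. mp_eval (mp_ac (mp_pderiv i F)) x \<noteq> 0)"

(* Closure in P^N over a field for the Zariski topology, whose closed sets are the common
   zero sets of families of homogeneous polynomials. *)

definition zariski_closure :: "nat \<Rightarrow> (nat \<Rightarrow> 'a::field) set \<Rightarrow> (nat \<Rightarrow> 'a) set" where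
  "zariski_closure N S = {x \<in> proj_points N.
     \<forall>G d. mp_in {..N} G \<longrightarrow> mp_homogeneous d G \<longrightarrow> (\<forall>y\<in>S. mp_eval G y = 0) \<longrightarrow> mp_eval G x = 0}"

(* A rational map from A^m to P^N over k is given by polynomials f 0, ..., f N in
   k[t_0, ..., t_(m-1)], not all zero (clear denominators in a tuple of rational functions).
   It is defined at least on the dense open set where the f i have no common zero, and
   both its target and its dominance can be tested on that set over the algebraic closure;
   k-points would not suffice, as k may be finite. *)

definition rational_map :: "nat \<Rightarrow> nat \<Rightarrow> (nat \<Rightarrow> ('k::field) mpoly) \<Rightarrow> bool" where
  "rational_map m N f \<longleftrightarrow> (\<forall>i\<le>N. mp_in {..<m} (f i)) \<and> (\<exists>i\<le>N. f i \<noteq> 0)"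

definition rational_map_at ::
    "nat \<Rightarrow> (nat \<Rightarrow> ('k::field) mpoly) \<Rightarrow> (nat \<Rightarrow> 'k alg_closure) \<Rightarrow> (nat \<Rightarrow> 'k alg_closure)" where
  "rational_map_at N f t = (\<lambda>i. if i \<le> N then mp_eval (mp_ac (f i)) t else 0)"

definition rational_map_image ::
    "nat \<Rightarrow> nat \<Rightarrow> (nat \<Rightarrow> ('k::field) mpoly) \<Rightarrow> (nat \<Rightarrow> 'k alg_closure) set" where
  "rational_map_image m N f = (rational_map_at N f ` affine_points m) \<inter> proj_points N"

definition unirational_hypersurface :: "nat \<Rightarrow> ('k::field) mpoly \<Rightarrow> bool" where
  "unirational_hypersurface N F \<longleftrightarrow> (\<exists>m f. rational_map m N f
     \<and> rational_map_image m N f \<subseteq> hypersurface_points N (mp_ac F)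
     \<and> hypersurface_points N (mp_ac F) \<subseteq> zariski_closure N (rational_map_image m N f))"

end

theory Submission
  imports Defs "HOL-Library.Nat_Bijection"
begin

text \<open>
  The argument for the existence of a dominant map is Kollar's, in explicit form. On a tangent line at a
  point \<open>u\<close> of the cubic \<open>F = 0\<close> there is one residual intersection point. It is a polynomial in \<open>u\<close>
  and the tangent direction, so iterating this construction from a point, with all tangent directions,
  gives rationally parametrised families. In any characteristic the third family is dense if the second
  one contains a point whose tangent section is not a cone with that vertex. A \<open>k\<close>-point need not have this property. However, a
  general line through it meets the cubic in two further points that are conjugate over a quadratic
  extension and do have it. The line through conjugate points of the two families started there
  has a third intersection point, which is given by polynomials over \<open>k\<close> after Weil
  restriction, and these points are dense. Density rests on two facts about smooth cubics of dimension at
  least two: they are irreducible, and no point of them lies on all tangent hyperplanes. Conversely, a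
  polynomial curve in the source of a rational map has a limit point over \<open>k\<close>, even if \<open>k\<close> is finite.\<close>

section \<open>Polynomial functions\<close>

text \<open>Two obstacles shape the proof. The field \<open>k\<close> may be finite, so general
  \<open>k\<close>-points or \<open>k\<close>-lines need not exist: every genericity argument takes
  place over the algebraic closure, and only the finished formula for the map must have coefficients
  in \<open>k\<close>. And the characteristic is arbitrary. A dominant map may be inseparable, so
  density cannot be read off from a differential. Instead, if the points obtained by one more
  tangent step are not dense, the tangent hyperplanes at the starting points are shown to form a
  pencil. When the starting points fill the cubic, the axis of this pencil still meets the cubic
  because the dimension is at least two, and gives a point on all tangent hyperplanes. Excluding
  such a point is hardest in characteristic two, where discriminants of quadratics are squares.
  There it needs a common zero of \<open>N\<close> quadrics in projective \<open>N\<close>-space,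
  the reason for the excursion into graded ideals. All infinitesimal arguments are coefficient
  comparisons along lines, without division by 2 or 3.\<close>

instance alg_closure :: (field) field_gcd ..

text \<open>\<open>C\<close> lists the admissible coordinate functions and \<open>S\<close> the
  admissible constants, so \<open>S\<close> records a field of definition. It is everything in the
  geometric arguments and the image of the ground field in the descent, where the same closure rules
  show that a formula is rational.\<close>

inductive_set polyfuns :: "('d \<Rightarrow> 'a::comm_ring_1) set \<Rightarrow> 'a set \<Rightarrow> ('d \<Rightarrow> 'a) set"
  for C S where
  const: "c \<in> S \<Longrightarrow> (\<lambda>_. c) \<in> polyfuns C S"
| coord: "f \<in> C \<Longrightarrow> f \<in> polyfuns C S"
| add: "f \<in> polyfuns C S \<Longrightarrow> g \<in> polyfuns C S \<Longrightarrow> (\<lambda>x. f x + g x) \<in> polyfuns C S"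
| mult: "f \<in> polyfuns C S \<Longrightarrow> g \<in> polyfuns C S \<Longrightarrow> (\<lambda>x. f x * g x) \<in> polyfuns C S"

lemma polyfuns_uminus:
  assumes "f \<in> polyfuns C S" "- 1 \<in> S" shows "(\<lambda>x. - f x) \<in> polyfuns C S"
  using polyfuns.mult[OF polyfuns.const[OF assms(2)] assms(1)] by simp

lemma polyfuns_diff:
  assumes "f \<in> polyfuns C S" "g \<in> polyfuns C S" "- 1 \<in> S"
  shows "(\<lambda>x. f x - g x) \<in> polyfuns C S"
  using polyfuns.add[OF assms(1) polyfuns_uminus[OF assms(2,3)]] by simp

lemma polyfuns_power:
  assumes "f \<in> polyfuns C S" "1 \<in> S" shows "(\<lambda>x. f x ^ n) \<in> polyfuns C S"
  by (induction n) (auto intro: polyfuns.intros assms)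

lemma polyfuns_sum:
  assumes "\<And>i. i \<in> I \<Longrightarrow> f i \<in> polyfuns C S" "0 \<in> S"
  shows "(\<lambda>x. \<Sum>i\<in>I. f i x) \<in> polyfuns C S"
  using assms(1)
proof (induction I rule: infinite_finite_induct)
  case (insert j I)
  then show ?case by (auto intro: polyfuns.add)
qed (auto intro: polyfuns.const assms(2))

lemma polyfuns_prod:
  assumes "\<And>i. i \<in> I \<Longrightarrow> f i \<in> polyfuns C S" "1 \<in> S"
  shows "(\<lambda>x. \<Prod>i\<in>I. f i x) \<in> polyfuns C S"
  using assms(1)
proof (induction I rule: infinite_finite_induct)
  case (insert j I)
  then show ?case by (auto intro: polyfuns.mult)
qed (auto intro: polyfuns.const assms(2))

lemma polyfuns_subst:
  assumes "f \<in> polyfuns C S" "\<And>g. g \<in> C \<Longrightarrow> (\<lambda>x. g (h x)) \<in> polyfuns D T" "S \<subseteq> T"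
  shows "(\<lambda>x. f (h x)) \<in> polyfuns D T"
  using assms(1) by induction (use assms(2,3) in \<open>auto intro: polyfuns.intros\<close>)

lemma polyfuns_mono:
  assumes "f \<in> polyfuns C S" "C \<subseteq> D" "S \<subseteq> T" shows "f \<in> polyfuns D T"
  using polyfuns_subst[OF assms(1), of "\<lambda>x. x" D T] assms(2,3) by (auto intro: polyfuns.coord)

abbreviation PU :: "('a \<Rightarrow> 'a::comm_ring_1) set" where
  "PU \<equiv> polyfuns {\<lambda>x. x} UNIV"

abbreviation PV :: "((nat \<Rightarrow> 'a) \<Rightarrow> 'a::comm_ring_1) set" where
  "PV \<equiv> polyfuns (range (\<lambda>i x. x i)) UNIV"

lemma PV_coord: "(\<lambda>x. x i) \<in> PV"
  by (rule polyfuns.coord) auto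

lemma PU_id: "(\<lambda>x. x) \<in> PU"
  by (rule polyfuns.coord) auto

lemmas polyfuns_intros = polyfuns.add polyfuns.mult polyfuns_diff[OF _ _ UNIV_I]
  polyfuns_uminus[OF _ UNIV_I] polyfuns_power[OF _ UNIV_I] polyfuns_sum[OF _ UNIV_I]
  polyfuns_prod[OF _ UNIV_I] polyfuns.const[OF UNIV_I] PU_id PV_coord

lemma PV_subst:
  assumes "f \<in> PV" "\<And>i. (\<lambda>x. h x i) \<in> polyfuns D UNIV"
  shows "(\<lambda>x. f (h x)) \<in> polyfuns D UNIV"
  by (rule polyfuns_subst[OF assms(1)]) (use assms(2) in auto)

lemma PU_poly:
  assumes "f \<in> PU" obtains p where "\<And>x. f x = poly p x"
proof -
  have "\<exists>p. \<forall>x. f x = poly p x" using assms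
  proof induction
    case (const c) show ?case by (rule exI[of _ "[:c:]"]) auto
  next
    case (coord f) then show ?case by (intro exI[of _ "[:0,1:]"]) auto
  next
    case (add f g) then show ?case by (metis poly_add)
  next
    case (mult f g) then show ?case by (metis poly_mult)
  qed
  with that show thesis by auto
qed

lemma poly_in_PU: "poly p \<in> PU"
proof -
  have "(\<lambda>x. poly p x) \<in> PU"
    by (induction p) (auto intro!: polyfuns_intros)
  then show ?thesis by simp
qed

lemma infinite_alg_closed: "infinite (UNIV :: 'a::alg_closed_field set)"
proof
  assume fin: "finite (UNIV :: 'a set)"
  define p :: "'a poly" where "p = (\<Prod>a\<in>UNIV. [:-a, 1:]) + 1"
  have "degree (\<Prod>a\<in>(UNIV::'a set). [:-a, 1:]) = card (UNIV :: 'a set)"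
    by (subst degree_prod_eq_sum_degree) auto
  moreover have "card (UNIV :: 'a set) > 0" using fin by (simp add: card_gt_0_iff)
  ultimately have "degree p > 0"
    unfolding p_def by (subst degree_add_eq_left) auto
  then obtain x where x: "poly p x = 0" using alg_closed_imp_poly_has_root by blast
  have "(\<Prod>a\<in>UNIV. poly [:-a, 1:] x) = 0"
    by (rule prod_zero[OF fin]) (rule bexI[of _ x], simp_all)
  then have "poly p x = 1"
    unfolding p_def poly_add poly_prod by simp
  with x show False by simp
qed

lemma poly_eq_0_infinite:
  assumes "infinite A" "\<And>x. x \<in> A \<Longrightarrow> poly p x = (0::'a::idom)" shows "p = 0"
proof (rule ccontr)
  assume "p \<noteq> 0"
  then have "finite {x. poly p x = 0}" by (rule poly_roots_finite)
  moreover have "A \<subseteq> {x. poly p x = 0}" using assms(2) by auto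
  ultimately show False using assms(1) finite_subset by blast
qed

lemma PU_mult_nonzero:
  fixes f g :: "'a::alg_closed_field \<Rightarrow> 'a"
  assumes "f \<in> PU" "g \<in> PU" "f a \<noteq> 0" "g b \<noteq> 0" "finite B"
  shows "\<exists>x. x \<notin> B \<and> f x \<noteq> 0 \<and> g x \<noteq> 0"
proof -
  obtain p q where p: "\<And>x. f x = poly p x" and q: "\<And>x. g x = poly q x"
    using assms(1,2) by (metis PU_poly)
  have "p * q \<noteq> 0" using assms(3,4) p q by auto
  then have "finite ({x. poly (p * q) x = 0} \<union> B)" using poly_roots_finite assms(5) by blast
  then obtain x where "x \<notin> {x. poly (p * q) x = 0} \<union> B"
    using infinite_alg_closed ex_new_if_finite by blast
  with p q show ?thesis by auto
qed

lemma PU_eq_0: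
  fixes f :: "'a::alg_closed_field \<Rightarrow> 'a"
  assumes "f \<in> PU" "finite B" "\<And>x. x \<notin> B \<Longrightarrow> f x = 0" shows "f x = 0"
  using PU_mult_nonzero[OF assms(1,1) _ _ assms(2)] assms(3) by blast

text \<open>The polynomial functions vanishing on \<open>Z\<close> form a prime ideal. The set need
  not be closed, so that images of parametrisations can be treated directly.\<close>

definition irred_set :: "(nat \<Rightarrow> 'a::comm_ring_1) set \<Rightarrow> bool" where
  "irred_set Z \<longleftrightarrow> Z \<noteq> {} \<and> (\<forall>f\<in>PV. \<forall>g\<in>PV. (\<exists>a\<in>Z. f a \<noteq> 0) \<longrightarrow> (\<exists>b\<in>Z. g b \<noteq> 0) \<longrightarrow>
     (\<exists>x\<in>Z. f x \<noteq> 0 \<and> g x \<noteq> 0))"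

lemma irred_setD:
  assumes "irred_set Z" "f \<in> PV" "g \<in> PV" "a \<in> Z" "f a \<noteq> 0" "b \<in> Z" "g b \<noteq> 0"
  obtains x where "x \<in> Z" "f x \<noteq> 0" "g x \<noteq> 0"
  using assms unfolding irred_set_def by blast

lemma irred_set_prod:
  fixes Z :: "(nat \<Rightarrow> 'a::idom) set"
  assumes "irred_set Z" "finite I" "\<And>i. i \<in> I \<Longrightarrow> f i \<in> PV" "\<And>i. i \<in> I \<Longrightarrow> \<exists>a\<in>Z. f i a \<noteq> 0"
  shows "\<exists>a\<in>Z. \<forall>i\<in>I. f i a \<noteq> 0"
  using assms(2-)
proof (induction I rule: finite_induct)
  case empty
  then show ?case using assms(1) by (auto simp: irred_set_def)
next
  case (insert j I)
  then obtain a where a: "a \<in> Z" "\<forall>i\<in>I. f i a \<noteq> 0" by auto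
  obtain b where b: "b \<in> Z" "f j b \<noteq> 0" using insert(5)[of j] by blast
  have P: "(\<lambda>x. \<Prod>i\<in>I. f i x) \<in> PV" using insert by (auto intro: polyfuns_intros)
  have F: "f j \<in> PV" using insert by auto
  obtain x where "x \<in> Z" "(\<Prod>i\<in>I. f i x) \<noteq> 0" "f j x \<noteq> 0"
    by (rule irred_setD[OF assms(1) P F a(1) _ b]) (use a insert in auto)
  then show ?case using insert by auto
qed

text \<open>Two points of the source are joined by a line. Along it both functions become
  polynomials in one variable, each nonzero at one end, and over an infinite field their product has
  a nonroot.\<close>

lemma irred_set_image:
  fixes h :: "(nat \<Rightarrow> 'a::alg_closed_field) \<Rightarrow> (nat \<Rightarrow> 'a)"
  assumes h: "\<And>i. (\<lambda>x. h x i) \<in> PV"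
  shows "irred_set (range h)"
  unfolding irred_set_def
proof (intro conjI ballI impI)
  fix f g :: "(nat \<Rightarrow> 'a) \<Rightarrow> 'a" assume f: "f \<in> PV" and g: "g \<in> PV"
  assume "\<exists>a\<in>range h. f a \<noteq> 0" "\<exists>b\<in>range h. g b \<noteq> 0"
  then obtain a b where ab: "f (h a) \<noteq> 0" "g (h b) \<noteq> 0" by auto
  define l where "l t = (\<lambda>i. (1 - t) * a i + t * b i)" for t :: 'a
  have l: "(\<lambda>t. l t i) \<in> PU" for i unfolding l_def by (intro polyfuns_intros)
  have fh: "(\<lambda>x. f (h x)) \<in> PV" "(\<lambda>x. g (h x)) \<in> PV"
    by (rule PV_subst[OF f h], rule PV_subst[OF g h])
  have "(\<lambda>t. f (h (l t))) \<in> PU" "(\<lambda>t. g (h (l t))) \<in> PU"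
    by (rule PV_subst[OF fh(1) l], rule PV_subst[OF fh(2) l])
  moreover have "l 0 = a" "l 1 = b" by (auto simp: l_def)
  ultimately obtain t where "f (h (l t)) \<noteq> 0" "g (h (l t)) \<noteq> 0"
    using PU_mult_nonzero[of "\<lambda>t. f (h (l t))" "\<lambda>t. g (h (l t))" 0 1 "{}"] ab by auto
  then show "\<exists>x\<in>range h. f x \<noteq> 0 \<and> g x \<noteq> 0" by auto
qed auto

lemma irred_UNIV: "irred_set (UNIV :: (nat \<Rightarrow> 'a::alg_closed_field) set)"
  using irred_set_image[of "\<lambda>x. x"] by (auto intro: polyfuns_intros)

section \<open>Linear systems and divisibility in \<open>K[t][x]\<close>\<close>

lemma homogeneous_system_nontrivial:
  fixes a :: "'i \<Rightarrow> 'j \<Rightarrow> 'a::field"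
  assumes "finite I" "finite J" "card I < card J"
  shows "\<exists>c. (\<exists>j\<in>J. c j \<noteq> 0) \<and> (\<forall>i\<in>I. (\<Sum>j\<in>J. a i j * c j) = 0)"
  using assms
proof (induction I arbitrary: J a rule: finite_induct)
  case empty
  then obtain j where "j \<in> J" by fastforce
  then show ?case by (intro exI[of _ "\<lambda>_. 1"]) auto
next
  case (insert i I)
  show ?case
  proof (cases "\<forall>j\<in>J. a i j = 0")
    case True
    have "card I < card J" using insert by simp
    from insert.IH[OF insert.prems(1) this, of a] obtain c where
      "\<exists>j\<in>J. c j \<noteq> 0" "\<forall>i\<in>I. (\<Sum>j\<in>J. a i j * c j) = 0" by blast
    with True show ?thesis by (intro exI[of _ c]) simp
  next
    case False
    then obtain j0 where j0: "j0 \<in> J" "a i j0 \<noteq> 0" by blast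
    define J' where "J' = J - {j0}"
    have J': "finite J'" "card I < card J'" "J = insert j0 J'" "j0 \<notin> J'"
      using insert j0 by (auto simp: J'_def card_Diff_singleton)
    obtain c where c: "\<exists>j\<in>J'. c j \<noteq> 0"
      "\<forall>k\<in>I. (\<Sum>j\<in>J'. (a k j - a k j0 * a i j / a i j0) * c j) = 0"
      using insert.IH[OF J'(1,2), of "\<lambda>k j. a k j - a k j0 * a i j / a i j0"] by blast
    define d where "d = (\<lambda>j. if j = j0 then - (\<Sum>j\<in>J'. a i j * c j) / a i j0 else c j)"
    have d: "(\<Sum>j\<in>J. a k j * d j) = a k j0 * d j0 + (\<Sum>j\<in>J'. a k j * c j)" for k
    proof -
      have "(\<Sum>j\<in>J'. a k j * d j) = (\<Sum>j\<in>J'. a k j * c j)"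
        using J'(4) by (intro sum.cong) (auto simp: d_def)
      then show ?thesis using J' by simp
    qed
    show ?thesis
    proof (intro exI[of _ d] conjI ballI)
      show "\<exists>j\<in>J. d j \<noteq> 0" using c(1) J'(3,4) by (auto simp: d_def)
      fix k assume "k \<in> insert i I"
      then consider "k = i" | "k \<in> I" by auto
      then show "(\<Sum>j\<in>J. a k j * d j) = 0"
      proof cases
        case 1
        then show ?thesis using j0 by (simp add: d) (simp add: d_def)
      next
        case 2
        have "0 = (\<Sum>j\<in>J'. (a k j - a k j0 * a i j / a i j0) * c j)" using c(2) 2 by auto
        also have "\<dots> = (\<Sum>j\<in>J'. a k j * c j) - a k j0 / a i j0 * (\<Sum>j\<in>J'. a i j * c j)"
          by (simp add: sum_subtractf sum_distrib_left algebra_simps)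
        finally show ?thesis by (simp add: d) (simp add: d_def)
      qed
    qed
  qed
qed


lemma positive_degree_prime_factor:
  fixes h :: "'a::field_gcd poly poly"
  assumes "degree h > 0"
  obtains q where "prime_elem q" "q dvd h" "degree q > 0"
proof -
  have h0: "h \<noteq> 0" using assms by auto
  obtain A where A: "\<forall>x\<in>#A. prime x" "normalize (prod_mset A) = normalize h"
    using prime_factorization_exists'[OF h0] by metis
  have "\<exists>q\<in>#A. degree q > 0"
  proof (rule ccontr)
    assume "\<not> ?thesis"
    then have "\<forall>q\<in>#A. degree q = 0" by auto
    then have "degree (prod_mset A) = 0"
    proof (induction A)
      case (add x A)
      have "degree (x * prod_mset A) \<le> degree x + degree (prod_mset A)" by (rule degree_mult_le)
      with add show ?case by simp
    qed simp
    moreover have "prod_mset A dvd h" "h dvd prod_mset A"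
      using A(2) by (simp_all add: associated_iff_dvd)
    ultimately have "degree h \<le> 0" using dvd_imp_degree_le[of h "prod_mset A"] h0 A(2)
      by (metis normalize_eq_0_iff)
    with assms show False by simp
  qed
  then obtain q where q: "q \<in># A" "degree q > 0" by auto
  have "q dvd prod_mset A" using q(1) by (rule dvd_prod_mset)
  then have "q dvd h" using A(2) by (metis associated_iff_dvd dvd_trans)
  with that q A(1) show thesis by auto
qed

text \<open>A nonzero element of least degree in the ideal generated by \<open>f\<close> and \<open>g\<close> divides both of them
  up to constants from the coefficient ring.\<close>

lemma bezout_poly_poly:
  fixes f g :: "'a::field_gcd poly poly"
  assumes f: "f \<noteq> 0" and no: "\<And>q. prime_elem q \<Longrightarrow> q dvd f \<Longrightarrow> q dvd g \<Longrightarrow> degree q = 0"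
  shows "\<exists>a b r. r \<noteq> 0 \<and> a * f + b * g = [:r:]"
proof -
  define P where "P h \<longleftrightarrow> h \<noteq> 0 \<and> (\<exists>a b. h = a * f + b * g)" for h
  have "P f" unfolding P_def by (intro conjI exI[of _ 1] exI[of _ 0]) (use f in simp_all)
  then obtain h where h: "P h" and least: "\<And>k. P k \<Longrightarrow> degree h \<le> degree k"
    using ex_has_least_nat[of P f degree] by blast
  then obtain a b where hab: "h = a * f + b * g" "h \<noteq> 0" by (auto simp: P_def)
  \<comment> \<open>The leading coefficient of \<open>h\<close> is only a polynomial, so
    pseudo-division takes the place of division with remainder. The remainder stays in the ideal,
    and minimality of the degree of \<open>h\<close> makes it zero.\<close>
  have red: "\<exists>c. c \<noteq> 0 \<and> h dvd smult c k" if k: "k = u * f + v * g" for k u v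
  proof -
    obtain q r where qr: "pseudo_divmod k h = (q, r)" by fastforce
    define c where "c = coeff h (degree h) ^ (Suc (degree k) - degree h)"
    have 1: "smult c k = h * q + r" "r = 0 \<or> degree r < degree h"
      using pseudo_divmod[OF hab(2) qr] by (auto simp: c_def)
    have "r = (smult c u - a * q) * f + (smult c v - b * q) * g"
      using 1(1) by (simp add: k hab(1) algebra_simps smult_add_right)
    then have "r = 0" using 1(2) least[of r] unfolding P_def by fastforce
    with 1 have "h dvd smult c k" by simp
    moreover have "c \<noteq> 0" using hab(2) by (simp add: c_def)
    ultimately show ?thesis by blast
  qed
  have "degree h = 0"
  proof (rule ccontr)
    assume "degree h \<noteq> 0"
    then obtain q where q: "prime_elem q" "q dvd h" "degree q > 0"
      using positive_degree_prime_factor[of h] by auto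
    have "q dvd k" if k: "k = u * f + v * g" for k u v
    proof -
      obtain c where c: "c \<noteq> 0" "h dvd smult c k" using red[OF k] by blast
      then have "q dvd [:c:] * k" using q(2) dvd_trans by simp
      moreover have "\<not> q dvd [:c:]"
        using dvd_imp_degree_le[of q "[:c:]"] c(1) q(3) by auto
      ultimately show ?thesis using prime_elem_dvd_multD[OF q(1)] by blast
    qed
    from this[of f 1 0] this[of g 0 1] have "q dvd f" "q dvd g" by auto
    with no q show False by auto
  qed
  then obtain r where r: "h = [:r:]" by (meson degree_eq_zeroE)
  with hab(2) have "r \<noteq> 0" by auto
  moreover have "a * f + b * g = [:r:]" using hab(1) r by simp
  ultimately show ?thesis by blast
qed

lemma gcd_cofactors:
  fixes q c :: "'a::field_gcd poly"
  assumes "q \<noteq> 0"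
  obtains g q' c' where "q = g * q'" "c = g * c'" "g \<noteq> 0" "coprime q' c'"
    "\<And>x. poly q' x = 0 \<Longrightarrow> poly c' x \<noteq> 0"
proof -
  have "gcd q c \<noteq> 0" using assms by simp
  then obtain q' c' where *: "q = q' * gcd q c" "c = c' * gcd q c" "coprime q' c'"
    using gcd_coprime_exists by blast
  have "poly c' x \<noteq> 0" if "poly q' x = 0" for x
  proof
    assume "poly c' x = 0"
    then have "[:-x, 1:] dvd q'" "[:-x, 1:] dvd c'" using that by (auto simp: poly_eq_0_iff_dvd)
    then have "is_unit [:-x, 1:]" using *(3) by (meson coprime_common_divisor)
    then show False by (simp add: is_unit_iff_degree)
  qed
  then show thesis using that[of "gcd q c" q' c'] * \<open>gcd q c \<noteq> 0\<close> by (simp add: mult.commute)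
qed

section \<open>Cubic forms and their polarisation\<close>

definition lc :: "'a::comm_ring_1 \<Rightarrow> (nat \<Rightarrow> 'a) \<Rightarrow> 'a \<Rightarrow> (nat \<Rightarrow> 'a) \<Rightarrow> nat \<Rightarrow> 'a" where
  "lc a x b y = (\<lambda>i. a * x i + b * y i)"

text \<open>Vectors have infinitely many coordinates, and a linear functional need not be determined
  by finitely many of them. Membership in \<open>PV\<close> ensures this.\<close>

definition lin :: "((nat \<Rightarrow> 'a) \<Rightarrow> 'a::comm_ring_1) \<Rightarrow> bool" where
  "lin \<phi> \<longleftrightarrow> \<phi> \<in> PV \<and> (\<forall>a x b y. \<phi> (lc a x b y) = a * \<phi> x + b * \<phi> y)"

lemma lin_PV: "lin \<phi> \<Longrightarrow> \<phi> \<in> PV"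
  and lin_lc: "lin \<phi> \<Longrightarrow> \<phi> (lc a x b y) = a * \<phi> x + b * \<phi> y"
  by (auto simp: lin_def)

lemma lin_coord: "lin (\<lambda>x. x i)"
  by (auto simp: lin_def lc_def PV_coord)

lemma lin_comb: "lin \<phi> \<Longrightarrow> lin \<psi> \<Longrightarrow> lin (\<lambda>x. a * \<phi> x + b * \<psi> x)"
  by (auto simp: lin_def algebra_simps intro!: polyfuns_intros)

lemma lin_sum:
  assumes "lin \<phi>" "finite J"
  shows "\<phi> (\<lambda>i. \<Sum>j\<in>J. c j * e j i) = (\<Sum>j\<in>J. c j * \<phi> (e j))"
  using assms(2)
proof (induction J rule: finite_induct)
  case empty
  show ?case using lin_lc[OF assms(1), of 0 "\<lambda>_. 0" 0 "\<lambda>_. 0"] by (simp add: lc_def)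
next
  case (insert j J)
  have "(\<lambda>i. \<Sum>j\<in>insert j J. c j * e j i) = lc (c j) (e j) 1 (\<lambda>i. \<Sum>j\<in>J. c j * e j i)"
    using insert by (auto simp: lc_def)
  with insert show ?case by (simp add: lin_lc[OF assms(1)])
qed

lemma lc_polyfuns:
  assumes "a \<in> polyfuns D S" "b \<in> polyfuns D S"
    "(\<lambda>x. f x i) \<in> polyfuns D S" "(\<lambda>x. g x i) \<in> polyfuns D S"
  shows "(\<lambda>x. lc (a x) (f x) (b x) (g x) i) \<in> polyfuns D S"
  unfolding lc_def by (intro polyfuns.add polyfuns.mult assms)

lemma lc_simps [simp]: "lc 1 x 0 y = x" "lc 0 x 1 y = y"
  by (auto simp: lc_def)

lemma cubic_coeffs_eq_0:
  fixes a :: "'a::alg_closed_field"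
  assumes "finite B" "\<And>t. t \<notin> B \<Longrightarrow> a + t * b + t^2 * c + t^3 * d = 0"
  shows "a = 0 \<and> b = 0 \<and> c = 0 \<and> d = 0"
proof -
  have "infinite (- B)" using assms(1) infinite_alg_closed by (metis finite_compl)
  then have "[:a, b, c, d:] = 0"
    by (rule poly_eq_0_infinite) (use assms(2) in \<open>auto simp: algebra_simps power2_eq_square power3_eq_cube\<close>)
  then show ?thesis by simp
qed

lemma quadratic_root:
  fixes a :: "'a::alg_closed_field"
  assumes "c \<noteq> 0" obtains t where "a + t * b + t^2 * c = 0"
proof -
  have "degree [:a, b, c:] > 0" using assms by simp
  then obtain t where "poly [:a, b, c:] t = 0" using alg_closed_imp_poly_has_root by blast
  with that[of t] show thesis by (simp add: algebra_simps power2_eq_square)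
qed

lemma cubic_root:
  fixes a :: "'a::alg_closed_field"
  assumes "d \<noteq> 0" obtains t where "a + t * b + t^2 * c + t^3 * d = 0"
proof -
  have "degree [:a, b, c, d:] > 0" using assms by simp
  then obtain t where "poly [:a, b, c, d:] t = 0" using alg_closed_imp_poly_has_root by blast
  with that[of t] show thesis by (simp add: algebra_simps power2_eq_square power3_eq_cube)
qed

text \<open>Each monomial is stored as a triple of variables, so that the gradient and the
  polarisation have termwise integral formulas, valid in characteristics two and three as well.
  Vectors are functions on all naturals, of which only the coordinates up to \<open>N\<close>
  enter.\<close>

locale cubic =
  fixes N :: nat and E :: "'e set" and cf :: "'e \<Rightarrow> 'a::{alg_closed_field,field_gcd}"
    and ia ja ka :: "'e \<Rightarrow> nat"
  assumes idx: "\<And>e. e \<in> E \<Longrightarrow> ia e \<le> N \<and> ja e \<le> N \<and> ka e \<le> N"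
begin

definition F :: "(nat \<Rightarrow> 'a) \<Rightarrow> 'a" where
  "F x = (\<Sum>e\<in>E. cf e * (x (ia e) * x (ja e) * x (ka e)))"

text \<open>The differential of \<open>F\<close> at \<open>x\<close> applied to \<open>v\<close>,
  quadratic in \<open>x\<close> and linear in \<open>v\<close>. As an equation in \<open>v\<close>,
  \<open>A x v = 0\<close> is the tangent hyperplane at a point \<open>x\<close> of the cubic, while
  \<open>A v x = 0\<close> is the polar quadric of \<open>x\<close>.\<close>

definition A :: "(nat \<Rightarrow> 'a) \<Rightarrow> (nat \<Rightarrow> 'a) \<Rightarrow> 'a" where
  "A x v = (\<Sum>e\<in>E. cf e * (v (ia e) * x (ja e) * x (ka e) + x (ia e) * v (ja e) * x (ka e)
     + x (ia e) * x (ja e) * v (ka e)))"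

text \<open>The full polarisation, a symmetric trilinear form with \<open>B x x x = 6 * F x\<close>.
  It is the cross term of the quadratic map \<open>A\<close>.\<close>

definition B :: "(nat \<Rightarrow> 'a) \<Rightarrow> (nat \<Rightarrow> 'a) \<Rightarrow> (nat \<Rightarrow> 'a) \<Rightarrow> 'a" where
  "B x y z = (\<Sum>e\<in>E. cf e * (x (ia e) * y (ja e) * z (ka e) + x (ia e) * z (ja e) * y (ka e)
     + y (ia e) * x (ja e) * z (ka e) + y (ia e) * z (ja e) * x (ka e)
     + z (ia e) * x (ja e) * y (ka e) + z (ia e) * y (ja e) * x (ka e)))"

definition nz :: "(nat \<Rightarrow> 'a) \<Rightarrow> bool" where
  "nz x \<longleftrightarrow> (\<exists>i\<le>N. x i \<noteq> 0)"

lemma F_lc: "F (lc a x b y) = a^3 * F x + a^2 * b * A x y + a * b^2 * A y x + b^3 * F y"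
  unfolding F_def A_def lc_def sum_distrib_left sum.distrib[symmetric]
  by (intro sum.cong) (auto simp: algebra_simps power2_eq_square power3_eq_cube)

lemma A_lc: "A x (lc a y b z) = a * A x y + b * A x z"
  unfolding A_def lc_def sum_distrib_left sum.distrib[symmetric]
  by (intro sum.cong) (auto simp: algebra_simps)

lemma A_lc': "A (lc a x b y) z = a^2 * A x z + a * b * B x y z + b^2 * A y z"
  unfolding A_def B_def lc_def sum_distrib_left sum.distrib[symmetric]
  by (intro sum.cong) (auto simp: algebra_simps power2_eq_square)

lemma B_commute: "B x y z = B y x z" "B x y z = B x z y"
  unfolding B_def by (auto intro!: sum.cong simp: algebra_simps)

lemma B_lc: "B x y (lc a z b w) = a * B x y z + b * B x y w"
  unfolding B_def lc_def sum_distrib_left sum.distrib[symmetric]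
  by (intro sum.cong) (auto simp: algebra_simps)

lemma B_diag: "B x x z = 2 * A x z" "B x z x = 2 * A x z" "B z x x = 2 * A x z"
proof -
  show "B x x z = 2 * A x z"
    unfolding A_def B_def sum_distrib_left by (intro sum.cong) (auto simp: algebra_simps)
  then show "B x z x = 2 * A x z" "B z x x = 2 * A x z" using B_commute by metis+
qed

lemma A_self: "A x x = 3 * F x"
  unfolding A_def F_def sum_distrib_left by (intro sum.cong) (auto simp: algebra_simps)

lemma F_scale: "F (\<lambda>i. c * x i) = c^3 * F x"
  using F_lc[of c x 0 x] by (simp add: lc_def)

lemma A_scale: "A (\<lambda>i. c * x i) v = c^2 * A x v"
  using A_lc'[of c x 0 x] by (simp add: lc_def)

lemma A_scale': "A v (\<lambda>i. c * x i) = c * A v x"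
  using A_lc[of v c x 0 x] by (simp add: lc_def)

lemma polyfuns_F:
  assumes "\<And>i. i \<le> N \<Longrightarrow> (\<lambda>x. h x i) \<in> polyfuns D S" "cf ` E \<subseteq> S" "0 \<in> S"
  shows "(\<lambda>x. F (h x)) \<in> polyfuns D S"
  unfolding F_def using assms(2,3) idx
  by (intro polyfuns_sum polyfuns.mult polyfuns.const assms(1)) auto

lemma polyfuns_A:
  assumes "\<And>i. i \<le> N \<Longrightarrow> (\<lambda>x. h x i) \<in> polyfuns D S" "\<And>i. i \<le> N \<Longrightarrow> (\<lambda>x. g x i) \<in> polyfuns D S"
    "cf ` E \<subseteq> S" "0 \<in> S"
  shows "(\<lambda>x. A (h x) (g x)) \<in> polyfuns D S"
  unfolding A_def using assms(3,4) idx
  by (intro polyfuns_sum polyfuns.mult polyfuns.add polyfuns.const assms(1,2)) auto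

lemma polyfuns_B:
  assumes "\<And>i. i \<le> N \<Longrightarrow> (\<lambda>x. f x i) \<in> polyfuns D S" "\<And>i. i \<le> N \<Longrightarrow> (\<lambda>x. g x i) \<in> polyfuns D S"
    "\<And>i. i \<le> N \<Longrightarrow> (\<lambda>x. h x i) \<in> polyfuns D S" "cf ` E \<subseteq> S" "0 \<in> S"
  shows "(\<lambda>x. B (f x) (g x) (h x)) \<in> polyfuns D S"
  unfolding B_def using assms(4,5) idx
  by (intro polyfuns_sum polyfuns.mult polyfuns.add polyfuns.const assms(1,2,3)) auto

lemmas cubic_intros = polyfuns_intros lc_polyfuns
  polyfuns_F[OF _ subset_UNIV UNIV_I] polyfuns_A[OF _ _ subset_UNIV UNIV_I]
  polyfuns_B[OF _ _ _ subset_UNIV UNIV_I]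

lemma lin_A: "lin (A x)"
  by (auto simp: lin_def A_lc intro!: cubic_intros)

lemma not_nz:
  assumes "\<not> nz x" shows "F x = 0" "A x v = 0" "A v x = 0"
  using assms idx unfolding F_def A_def nz_def by (auto intro!: sum.neutral)

lemma F_cong: "(\<And>i. i \<le> N \<Longrightarrow> x i = y i) \<Longrightarrow> F x = F y"
  unfolding F_def using idx by (intro sum.cong) auto

lemma A_cong: "(\<And>i. i \<le> N \<Longrightarrow> x i = y i) \<Longrightarrow> (\<And>i. i \<le> N \<Longrightarrow> v i = w i) \<Longrightarrow> A x v = A y w"
  unfolding A_def using idx by (intro sum.cong) auto

lemma nz_A: "A v x \<noteq> 0 \<Longrightarrow> nz x" "A x v \<noteq> 0 \<Longrightarrow> nz x"
  using not_nz by blast+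

lemma line_tangent:
  assumes "finite T" "\<And>t. t \<notin> T \<Longrightarrow> F (lc 1 x t y) = 0"
  shows "F x = 0 \<and> A x y = 0 \<and> A y x = 0 \<and> F y = 0"
  using cubic_coeffs_eq_0[OF assms(1), of "F x" "A x y" "A y x" "F y"] assms(2)
  by (simp add: F_lc algebra_simps)

end

locale smooth_cubic = cubic N E cf ia ja ka
  for N and E :: "'e set" and cf :: "'e \<Rightarrow> 'a::{alg_closed_field,field_gcd}" and ia ja ka +
  assumes N3: "N \<ge> 3" and smooth: "\<And>x. F x = 0 \<Longrightarrow> nz x \<Longrightarrow> \<exists>v. A x v \<noteq> 0"
begin

text \<open>Four coordinates are available because \<open>N \<ge> 3\<close>, and three linear
  equations in four unknowns have a nontrivial solution. Dimension at least two of the cubic enters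
  here.\<close>

lemma kernel3:
  assumes "lin \<phi>1" "lin \<phi>2" "lin \<phi>3"
  shows "\<exists>x. nz x \<and> \<phi>1 x = 0 \<and> \<phi>2 x = 0 \<and> \<phi>3 x = 0"
proof -
  define e :: "nat \<Rightarrow> nat \<Rightarrow> 'a" where "e j = (\<lambda>i. if i = j then 1 else 0)" for j
  define a where "a k j = [\<phi>1 (e j), \<phi>2 (e j), \<phi>3 (e j)] ! k" for k j
  obtain c where c: "\<exists>j\<in>{..3}. c j \<noteq> 0" "\<forall>k\<in>{..<3}. (\<Sum>j\<in>{..3}. a k j * c j) = 0"
    using homogeneous_system_nontrivial[of "{..<3::nat}" "{..3::nat}" a] by auto
  define x where "x = (\<lambda>i. \<Sum>j\<in>{..3}. c j * e j i)"
  have xi: "x i = (if i \<le> 3 then c i else 0)" for i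
    unfolding x_def e_def by (auto simp: if_distrib cong: if_cong)
  have "\<phi> x = (\<Sum>j\<in>{..3}. \<phi> (e j) * c j)" if "lin \<phi>" for \<phi>
    unfolding x_def by (subst lin_sum[OF that]) (auto simp: mult.commute)
  then have "\<phi>1 x = 0" "\<phi>2 x = 0" "\<phi>3 x = 0"
    using assms c(2)[rule_format, of 0] c(2)[rule_format, of 1] c(2)[rule_format, of 2]
    by (simp_all add: a_def)
  moreover have "nz x" using c(1) N3 unfolding nz_def by (auto simp: xi)
  ultimately show ?thesis by blast
qed

text \<open>The coordinate \<open>i\<close> certifies that the two vectors are independent;
  \<open>nz_lc\<close> turns this into nonvanishing of their nontrivial combinations.\<close>

lemma kernel2_pair:
  assumes "lin \<phi>1" "lin \<phi>2"
  obtains y y' i where "\<phi>1 y = 0" "\<phi>2 y = 0" "\<phi>1 y' = 0" "\<phi>2 y' = 0" "i \<le> N" "y i \<noteq> 0" "y' i = 0" "nz y'"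
proof -
  obtain y where y: "nz y" "\<phi>1 y = 0" "\<phi>2 y = 0" using kernel3[OF assms assms(2)] by blast
  then obtain i where i: "i \<le> N" "y i \<noteq> 0" by (auto simp: nz_def)
  obtain y' where "nz y'" "\<phi>1 y' = 0" "\<phi>2 y' = 0" "y' i = 0"
    using kernel3[OF assms lin_coord[of i]] by blast
  with y i that show thesis by blast
qed

lemma nz_lc:
  assumes "i \<le> N" "y i \<noteq> 0" "y' i = 0" "nz y'" "a \<noteq> 0 \<or> b \<noteq> 0"
  shows "nz (lc a y b y')"
proof (cases "a = 0")
  case True
  with assms(4,5) show ?thesis by (auto simp: nz_def lc_def)
next
  case False
  with assms show ?thesis by (auto simp: nz_def lc_def intro!: exI[of _ i])
qed

text \<open>All derivatives inside the hyperplane vanish along it. The derivative in the transversal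
  direction \<open>e\<close> is a quadratic function there, so it has a zero on the line through
  \<open>y\<close> and \<open>y'\<close>. That zero is a singular point.\<close>

lemma no_hyperplane:
  assumes "lin \<phi>" "\<phi> e \<noteq> 0" "\<And>v. \<phi> v = 0 \<Longrightarrow> F v = 0" shows False
proof -
  obtain y y' i where y: "\<phi> y = 0" "\<phi> y' = 0" "i \<le> N" "y i \<noteq> 0" "y' i = 0" "nz y'"
    using kernel2_pair[OF assms(1,1)] by metis
  have "\<exists>v. nz v \<and> \<phi> v = 0 \<and> A v e = 0"
  proof (cases "A y' e = 0")
    case True with y show ?thesis by blast
  next
    case False
    then obtain t where "A y e + t * B y y' e + t^2 * A y' e = 0" using quadratic_root by blast
    then have "A (lc 1 y t y') e = 0" by (simp add: A_lc')
    moreover have "nz (lc 1 y t y')" using nz_lc[of i y y' 1 t] y by simp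
    moreover have "\<phi> (lc 1 y t y') = 0" using y by (simp add: lin_lc[OF assms(1)])
    ultimately show ?thesis by blast
  qed
  then obtain v where v: "nz v" "\<phi> v = 0" "A v e = 0" by blast
  have ker: "A v w = 0" if "\<phi> w = 0" for w
    using line_tangent[of "{}" v w] assms(3) v(2) that by (simp add: lin_lc[OF assms(1)])
  have "A v w = 0" for w
  proof -
    have "A v (lc 1 w (- \<phi> w / \<phi> e) e) = 0"
      by (rule ker) (use assms(2) in \<open>simp add: lin_lc[OF assms(1)]\<close>)
    with v(3) show ?thesis by (simp add: A_lc)
  qed
  moreover have "F v = 0" using assms(3) v(2) by blast
  ultimately show False using smooth v(1) by blast
qed

lemma F_nonzero: "\<exists>b. F b \<noteq> 0"
proof (rule ccontr)
  assume "\<not> ?thesis"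
  then show False
    using no_hyperplane[of "\<lambda>x. x 0" "\<lambda>_. 1"] lin_coord[of 0] by auto
qed

text \<open>Take \<open>b\<close> off the hyperplane and off the cubic. For \<open>y\<close> in the
  hyperplane, some \<open>y + t b\<close> lies on the cubic. If the cubic were inside the
  hyperplane, then \<open>t = 0\<close> and \<open>F y = 0\<close>, so the cubic would contain the
  whole hyperplane.\<close>

lemma lin_nonzero_on_X:
  assumes "lin \<phi>" "\<phi> e \<noteq> 0" shows "\<exists>x. F x = 0 \<and> \<phi> x \<noteq> 0"
proof (rule ccontr)
  assume contra: "\<not> ?thesis"
  obtain b0 where "F b0 \<noteq> 0" using F_nonzero by blast
  moreover have "F \<in> PV" by (intro cubic_intros)
  ultimately obtain b where b: "\<phi> b \<noteq> 0" "F b \<noteq> 0"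
    using irred_setD[OF irred_UNIV lin_PV[OF assms(1)], of F e b0] assms(2) by auto
  have "F y = 0" if y: "\<phi> y = 0" for y
  proof (rule ccontr)
    assume "F y \<noteq> 0"
    obtain t where t: "F y + t * A y b + t^2 * A b y + t^3 * F b = 0" using cubic_root[OF b(2)] by blast
    then have "F (lc 1 y t b) = 0" by (simp add: F_lc)
    with contra have "\<phi> (lc 1 y t b) = 0" by blast
    with b(1) y have "t = 0" by (simp add: lin_lc[OF assms(1)])
    with t \<open>F y \<noteq> 0\<close> show False by simp
  qed
  with no_hyperplane[OF assms] show False by blast
qed

end

section \<open>Evaluation of polynomials\<close>

definition mp_monom :: "(nat \<Rightarrow>\<^sub>0 nat) \<Rightarrow> (nat \<Rightarrow> 'a::comm_semiring_1) \<Rightarrow> 'a" where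
  "mp_monom e x = (\<Prod>i\<in>Poly_Mapping.keys e. x i ^ Poly_Mapping.lookup e i)"

lemma mp_monom_superset:
  assumes "finite S" "Poly_Mapping.keys e \<subseteq> S"
  shows "mp_monom e x = (\<Prod>i\<in>S. x i ^ Poly_Mapping.lookup e i)"
  unfolding mp_monom_def
  by (rule prod.mono_neutral_left) (use assms in \<open>auto simp: in_keys_iff\<close>)

lemma mp_monom_add: "mp_monom (e + e') x = mp_monom e x * mp_monom e' x"
proof -
  let ?S = "Poly_Mapping.keys e \<union> Poly_Mapping.keys e'"
  have "mp_monom (e + e') x = (\<Prod>i\<in>?S. x i ^ Poly_Mapping.lookup (e + e') i)"
    by (rule mp_monom_superset) (use Poly_Mapping.keys_add[of e e'] in auto)
  also have "\<dots> = (\<Prod>i\<in>?S. x i ^ Poly_Mapping.lookup e i) * (\<Prod>i\<in>?S. x i ^ Poly_Mapping.lookup e' i)"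
    by (simp add: lookup_add power_add prod.distrib)
  also have "\<dots> = mp_monom e x * mp_monom e' x"
    by (subst (1 2) mp_monom_superset[of ?S]) auto
  finally show ?thesis .
qed

lemma mp_eval_superset:
  assumes "finite S" "Poly_Mapping.keys p \<subseteq> S"
  shows "mp_eval p x = (\<Sum>e\<in>S. Poly_Mapping.lookup p e * mp_monom e x)"
  unfolding mp_eval_def mp_monom_def[symmetric]
  by (rule sum.mono_neutral_left) (use assms in \<open>auto simp: in_keys_iff\<close>)

lemma mp_eval_0 [simp]: "mp_eval 0 x = 0"
  by (simp add: mp_eval_def)

lemma mp_eval_single [simp]: "mp_eval (Poly_Mapping.single e c) x = c * mp_monom e x"
  by (subst mp_eval_superset[of "{e}"]) auto

lemma mp_eval_add: "mp_eval (p + q) x = mp_eval p x + mp_eval q x"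
proof -
  let ?S = "Poly_Mapping.keys p \<union> Poly_Mapping.keys q"
  have "mp_eval (p + q) x = (\<Sum>e\<in>?S. Poly_Mapping.lookup (p + q) e * mp_monom e x)"
    by (rule mp_eval_superset) (use Poly_Mapping.keys_add[of p q] in auto)
  then show ?thesis
    by (simp add: lookup_add algebra_simps sum.distrib mp_eval_superset[of ?S])
qed

lemma mp_eval_sum: "mp_eval (\<Sum>i\<in>I. f i) x = (\<Sum>i\<in>I. mp_eval (f i) x)"
  by (induction I rule: infinite_finite_induct) (auto simp: mp_eval_add)

lemma mpoly_sum_single: "p = (\<Sum>e\<in>Poly_Mapping.keys p. Poly_Mapping.single e (Poly_Mapping.lookup p e))"
  by (rule poly_mapping_eqI)
    (auto simp: lookup_sum lookup_single when_def in_keys_iff if_distrib sum.delta' cong: if_cong)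

lemma mp_eval_mult: "mp_eval (p * q) x = mp_eval p x * mp_eval q x"
proof -
  let ?s = "\<lambda>p e. Poly_Mapping.single e (Poly_Mapping.lookup p e)"
  have "p * q = (\<Sum>e\<in>Poly_Mapping.keys p. ?s p e) * (\<Sum>e\<in>Poly_Mapping.keys q. ?s q e)"
    by (rule arg_cong2[where f = "(*)", OF mpoly_sum_single mpoly_sum_single])
  also have "\<dots> = (\<Sum>e\<in>Poly_Mapping.keys p. \<Sum>e'\<in>Poly_Mapping.keys q. ?s p e * ?s q e')"
    by (simp add: sum_product)
  finally have "mp_eval (p * q) x = (\<Sum>e\<in>Poly_Mapping.keys p. \<Sum>e'\<in>Poly_Mapping.keys q.
      (Poly_Mapping.lookup p e * mp_monom e x) * (Poly_Mapping.lookup q e' * mp_monom e' x))"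
    by (simp add: mp_eval_sum mult_single mp_monom_add algebra_simps)
  then show ?thesis
    by (simp add: sum_product mp_eval_def mp_monom_def)
qed

lemma mp_eval_1 [simp]: "mp_eval 1 x = 1"
  unfolding single_one[symmetric] mp_eval_single by (simp add: mp_monom_def)

lemma mp_eval_uminus: "mp_eval (- p) x = - mp_eval (p :: 'a::comm_ring_1 mpoly) x"
  using mp_eval_add[of p "- p" x] by (simp add: minus_unique)

definition mp_const :: "'a::zero \<Rightarrow> 'a mpoly" where
  "mp_const c = Poly_Mapping.single 0 c"

definition mp_var :: "nat \<Rightarrow> 'a::comm_semiring_1 mpoly" where
  "mp_var i = Poly_Mapping.single (Poly_Mapping.single i 1) 1"

lemma mp_eval_const [simp]: "mp_eval (mp_const c) x = c"
  by (simp add: mp_const_def mp_monom_def)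

lemma mp_eval_var [simp]: "mp_eval (mp_var i) x = x i"
  by (simp add: mp_var_def mp_monom_def)

lemma mp_const_add: "mp_const (a + b) = mp_const a + mp_const b"
  and mp_const_mult: "mp_const (a * b) = mp_const a * mp_const (b :: 'a::comm_semiring_1)"
  and mp_const_0 [simp]: "mp_const 0 = 0"
  and mp_const_1 [simp]: "mp_const 1 = (1 :: 'a mpoly)"
  by (simp_all add: mp_const_def single_add mult_single)

lemma mp_const_uminus: "mp_const (- a) = - mp_const (a :: 'a::comm_ring_1)"
  by (simp add: mp_const_def single_uminus)

lemma mp_const_sum: "mp_const (\<Sum>i\<in>I. f i) = (\<Sum>i\<in>I. mp_const (f i :: 'a::comm_semiring_1))"
  by (induction I rule: infinite_finite_induct) (auto simp: mp_const_add)

section \<open>Spans of polynomials over the field of constants\<close>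

inductive_set mspan :: "'a::comm_ring_1 mpoly set \<Rightarrow> 'a mpoly set" for S where
  zero: "0 \<in> mspan S"
| step: "f \<in> mspan S \<Longrightarrow> t \<in> S \<Longrightarrow> mp_const c * t + f \<in> mspan S"

lemma mspan_add: "f \<in> mspan S \<Longrightarrow> g \<in> mspan S \<Longrightarrow> f + g \<in> mspan S"
  by (induction rule: mspan.induct) (auto simp: add.assoc intro: mspan.step)

lemma mspan_base: "t \<in> S \<Longrightarrow> mp_const c * t \<in> mspan S"
  using mspan.step[OF mspan.zero] by fastforce

lemma mspan_superset: "S \<subseteq> mspan S"
  using mspan_base[of _ S 1] by auto

lemma mspan_mult:
  assumes "f \<in> mspan S" "\<And>t. t \<in> S \<Longrightarrow> t * g \<in> mspan T" "\<And>c h. h \<in> mspan T \<Longrightarrow> mp_const c * h \<in> mspan T"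
  shows "f * g \<in> mspan T"
  using assms(1)
proof induction
  case (step f t c)
  have "(mp_const c * t + f) * g = mp_const c * (t * g) + f * g" by (simp add: algebra_simps)
  with step assms show ?case by (auto intro: mspan_add)
qed (auto intro: mspan.zero)

lemma mspan_scale: "f \<in> mspan S \<Longrightarrow> mp_const c * f \<in> mspan S"
proof (induction rule: mspan.induct)
  case (step f t d)
  have "mp_const c * (mp_const d * t + f) = mp_const (c * d) * t + mp_const c * f"
    by (simp add: algebra_simps mp_const_mult)
  with step show ?case by (auto intro: mspan.step)
qed (auto intro: mspan.zero)

lemma mspan_sub: "S \<subseteq> mspan T \<Longrightarrow> mspan S \<subseteq> mspan T"
proof
  fix f assume S: "S \<subseteq> mspan T" "f \<in> mspan S"
  have "f * 1 \<in> mspan T" by (rule mspan_mult[OF S(2)]) (use S(1) mspan_scale in auto)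
  then show "f \<in> mspan T" by simp
qed

lemma mspan_sum: "(\<And>i. i \<in> I \<Longrightarrow> f i \<in> mspan S) \<Longrightarrow> (\<Sum>i\<in>I. f i) \<in> mspan S"
  by (induction I rule: infinite_finite_induct) (auto intro: mspan.zero mspan_add)

lemma mspan_finite:
  assumes "finite S" "f \<in> mspan S" shows "\<exists>c. f = (\<Sum>t\<in>S. mp_const (c t) * t)"
  using assms(2)
proof induction
  case zero
  show ?case by (rule exI[of _ "\<lambda>_. 0"]) simp
next
  case (step f t d)
  then obtain c where c: "f = (\<Sum>t\<in>S. mp_const (c t) * t)" by blast
  have "(\<Sum>s\<in>S. mp_const ((if s = t then d else 0) + c s) * s)
      = (\<Sum>s\<in>S. mp_const (if s = t then d else 0) * s) + f"
    by (simp add: mp_const_add algebra_simps sum.distrib c)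
  also have "(\<Sum>s\<in>S. mp_const (if s = t then d else 0) * s) = (\<Sum>s\<in>S. if s = t then mp_const d * t else 0)"
    by (intro sum.cong) auto
  also have "\<dots> = mp_const d * t" using step(2) assms(1) by simp
  finally show ?case by (intro exI[of _ "\<lambda>s. (if s = t then d else 0) + c s"]) simp
qed

lemma mspan_dependent:
  fixes e :: "'j \<Rightarrow> 'a::field mpoly"
  assumes "finite S" "finite J" "card S < card J" "\<And>j. j \<in> J \<Longrightarrow> e j \<in> mspan S"
  shows "\<exists>c. (\<exists>j\<in>J. c j \<noteq> 0) \<and> (\<Sum>j\<in>J. mp_const (c j) * e j) = 0"
proof -
  have "\<forall>j\<in>J. \<exists>c. e j = (\<Sum>t\<in>S. mp_const (c t) * t)"
    using mspan_finite[OF assms(1)] assms(4) by blast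
  then obtain a where a: "\<And>j. j \<in> J \<Longrightarrow> e j = (\<Sum>t\<in>S. mp_const (a j t) * t)"
    by metis
  obtain c where c: "\<exists>j\<in>J. c j \<noteq> 0" "\<forall>t\<in>S. (\<Sum>j\<in>J. a j t * c j) = 0"
    using homogeneous_system_nontrivial[OF assms(1-3), of "\<lambda>t j. a j t"] by blast
  have "(\<Sum>j\<in>J. mp_const (c j) * e j) = (\<Sum>j\<in>J. \<Sum>t\<in>S. mp_const (a j t * c j) * t)"
    using a by (intro sum.cong) (auto simp: sum_distrib_left mp_const_mult algebra_simps)
  also have "\<dots> = (\<Sum>t\<in>S. mp_const (\<Sum>j\<in>J. a j t * c j) * t)"
    by (subst sum.swap) (simp add: mp_const_sum sum_distrib_right)
  also have "\<dots> = 0" using c(2) by simp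
  finally show ?thesis using c(1) by blast
qed

section \<open>Common zeros of quadratic forms\<close>

fun monoms :: "nat \<Rightarrow> nat \<Rightarrow> 'a::comm_ring_1 mpoly set" where
  "monoms N 0 = {1}"
| "monoms N (Suc d) = (\<Union>i\<le>N. (\<lambda>m. mp_var i * m) ` monoms N d)"

abbreviation forms :: "nat \<Rightarrow> nat \<Rightarrow> 'a::comm_ring_1 mpoly set" where
  "forms N d \<equiv> mspan (monoms N d)"

lemma finite_monoms: "finite (monoms N d)"
  by (induction d) auto

lemma monoms_mult: "m \<in> monoms N a \<Longrightarrow> m' \<in> monoms N b \<Longrightarrow> m * m' \<in> monoms N (a + b)"
proof (induction a arbitrary: m)
  case (Suc a)
  then obtain i m1 where "i \<le> N" "m1 \<in> monoms N a" "m = mp_var i * m1" by auto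
  then show ?case using Suc.IH[of m1] Suc.prems(2) by (auto simp: mult.assoc)
qed simp

lemma monoms_split: "m \<in> monoms N (a + b) \<Longrightarrow> \<exists>m1\<in>monoms N a. \<exists>m2\<in>monoms N b. m = m1 * m2"
proof (induction a arbitrary: m)
  case (Suc a)
  then obtain i m' where "i \<le> N" "m' \<in> monoms N (a + b)" "m = mp_var i * m'" by auto
  moreover from this Suc.IH obtain m1 m2 where "m1 \<in> monoms N a" "m2 \<in> monoms N b" "m' = m1 * m2" by blast
  ultimately show ?case
    by (intro bexI[of _ "mp_var i * m1"] bexI[of _ m2]) (auto simp: mult.assoc)
qed simp

lemma forms_mult:
  fixes f g :: "'a::comm_ring_1 mpoly"
  assumes "f \<in> forms N a" "g \<in> forms N b" shows "f * g \<in> forms N (a + b)"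
proof (rule mspan_mult[OF assms(1)])
  fix t :: "'a mpoly" assume t: "t \<in> monoms N a"
  have "g * t \<in> forms N (a + b)"
  proof (rule mspan_mult[OF assms(2)])
    fix u :: "'a mpoly" assume "u \<in> monoms N b"
    then show "u * t \<in> forms N (a + b)"
      using monoms_mult[OF t, of u] mspan_superset[of "monoms N (a + b)"] by (auto simp: mult.commute)
  qed (rule mspan_scale)
  then show "t * g \<in> forms N (a + b)" by (simp add: mult.commute)
qed (rule mspan_scale)

lemma var_in_forms: "i \<le> N \<Longrightarrow> mp_var i \<in> forms N 1"
  by (rule subsetD[OF mspan_superset]) force

lemma form_power: "f \<in> forms N 1 \<Longrightarrow> f ^ k \<in> forms N k"
proof (induction k)
  case 0
  show ?case using mspan_superset[of "monoms N 0"] by auto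
next
  case (Suc k)
  then show ?case using forms_mult[of f N 1 "f ^ k" k] by simp
qed

lemma mp_var_power: "mp_var i ^ k = Poly_Mapping.single (Poly_Mapping.single i k) (1::'a::comm_ring_1)"
proof (induction k)
  case (Suc k)
  then show ?case by (simp add: mp_var_def mult_single single_add[symmetric])
qed simp

lemma prod_var_power:
  "finite S \<Longrightarrow> (\<Prod>i\<in>S. mp_var i ^ a i) =
    Poly_Mapping.single (\<Sum>i\<in>S. Poly_Mapping.single i (a i)) (1::'a::comm_ring_1)"
  by (induction S rule: finite_induct) (simp_all add: mp_var_power mult_single)

lemma var_power_in_monoms: "i \<le> N \<Longrightarrow> mp_var i ^ k \<in> monoms N k"
  by (induction k) auto

lemma prod_var_power_in_monoms:
  "finite S \<Longrightarrow> S \<subseteq> {..N} \<Longrightarrow> (\<Prod>i\<in>S. mp_var i ^ a i) \<in> monoms N (\<Sum>i\<in>S. a i)"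
  by (induction S rule: finite_induct) (auto intro!: monoms_mult var_power_in_monoms)

text \<open>The degree \<open>d\<close> part of the ideal generated by the quadrics
  \<open>f i\<close>. The disjunct \<open>h = 0\<close> covers the degrees below two, where no
  \<open>d'\<close> exists and only zero belongs to the ideal.\<close>

definition in_ideal :: "nat \<Rightarrow> 'i set \<Rightarrow> ('i \<Rightarrow> 'a::comm_ring_1 mpoly) \<Rightarrow> nat \<Rightarrow> 'a mpoly \<Rightarrow> bool" where
  "in_ideal N I f d h \<longleftrightarrow> h = 0 \<or>
     (\<exists>g d'. d = d' + 2 \<and> (\<forall>i\<in>I. g i \<in> forms N d') \<and> h = (\<Sum>i\<in>I. f i * g i))"

context
  fixes N :: nat and I :: "'i set" and f :: "'i \<Rightarrow> 'a::field mpoly"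
  assumes fin: "finite I" and f: "\<And>i. i \<in> I \<Longrightarrow> f i \<in> forms N 2"
begin

lemma in_ideal_mult:
  assumes "in_ideal N I f d h" "g \<in> forms N e" shows "in_ideal N I f (d + e) (g * h)"
proof (cases "h = 0")
  case False
  then obtain k d' where k: "d = d' + 2" "\<forall>i\<in>I. k i \<in> forms N d'" "h = (\<Sum>i\<in>I. f i * k i)"
    using assms(1) by (auto simp: in_ideal_def)
  have "g * h = (\<Sum>i\<in>I. f i * (k i * g))" by (simp add: k(3) sum_distrib_left algebra_simps)
  moreover have "\<forall>i\<in>I. k i * g \<in> forms N (d' + e)" using k(2) assms(2) forms_mult by blast
  ultimately show ?thesis unfolding in_ideal_def using k(1)
    by (intro disjI2 exI[of _ "\<lambda>i. k i * g"] exI[of _ "d' + e"]) auto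
qed (simp add: in_ideal_def)

lemma in_ideal_add:
  assumes "in_ideal N I f d h" "in_ideal N I f d h'" shows "in_ideal N I f d (h + h')"
proof (cases "h = 0 \<or> h' = 0")
  case False
  then obtain k k' d' where k: "d = d' + 2" "\<forall>i\<in>I. k i \<in> forms N d'" "h = (\<Sum>i\<in>I. f i * k i)"
    "\<forall>i\<in>I. k' i \<in> forms N d'" "h' = (\<Sum>i\<in>I. f i * k' i)"
    using assms by (auto simp: in_ideal_def)
  have "h + h' = (\<Sum>i\<in>I. f i * (k i + k' i))" by (simp add: k sum.distrib algebra_simps)
  moreover have "\<forall>i\<in>I. k i + k' i \<in> forms N d'" using k mspan_add by blast
  ultimately show ?thesis unfolding in_ideal_def using k(1)
    by (intro disjI2 exI[of _ "\<lambda>i. k i + k' i"] exI[of _ d']) auto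
qed (use assms in auto)

lemma in_ideal_forms: "in_ideal N I f d h \<Longrightarrow> h \<in> forms N d"
  unfolding in_ideal_def using forms_mult[OF f] by (auto intro!: mspan_sum mspan.zero simp: add.commute)

text \<open>If all forms of some degree lie in the ideal, then the polynomials are spanned over the ring
  generated by the \<open>f i\<close> by finitely many monomials. As there are fewer \<open>f i\<close> than variables,
  there are too many monomials in a large box.\<close>

lemma ideal_misses_form:
  assumes card: "card I \<le> N" shows "\<exists>m\<in>monoms N d. \<not> in_ideal N I f d m"
proof (rule ccontr)
  assume "\<not> ?thesis"
  then have base: "\<And>m. m \<in> monoms N d \<Longrightarrow> in_ideal N I f d m" by auto
  have all: "in_ideal N I f (d + k) m" if m: "m \<in> monoms N (d + k)" for k m
  proof -
    obtain m1 m2 where "m1 \<in> monoms N d" "m2 \<in> monoms N k" "m = m1 * m2" using monoms_split[OF m] by blast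
    then show ?thesis
      using in_ideal_mult[OF base, of m1 m2 k] mspan_superset[of "monoms N k"]
      by (auto simp: mult.commute)
  qed
  define M where "M = (\<Union>k<d. monoms N k :: 'a mpoly set)"
  \<comment> \<open>The exponents of the generators are bounded one by one by \<open>l\<close>. This
    makes the size of \<open>T l\<close> at most \<open>card M\<close> times a power of
    \<open>l + 1\<close> with exponent \<open>card I\<close>.\<close>
  define T where "T l = (\<lambda>(m, \<beta>). m * (\<Prod>i\<in>I. f i ^ \<beta> i)) ` (M \<times> (PiE I (\<lambda>_. {..l})))" for l :: nat
  have finM: "finite M" unfolding M_def using finite_monoms by blast
  have finT: "finite (T l)" for l
    unfolding T_def using finM fin by (intro finite_imageI finite_cartesian_product finite_PiE) auto
  have T_I: "m * (\<Prod>i\<in>I. f i ^ \<beta> i) \<in> T l" if "m \<in> M" "\<And>i. i \<in> I \<Longrightarrow> \<beta> i \<le> l" for m \<beta> l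
  proof -
    have "(\<Prod>i\<in>I. f i ^ \<beta> i) = (\<Prod>i\<in>I. f i ^ restrict \<beta> I i)" by (intro prod.cong) auto
    then show ?thesis unfolding T_def using that
      by (intro image_eqI[of _ _ "(m, restrict \<beta> I)"]) (auto simp: PiE_iff)
  qed
  have T_mono: "T l \<subseteq> T l'" if "l \<le> l'" for l l'
  proof
    fix t assume "t \<in> T l"
    then obtain m \<beta> where "m \<in> M" "\<beta> \<in> PiE I (\<lambda>_. {..l})" "t = m * (\<Prod>i\<in>I. f i ^ \<beta> i)"
      by (auto simp: T_def)
    then show "t \<in> T l'" using that by (auto intro!: T_I simp: PiE_iff intro: order_trans)
  qed
  have T_mult: "t * f j \<in> T (l + 2)" if "t \<in> T l" "j \<in> I" for t j l
  proof -
    obtain m \<beta> where mb: "m \<in> M" "\<beta> \<in> PiE I (\<lambda>_. {..l})" "t = m * (\<Prod>i\<in>I. f i ^ \<beta> i)"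
      using \<open>t \<in> T l\<close> by (auto simp: T_def)
    have "t * f j = m * (\<Prod>i\<in>I. f i ^ (\<beta>(j := Suc (\<beta> j))) i)"
      unfolding mb(3) using fin that(2)
      by (subst (1 2) prod.remove[of I j]) (auto simp: algebra_simps intro!: prod.cong)
    also have "\<dots> \<in> T (l + 2)"
    proof (rule T_I[OF mb(1)])
      fix i assume "i \<in> I"
      then have "\<beta> i \<le> l" "\<beta> j \<le> l" using mb(2) that(2) by (auto simp: PiE_iff)
      then show "(\<beta>(j := Suc (\<beta> j))) i \<le> l + 2" by auto
    qed
    finally show ?thesis .
  qed
  have span: "monoms N k \<subseteq> mspan (T k)" for k
  proof (induction k rule: less_induct)
    case (less k)
    show ?case
    proof
      fix m :: "'a mpoly" assume m: "m \<in> monoms N k"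
      show "m \<in> mspan (T k)"
      proof (cases "k < d")
        case True
        then have "m \<in> M" using m by (auto simp: M_def)
        from T_I[OF this, of "\<lambda>_. 0" k] show ?thesis using mspan_superset by auto
      next
        case False
        then have "in_ideal N I f k m" using all[of m "k - d"] m by simp
        then consider "m = 0" | g k' where "k = k' + 2" "\<forall>i\<in>I. g i \<in> forms N k'" "m = (\<Sum>i\<in>I. f i * g i)"
          by (auto simp: in_ideal_def)
        then show ?thesis
        proof cases
          case 2
          have "g i * f i \<in> mspan (T k)" if "i \<in> I" for i
          proof (rule mspan_mult)
            show "g i \<in> mspan (T k')" using mspan_sub[OF less.IH[of k']] 2 that by auto
            show "t * f i \<in> mspan (T k)" if "t \<in> T k'" for t
              using T_mult[OF that \<open>i \<in> I\<close>] 2(1) mspan_superset by auto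
          qed (rule mspan_scale)
          then show ?thesis unfolding 2(3) by (intro mspan_sum) (auto simp: mult.commute)
        qed (simp add: mspan.zero)
      qed
    qed
  qed
  define c0 where "c0 = card M"
  \<comment> \<open>The box has exponents up to \<open>e\<close> in each of \<open>N + 1\<close>
    variables, and \<open>L\<close> is the largest degree in it. With this \<open>e\<close> the
    bound \<open>c0 * ((N + 1) * (e + 1)) ^ N\<close> equals \<open>e * (e + 1) ^ N\<close>, which
    is below the number \<open>(e + 1) ^ (N + 1)\<close> of monomials in the box.\<close>
  define e where "e = c0 * (N + 1) ^ N"
  define L where "L = (N + 1) * e"
  define J where "J = PiE {..N} (\<lambda>_. {..e})"
  define mon where "mon a = (\<Prod>i\<le>N. mp_var i ^ a i :: 'a mpoly)" for a
  have J: "finite J" "card J = (e + 1) ^ (N + 1)"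
    unfolding J_def by (auto intro: finite_PiE simp: card_PiE)
  have "card (T L) \<le> card (M \<times> (PiE I (\<lambda>_. {..L})))"
    unfolding T_def using finM fin by (intro card_image_le finite_cartesian_product finite_PiE) auto
  also have "\<dots> = c0 * (L + 1) ^ card I"
    using fin by (simp add: card_cartesian_product card_PiE c0_def)
  also have "\<dots> \<le> c0 * ((N + 1) * (e + 1)) ^ N"
  proof -
    have "(L + 1) ^ card I \<le> (L + 1) ^ N" using card by (intro power_increasing) auto
    also have "\<dots> \<le> ((N + 1) * (e + 1)) ^ N" by (intro power_mono) (auto simp: L_def)
    finally show ?thesis by simp
  qed
  also have "\<dots> = (c0 * (N + 1) ^ N) * (e + 1) ^ N" by (simp only: power_mult_distrib mult.assoc)
  also have "\<dots> = e * (e + 1) ^ N" by (simp only: e_def)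
  also have "\<dots> < card J" by (simp add: J)
  finally have less: "card (T L) < card J" .
  have "mon a \<in> mspan (T L)" if "a \<in> J" for a
  proof -
    have "(\<Sum>i\<le>N. a i) \<le> (\<Sum>i\<le>N. e)"
      using that by (intro sum_mono) (auto simp: J_def PiE_iff)
    then have "T (\<Sum>i\<le>N. a i) \<subseteq> T L" by (intro T_mono) (simp add: L_def)
    moreover have "mon a \<in> mspan (T (\<Sum>i\<le>N. a i))"
      using span prod_var_power_in_monoms[of "{..N}" N a] by (auto simp: mon_def)
    ultimately show ?thesis using mspan_sub mspan_superset by blast
  qed
  then obtain c where c: "\<exists>j\<in>J. c j \<noteq> 0" "(\<Sum>j\<in>J. mp_const (c j) * mon j) = 0"
    using mspan_dependent[OF finT J(1) less, of mon] by blast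
  define ex where "ex a = (\<Sum>i\<le>N. Poly_Mapping.single i (a i))" for a :: "nat \<Rightarrow> nat"
  have lk: "Poly_Mapping.lookup (ex a) i = (if i \<le> N then a i else 0)" for a i
    by (auto simp: ex_def lookup_sum lookup_single when_def)
  have inj: "ex a = ex b \<longleftrightarrow> a = b" if "a \<in> J" "b \<in> J" for a b
  proof
    assume eq: "ex a = ex b"
    show "a = b"
    proof
      fix i show "a i = b i"
        using lk[of a i] lk[of b i] eq that by (cases "i \<le> N") (auto simp: J_def PiE_iff extensional_def)
    qed
  qed simp
  obtain j where j: "j \<in> J" "c j \<noteq> 0" using c(1) by blast
  have "0 = Poly_Mapping.lookup (\<Sum>j\<in>J. mp_const (c j) * mon j) (ex j)" by (simp add: c(2))
  also have "\<dots> = (\<Sum>i\<in>J. if i = j then c j else 0)"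
    unfolding lookup_sum mon_def mp_const_def using j(1)
    by (intro sum.cong) (auto simp: prod_var_power mult_single lookup_single when_def ex_def[symmetric] inj)
  also have "\<dots> = c j" using j(1) J(1) by simp
  finally show False using j(2) by simp
qed

end

section \<open>Graded ideals and a projective Nullstellensatz\<close>

lemma mp_const_diff: "mp_const (a - b) = mp_const a - mp_const (b :: 'a::comm_ring_1)"
  by (simp add: mp_const_def single_diff)

text \<open>A homogeneous ideal is given by its forms tagged with their degrees. The tag is kept
  because the zero polynomial has every degree.\<close>

definition graded_ideal :: "nat \<Rightarrow> (nat \<times> 'a::comm_ring_1 mpoly) set \<Rightarrow> bool" where
  "graded_ideal N Q \<longleftrightarrow> (\<forall>d. (d, 0) \<in> Q) \<and> (\<forall>d h. (d, h) \<in> Q \<longrightarrow> h \<in> forms N d) \<and>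
     (\<forall>d g h. (d, g) \<in> Q \<longrightarrow> (d, h) \<in> Q \<longrightarrow> (d, g + h) \<in> Q) \<and>
     (\<forall>d e g h. (d, h) \<in> Q \<longrightarrow> g \<in> forms N e \<longrightarrow> (d + e, g * h) \<in> Q)"

lemma graded_ideal_I:
  assumes "\<And>d. (d, 0) \<in> Q" "\<And>d h. (d, h) \<in> Q \<Longrightarrow> h \<in> forms N d"
    "\<And>d g h. (d, g) \<in> Q \<Longrightarrow> (d, h) \<in> Q \<Longrightarrow> (d, g + h) \<in> Q"
    "\<And>d e g h. (d, h) \<in> Q \<Longrightarrow> g \<in> forms N e \<Longrightarrow> (d + e, g * h) \<in> Q"
  shows "graded_ideal N Q"
  using assms unfolding graded_ideal_def by blast

lemma graded_ideal_D:
  assumes "graded_ideal N Q"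
  shows "(d, 0) \<in> Q" "(d, h) \<in> Q \<Longrightarrow> h \<in> forms N d"
    "(d, g) \<in> Q \<Longrightarrow> (d, h) \<in> Q \<Longrightarrow> (d, g + h) \<in> Q"
    "(d, h) \<in> Q \<Longrightarrow> g \<in> forms N e \<Longrightarrow> (d + e, g * h) \<in> Q"
    "(d, h) \<in> Q \<Longrightarrow> (d, mp_const c * h) \<in> Q"
proof -
  have *: "(\<forall>d. (d, 0) \<in> Q) \<and> (\<forall>d h. (d, h) \<in> Q \<longrightarrow> h \<in> forms N d) \<and>
     (\<forall>d g h. (d, g) \<in> Q \<longrightarrow> (d, h) \<in> Q \<longrightarrow> (d, g + h) \<in> Q) \<and>
     (\<forall>d e g h. (d, h) \<in> Q \<longrightarrow> g \<in> forms N e \<longrightarrow> (d + e, g * h) \<in> Q)"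
    using assms unfolding graded_ideal_def .
  show "(d, 0) \<in> Q" "(d, h) \<in> Q \<Longrightarrow> h \<in> forms N d"
    "(d, g) \<in> Q \<Longrightarrow> (d, h) \<in> Q \<Longrightarrow> (d, g + h) \<in> Q"
    "(d, h) \<in> Q \<Longrightarrow> g \<in> forms N e \<Longrightarrow> (d + e, g * h) \<in> Q"
    using * by blast+
  have "mp_const c \<in> forms N 0" using mspan_base[of 1 "monoms N 0" c] by simp
  then show "(d, h) \<in> Q \<Longrightarrow> (d, mp_const c * h) \<in> Q" using *  by (metis add_0_right)
qed

lemma graded_ideal_full:
  assumes Q: "graded_ideal N Q" and all: "\<And>m. m \<in> monoms N d \<Longrightarrow> (d, m) \<in> Q"
    and h: "h \<in> forms N (d + k)"
  shows "(d + k, h) \<in> Q"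
  using h
proof induction
  case zero
  show ?case by (rule graded_ideal_D(1)[OF Q])
next
  case (step g t c)
  obtain m1 m2 where m: "m1 \<in> monoms N d" "m2 \<in> monoms N k" "t = m1 * m2"
    using monoms_split[OF step(2)] by blast
  have "(d + k, m2 * m1) \<in> Q"
    by (rule graded_ideal_D(4)[OF Q all[OF m(1)]]) (use m(2) mspan_superset in blast)
  then have "(d + k, mp_const c * t) \<in> Q"
    using graded_ideal_D(5)[OF Q, of "d + k" "m2 * m1" c] m(3) mult.commute[of m1 m2] by simp
  then show ?case using graded_ideal_D(3)[OF Q] step(3) by blast
qed

text \<open>The ideal contains no power of the irrelevant ideal, the condition for having a zero in
  projective space.\<close>

definition proper_graded :: "nat \<Rightarrow> (nat \<times> 'a::comm_ring_1 mpoly) set \<Rightarrow> bool" where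
  "proper_graded N Q \<longleftrightarrow> (\<forall>d. \<exists>m\<in>monoms N d. (d, m) \<notin> Q)"

text \<open>Zorn's lemma applies because there are finitely many monomials in each degree: if the
  union of a chain contained them all, so would a single member.\<close>

lemma maximal_graded_ideal:
  fixes Q :: "(nat \<times> 'a::comm_ring_1 mpoly) set"
  assumes Q: "graded_ideal N Q" "proper_graded N Q"
  obtains P where "graded_ideal N P" "proper_graded N P" "Q \<subseteq> P"
    "\<forall>R. graded_ideal N R \<longrightarrow> proper_graded N R \<longrightarrow> P \<subseteq> R \<longrightarrow> R = P"
proof -
  define \<A> where "\<A> = {R. graded_ideal N R \<and> proper_graded N R \<and> Q \<subseteq> R}"
  have "\<exists>M\<in>\<A>. \<forall>R\<in>\<A>. M \<subseteq> R \<longrightarrow> R = M"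
  proof (rule subset_Zorn_nonempty)
    show "\<A> \<noteq> {}" using Q unfolding \<A>_def by blast
    fix C assume C: "C \<noteq> {}" "subset.chain \<A> C"
    then have CA: "\<And>R. R \<in> C \<Longrightarrow> graded_ideal N R \<and> proper_graded N R \<and> Q \<subseteq> R"
      and lin: "\<And>R R'. R \<in> C \<Longrightarrow> R' \<in> C \<Longrightarrow> R \<subseteq> R' \<or> R' \<subseteq> R"
      unfolding subset.chain_def \<A>_def by blast+
    have "graded_ideal N (\<Union>C)"
    proof (rule graded_ideal_I)
      fix d show "(d, 0) \<in> \<Union>C" using C(1) CA graded_ideal_D(1) by (metis UnionI all_not_in_conv)
    next
      fix d and h :: "'a mpoly" assume "(d, h) \<in> \<Union>C"
      then show "h \<in> forms N d" using CA graded_ideal_D(2) by blast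
    next
      fix d and g h :: "'a mpoly" assume "(d, g) \<in> \<Union>C" "(d, h) \<in> \<Union>C"
      then obtain R R' where R: "(d, g) \<in> R" "(d, h) \<in> R'" "R \<in> C" "R' \<in> C" by blast
      then obtain S where "S \<in> C" "(d, g) \<in> S" "(d, h) \<in> S" using lin[of R R'] by blast
      then show "(d, g + h) \<in> \<Union>C" using CA graded_ideal_D(3) by blast
    next
      fix d e and g h :: "'a mpoly" assume "(d, h) \<in> \<Union>C" "g \<in> forms N e"
      then show "(d + e, g * h) \<in> \<Union>C" using CA graded_ideal_D(4) by blast
    qed
    moreover have "proper_graded N (\<Union>C)"
      unfolding proper_graded_def
    proof (rule allI, rule ccontr)
      fix d assume "\<not> (\<exists>m\<in>monoms N d. (d, m) \<notin> \<Union>C)"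
      then have sub: "(\<lambda>m. (d, m)) ` monoms N d \<subseteq> \<Union>C" by blast
      obtain R where "R \<in> C" "(\<lambda>m. (d, m)) ` monoms N d \<subseteq> R"
        using finite_subset_Union_chain[OF _ sub C] finite_monoms by blast
      then show False using CA[of R] unfolding proper_graded_def by blast
    qed
    ultimately show "\<Union>C \<in> \<A>" using C(1) CA unfolding \<A>_def by blast
  qed
  then obtain P where P: "P \<in> \<A>" "\<forall>R\<in>\<A>. P \<subseteq> R \<longrightarrow> R = P" by blast
  have P': "graded_ideal N P" "proper_graded N P" "Q \<subseteq> P" using P(1) by (simp_all add: \<A>_def)
  show thesis
    by (rule that[OF P']) (use P(2) P'(3) in \<open>unfold \<A>_def, blast\<close>)
qed

text \<open>The maximal graded ideals that contain no power of the irrelevant ideal are the ideals of points.\<close>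

lemma maximal_graded_ideal_point:
  fixes P :: "(nat \<times> 'a::alg_closed_field mpoly) set"
  assumes P: "graded_ideal N P" and proper: "proper_graded N P"
    and max: "\<forall>R. graded_ideal N R \<longrightarrow> proper_graded N R \<longrightarrow> P \<subseteq> R \<longrightarrow> R = P"
  shows "\<exists>x. (\<exists>i\<le>N. x i \<noteq> 0) \<and> (\<forall>d h. (d, h) \<in> P \<longrightarrow> mp_eval h x = 0)"
proof -
  note PD = graded_ideal_D[OF P]
  \<comment> \<open>\<open>R\<close> is the ideal generated by \<open>P\<close> and
    \<open>l\<close>. By maximality it contains all forms of some degree, so modulo \<open>P\<close>
    every form of large degree is a multiple of \<open>l\<close>.\<close>
  have absorb: "\<exists>d0. \<forall>k. \<forall>h\<in>forms N (d0 + k + a). \<exists>p g. (d0 + k + a, p) \<in> P \<and> g \<in> forms N (d0 + k) \<and> h = p + g * l"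
    if l: "l \<in> forms N a" "(a, l) \<notin> P" for a l
  proof -
    define R where "R = {(d, x). \<exists>p g. (d, p) \<in> P \<and> x = p + g * l \<and> (g = 0 \<or> (\<exists>e. d = e + a \<and> g \<in> forms N e))}"
    have "graded_ideal N R"
    proof (rule graded_ideal_I)
      fix d show "(d, 0) \<in> R" unfolding R_def using PD(1) by (auto intro!: exI[of _ 0])
    next
      fix d h assume "(d, h) \<in> R"
      then show "h \<in> forms N d"
        unfolding R_def using PD(2) forms_mult[OF _ l(1)] by (auto intro: mspan_add)
    next
      fix d x y assume "(d, x) \<in> R" "(d, y) \<in> R"
      then obtain p g p' g' where *: "(d, p) \<in> P" "x = p + g * l" "g = 0 \<or> (\<exists>e. d = e + a \<and> g \<in> forms N e)"
        "(d, p') \<in> P" "y = p' + g' * l" "g' = 0 \<or> (\<exists>e. d = e + a \<and> g' \<in> forms N e)"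
        unfolding R_def by blast
      have "g + g' = 0 \<or> (\<exists>e. d = e + a \<and> g + g' \<in> forms N e)"
        using *(3,6) by (auto intro: mspan_add)
      moreover have "x + y = (p + p') + (g + g') * l" by (simp add: * algebra_simps)
      moreover have "(d, p + p') \<in> P" using * PD(3) by blast
      ultimately show "(d, x + y) \<in> R" unfolding R_def by blast
    next
      fix d e and u x :: "'a mpoly" assume "(d, x) \<in> R" and u: "u \<in> forms N e"
      then obtain p g where *: "(d, p) \<in> P" "x = p + g * l" "g = 0 \<or> (\<exists>e. d = e + a \<and> g \<in> forms N e)"
        unfolding R_def by blast
      have "u * g = 0 \<or> (\<exists>e'. d + e = e' + a \<and> u * g \<in> forms N e')"
      proof (cases "g = 0")
        case False
        then obtain e1 where "d = e1 + a" "g \<in> forms N e1" using *(3) by blast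
        then have "d + e = (e + e1) + a" "u * g \<in> forms N (e + e1)" using forms_mult[OF u] by auto
        then show ?thesis by blast
      qed simp
      moreover have "u * x = u * p + u * g * l" by (simp add: * algebra_simps)
      moreover have "(d + e, u * p) \<in> P" using * u PD(4) by blast
      ultimately show "(d + e, u * x) \<in> R" unfolding R_def by blast
    qed
    moreover have RI: "(d, p + g * l) \<in> R" if "(d, p) \<in> P" "g = 0 \<or> (\<exists>e. d = e + a \<and> g \<in> forms N e)" for d p g
      using that unfolding R_def by blast
    have "P \<subseteq> R"
    proof
      fix z assume "z \<in> P"
      then show "z \<in> R" using RI[of "fst z" "snd z" 0] by simp
    qed
    moreover have "(a, l) \<in> R"
    proof -
      have "1 \<in> forms N 0" using mspan_superset[of "monoms N 0"] by auto
      then have "(1 :: 'a mpoly) = 0 \<or> (\<exists>e. a = e + a \<and> (1 :: 'a mpoly) \<in> forms N e)" by simp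
      from RI[OF PD(1) this] show ?thesis by simp
    qed
    ultimately have "\<not> proper_graded N R" using max l(2) by blast
    then obtain d where d: "\<And>m. m \<in> monoms N d \<Longrightarrow> (d, m) \<in> R" unfolding proper_graded_def by blast
    show ?thesis
    proof (intro exI[of _ d] allI ballI)
      fix k and h :: "'a mpoly" assume "h \<in> forms N (d + k + a)"
      then have "(d + k + a, h) \<in> R"
        using graded_ideal_full[OF \<open>graded_ideal N R\<close> d, of h "k + a"] by (simp add: add.assoc)
      then show "\<exists>p g. (d + k + a, p) \<in> P \<and> g \<in> forms N (d + k) \<and> h = p + g * l"
        unfolding R_def using mspan.zero by fastforce
    qed
  qed
  \<comment> \<open>Modulo \<open>P\<close>, forms of large degree are multiples of
    \<open>l\<close>, and the cofactors are multiples of \<open>m\<close>. If \<open>l * m\<close>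
    were in \<open>P\<close>, then \<open>P\<close> would contain all forms of degree
    \<open>?D\<close>.\<close>
  have prime: "(a + b, l * m) \<notin> P" if l: "l \<in> forms N a" "(a, l) \<notin> P" and m: "m \<in> forms N b" "(b, m) \<notin> P" for a b l m
  proof
    assume lm: "(a + b, l * m) \<in> P"
    obtain d1 where d1: "\<And>k h. h \<in> forms N (d1 + k + a) \<Longrightarrow> \<exists>p g. (d1 + k + a, p) \<in> P \<and> g \<in> forms N (d1 + k) \<and> h = p + g * l"
      using absorb[OF l] by blast
    obtain d2 where d2: "\<And>k h. h \<in> forms N (d2 + k + b) \<Longrightarrow> \<exists>p g. (d2 + k + b, p) \<in> P \<and> g \<in> forms N (d2 + k) \<and> h = p + g * m"
      using absorb[OF m] by blast
    let ?D = "d1 + (d2 + b) + a"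
    have "(?D, h) \<in> P" if h: "h \<in> monoms N ?D" for h
    proof -
      obtain p g where pg: "(?D, p) \<in> P" "g \<in> forms N (d1 + (d2 + b))" "h = p + g * l"
        using d1[of h "d2 + b"] h mspan_superset by blast
      obtain p' g' where pg': "(d2 + d1 + b, p') \<in> P" "g' \<in> forms N (d2 + d1)" "g = p' + g' * m"
        using d2[of g d1] pg(2) by (auto simp: add.assoc add.commute add.left_commute)
      have 1: "(d2 + d1 + b + a, l * p') \<in> P" by (rule PD(4)[OF pg'(1) l(1)])
      have 2: "(a + b + (d2 + d1), g' * (l * m)) \<in> P" by (rule PD(4)[OF lm pg'(2)])
      have "h = p + (l * p' + g' * (l * m))" by (simp add: pg pg' algebra_simps)
      moreover have "(?D, l * p') \<in> P" "(?D, g' * (l * m)) \<in> P"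
        using 1 2 by (simp_all add: ac_simps)
      ultimately show ?thesis using pg(1) PD(3) by metis
    qed
    then show False using proper unfolding proper_graded_def by blast
  qed
  obtain i0 where i0: "i0 \<le> N" "(1, mp_var i0) \<notin> P"
    using proper unfolding proper_graded_def by (auto dest!: spec[of _ 1])
  define y :: "'a mpoly" where "y = mp_var i0"
  have y: "y \<in> forms N 1" "(1, y) \<notin> P" using i0 var_in_forms by (auto simp: y_def)
  have ypow: "(k, y ^ k) \<notin> P" for k
  proof (induction k)
    case 0
    show ?case using proper unfolding proper_graded_def by (auto dest!: spec[of _ 0])
  next
    case (Suc k)
    then show ?case using prime[OF y form_power[OF y(1)], of k] by simp
  qed
  obtain c where c: "\<And>k h. h \<in> forms N (c + k + 1) \<Longrightarrow> \<exists>p g. (c + k + 1, p) \<in> P \<and> g \<in> forms N (c + k) \<and> h = p + g * y"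
    using absorb[OF y] by blast
  \<comment> \<open>Absorbing \<open>y\<close> repeatedly bounds the graded pieces of the quotient
    by \<open>P\<close>: each is \<open>y ^ k\<close> times the fixed piece of degree
    \<open>c\<close>.\<close>
  have divide: "\<exists>p g. (c + k, p) \<in> P \<and> g \<in> forms N c \<and> h = p + y ^ k * g" if "h \<in> forms N (c + k)" for h k
    using that
  proof (induction k arbitrary: h)
    case 0
    then show ?case using PD(1) by (intro exI[of _ 0] exI[of _ h]) auto
  next
    case (Suc k)
    then obtain p g where pg: "(c + k + 1, p) \<in> P" "g \<in> forms N (c + k)" "h = p + g * y"
      using c[of h k] by auto
    obtain p' g' where pg': "(c + k, p') \<in> P" "g' \<in> forms N c" "g = p' + y ^ k * g'"
      using Suc.IH[OF pg(2)] by blast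
    have "(c + k + 1, y * p') \<in> P" by (rule PD(4)[OF pg'(1) y(1)])
    then have "(c + Suc k, p + y * p') \<in> P" using pg(1) PD(3) by simp
    moreover have "h = (p + y * p') + y ^ Suc k * g'" by (simp add: pg pg' algebra_simps)
    ultimately show ?case using pg'(2) by blast
  qed
  have "\<exists>\<rho>. (1, mp_var i - mp_const \<rho> * y) \<in> P" if i: "i \<le> N" for i
  proof -
    define z :: "'a mpoly" where "z = mp_var i"
    have z: "z \<in> forms N 1" using i var_in_forms by (auto simp: z_def)
    \<comment> \<open>Homogenisation: for \<open>degree p \<le> e\<close> this is
      \<open>y ^ e\<close> times the value of \<open>p\<close> at \<open>z / y\<close>. Linear
      factors of \<open>p\<close> become linear forms, and primality of \<open>P\<close> selects one
      of them.\<close>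
    define hz where "hz e p = (\<Sum>j\<le>e. mp_const (coeff p j) * (z ^ j * y ^ (e - j)))" for e and p :: "'a poly"
    have zy: "z ^ j * y ^ (e - j) \<in> forms N e" if "j \<le> e" for j e
      using forms_mult[OF form_power[OF z] form_power[OF y(1)], of j "e - j"] that by simp
    have hz_forms: "hz e p \<in> forms N e" for e p
      unfolding hz_def using zy by (intro mspan_sum mspan_scale) auto
    have hz_mult: "hz (Suc e) ([:-\<rho>, 1:] * p) = (z - mp_const \<rho> * y) * hz e p" if "degree p \<le> e" for e \<rho> p
    proof -
      have "hz (Suc e) ([:-\<rho>, 1:] * p) = (\<Sum>j\<le>Suc e. mp_const (coeff (pCons 0 p) j) * (z ^ j * y ^ (Suc e - j)))
          - mp_const \<rho> * (\<Sum>j\<le>Suc e. mp_const (coeff p j) * (z ^ j * y ^ (Suc e - j)))"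
        unfolding hz_def sum_distrib_left sum_subtractf[symmetric]
        by (intro sum.cong) (auto simp: mp_const_diff mp_const_uminus mp_const_mult algebra_simps)
      also have "(\<Sum>j\<le>Suc e. mp_const (coeff (pCons 0 p) j) * (z ^ j * y ^ (Suc e - j))) = z * hz e p"
        unfolding hz_def by (subst sum.atMost_Suc_shift) (simp add: sum_distrib_left algebra_simps)
      also have "(\<Sum>j\<le>Suc e. mp_const (coeff p j) * (z ^ j * y ^ (Suc e - j))) = y * hz e p"
        unfolding hz_def using that
        by (simp add: coeff_eq_0 sum_distrib_left Suc_diff_le algebra_simps)
      finally show ?thesis by (simp add: algebra_simps)
    qed
    have root: "\<exists>\<rho>. (1, z - mp_const \<rho> * y) \<in> P" if "p \<noteq> 0" "degree p \<le> e" "(e, hz e p) \<in> P" for e p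
      using that
    proof (induction "degree p" arbitrary: p e)
      case 0
      then obtain a where a: "p = [:a:]" "a \<noteq> 0" by (metis degree_eq_zeroE pCons_0_0)
      have "hz e p = (\<Sum>j\<le>e. if j = 0 then mp_const a * y ^ e else 0)"
        unfolding hz_def a by (intro sum.cong) (auto simp: coeff_pCons split: nat.splits)
      then have "hz e p = mp_const a * y ^ e" by simp
      then have "(e, mp_const (inverse a) * (mp_const a * y ^ e)) \<in> P" using PD(5) 0 by metis
      moreover have "mp_const (inverse a) * (mp_const a * y ^ e) = y ^ e"
        using a(2) by (simp add: mult.assoc[symmetric] mp_const_mult[symmetric])
      ultimately show ?case using ypow by simp
    next
      case (Suc n)
      obtain \<rho> where "poly p \<rho> = 0" using alg_closed_imp_poly_has_root[of p] Suc(2) by auto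
      then obtain q where q: "p = [:-\<rho>, 1:] * q" by (auto simp: poly_eq_0_iff_dvd)
      have q0: "q \<noteq> 0" using q Suc by auto
      have "degree p = degree [:-\<rho>, 1:] + degree q" unfolding q using q0 by (intro degree_mult_eq) auto
      then have dq: "degree p = Suc (degree q)" by simp
      then obtain e' where e': "e = Suc e'" "degree q \<le> e'" using Suc by (cases e) auto
      have "hz e p = (z - mp_const \<rho> * y) * hz e' q" unfolding q e'(1) by (rule hz_mult[OF e'(2)])
      then have "(1 + e', (z - mp_const \<rho> * y) * hz e' q) \<in> P" using Suc.prems e'(1) by simp
      moreover have "z - mp_const \<rho> * y \<in> forms N 1"
        using mspan_add[OF z mspan_scale[OF y(1), of "- \<rho>"]] by (simp add: mp_const_uminus)
      ultimately have "(1, z - mp_const \<rho> * y) \<in> P \<or> (e', hz e' q) \<in> P"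
        using prime hz_forms by blast
      then show ?case using Suc.hyps(1)[of q e'] Suc.hyps(2) q0 e'(2) dq by auto
    qed
    define k where "k = card (monoms N c :: 'a mpoly set)"
    \<comment> \<open>Modulo \<open>P\<close>, the \<open>e + 1\<close> products
      \<open>z ^ j * y ^ (e - j)\<close> are \<open>y ^ k\<close> times elements of a span of
      \<open>k\<close> monomials. Hence they are linearly dependent modulo \<open>P\<close>.\<close>
    define e where "e = c + k"
    have "\<forall>j\<in>{..e}. \<exists>p g. (e, p) \<in> P \<and> g \<in> forms N c \<and> z ^ j * y ^ (e - j) = p + y ^ k * g"
      using divide zy unfolding e_def by blast
    then obtain p g where pg: "\<And>j. j \<le> e \<Longrightarrow> (e, p j) \<in> P \<and> g j \<in> forms N c \<and> z ^ j * y ^ (e - j) = p j + y ^ k * g j"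
      by (metis atMost_iff)
    obtain a where a: "\<exists>j\<in>{..e}. a j \<noteq> 0" "(\<Sum>j\<in>{..e}. mp_const (a j) * g j) = 0"
      using mspan_dependent[OF finite_monoms[of N c], of "{..e}" g] pg by (auto simp: e_def k_def)
    define q where "q = (\<Sum>j\<le>e. monom (a j) j)"
    have cq: "coeff q j = (if j \<le> e then a j else 0)" for j
      by (auto simp: q_def coeff_sum)
    have "hz e q = (\<Sum>j\<le>e. mp_const (a j) * (p j + y ^ k * g j))"
      unfolding hz_def by (intro sum.cong) (auto simp: cq pg[THEN conjunct2, THEN conjunct2, symmetric])
    also have "\<dots> = (\<Sum>j\<le>e. mp_const (a j) * p j) + y ^ k * (\<Sum>j\<le>e. mp_const (a j) * g j)"
      by (simp add: algebra_simps sum.distrib sum_distrib_left)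
    finally have hzq: "hz e q = (\<Sum>j\<le>e. mp_const (a j) * p j)" using a(2) by simp
    have "(e, \<Sum>j\<in>J. mp_const (a j) * p j) \<in> P" if "J \<subseteq> {..e}" for J
      using finite_subset[OF that finite_atMost] that
    proof (induction J rule: finite_induct)
      case (insert j J)
      then show ?case using PD(3,5) pg[of j] by auto
    qed (use PD(1) in auto)
    then have "(e, hz e q) \<in> P" using hzq by auto
    moreover have "q \<noteq> 0" using a(1) cq by (metis atMost_iff coeff_0)
    moreover have "degree q \<le> e" by (rule degree_le) (auto simp: cq)
    ultimately show ?thesis using root unfolding z_def by blast
  qed
  then obtain x where x: "\<And>i. i \<le> N \<Longrightarrow> (1, mp_var i - mp_const (x i) * y) \<in> P" by metis
  \<comment> \<open>The \<open>x i\<close> are the coordinates of the point in the chart where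
    \<open>y\<close> is 1: a form is congruent to its value at \<open>x\<close> times a power of
    \<open>y\<close>. As no power of \<open>y\<close> lies in \<open>P\<close>, forms in
    \<open>P\<close> vanish at \<open>x\<close>.\<close>
  have mon: "(d, m - mp_const (mp_eval m x) * y ^ d) \<in> P" if "m \<in> monoms N d" for m d
    using that
  proof (induction d arbitrary: m)
    case 0
    then show ?case using PD(1) by simp
  next
    case (Suc d)
    then obtain i m' where m': "i \<le> N" "m' \<in> monoms N d" "m = mp_var i * m'" by auto
    let ?u = "mp_const (mp_eval m' x)"
    have 1: "(d + 1, mp_var i * (m' - ?u * y ^ d)) \<in> P"
      by (rule PD(4)[OF Suc.IH[OF m'(2)] var_in_forms[OF m'(1)]])
    have 2: "(1 + d, (?u * y ^ d) * (mp_var i - mp_const (x i) * y)) \<in> P"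
      by (rule PD(4)[OF x[OF m'(1)] mspan_scale[OF form_power[OF y(1)]]])
    have "m - mp_const (mp_eval m x) * y ^ Suc d
        = mp_var i * (m' - ?u * y ^ d) + (?u * y ^ d) * (mp_var i - mp_const (x i) * y)"
      by (simp add: m' mp_eval_mult mp_const_mult algebra_simps)
    then show ?case using PD(3)[of "Suc d"] 1 2 by simp
  qed
  have form: "(d, h - mp_const (mp_eval h x) * y ^ d) \<in> P" if "h \<in> forms N d" for h d
    using that
  proof induction
    case (step h t a)
    have eq: "mp_const a * t + h - mp_const (mp_eval (mp_const a * t + h) x) * y ^ d
      = mp_const a * (t - mp_const (mp_eval t x) * y ^ d) + (h - mp_const (mp_eval h x) * y ^ d)"
      by (simp add: mp_eval_add mp_eval_mult mp_const_add mp_const_mult algebra_simps)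
    show ?case unfolding eq by (rule PD(3)[OF PD(5)[OF mon[OF step(2)]] step(3)])
  qed (use PD(1) in simp)
  have "mp_eval h x = 0" if h: "(d, h) \<in> P" for d h
  proof (rule ccontr)
    let ?a = "mp_eval h x"
    assume a: "?a \<noteq> 0"
    have "(d, mp_const (- 1) * (h - mp_const ?a * y ^ d) + h) \<in> P"
      using PD(3,5) form[OF PD(2)[OF h]] h by blast
    then have "(d, mp_const ?a * y ^ d) \<in> P" by (simp add: mp_const_uminus)
    then have "(d, mp_const (inverse ?a) * (mp_const ?a * y ^ d)) \<in> P" by (rule PD(5))
    moreover have "mp_const (inverse ?a) * (mp_const ?a * y ^ d) = y ^ d"
      using a by (simp add: mult.assoc[symmetric] mp_const_mult[symmetric])
    ultimately show False using ypow by simp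
  qed
  moreover have "x i0 \<noteq> 0"
  proof
    assume "x i0 = 0"
    then show False using x[OF i0(1)] i0(2) by simp
  qed
  ultimately show ?thesis using i0(1) by blast
qed

text \<open>By the count in \<open>ideal_misses_form\<close>, the ideal of at most \<open>N\<close>
  quadrics contains no power of the irrelevant ideal, and a maximal graded ideal above it is the
  ideal of a point. It will be applied to partial derivatives in characteristic two.\<close>

theorem common_zero:
  fixes f :: "'i \<Rightarrow> 'a::alg_closed_field mpoly"
  assumes "finite I" "card I \<le> N" "\<And>i. i \<in> I \<Longrightarrow> f i \<in> forms N 2"
  shows "\<exists>x. (\<exists>i\<le>N. x i \<noteq> 0) \<and> (\<forall>i\<in>I. mp_eval (f i) x = 0)"
proof -
  let ?in = "in_ideal N I f"
  define Q where "Q = {(d, h). ?in d h}"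
  have "graded_ideal N Q"
    unfolding Q_def mem_Collect_eq case_prod_conv
  proof (rule graded_ideal_I, unfold mem_Collect_eq case_prod_conv)
    show "?in d 0" for d by (simp add: in_ideal_def)
    show "h \<in> forms N d" if "?in d h" for d h using in_ideal_forms[OF assms(1,3) that] .
    show "?in d (g + h)" if "?in d g" "?in d h" for d g h using in_ideal_add[OF assms(1,3) that] .
    show "?in (d + e) (g * h)" if "?in d h" "g \<in> forms N e" for d e g h using in_ideal_mult[OF assms(1,3) that] .
  qed
  moreover have "proper_graded N Q"
    unfolding proper_graded_def Q_def mem_Collect_eq case_prod_conv
    by (rule allI) (rule ideal_misses_form[OF assms(1,3,2)])
  ultimately obtain P where P: "graded_ideal N P" "proper_graded N P" "Q \<subseteq> P"
    "\<forall>R. graded_ideal N R \<longrightarrow> proper_graded N R \<longrightarrow> P \<subseteq> R \<longrightarrow> R = P"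
    by (rule maximal_graded_ideal)
  obtain x where x: "\<exists>i\<le>N. x i \<noteq> 0" "\<And>d h. (d, h) \<in> P \<Longrightarrow> mp_eval h x = 0"
    using maximal_graded_ideal_point[OF P(1,2,4)] by blast
  have "mp_eval (f i) x = 0" if i: "i \<in> I" for i
  proof -
    define g :: "'i \<Rightarrow> 'a mpoly" where "g j = (if j = i then 1 else 0)" for j
    have "\<forall>j\<in>I. g j \<in> forms N 0"
      using mspan_superset[of "monoms N 0"] by (auto simp: g_def intro: mspan.zero)
    moreover have "(\<Sum>j\<in>I. f j * g j) = (\<Sum>j\<in>I. if j = i then f i else 0)"
      by (intro sum.cong) (auto simp: g_def)
    then have "f i = (\<Sum>j\<in>I. f j * g j)" using assms(1) i by simp
    ultimately have "?in 2 (f i)"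
      unfolding in_ideal_def by (intro disjI2 exI[of _ g] exI[of _ 0]) auto
    then show ?thesis using P(3) x(2) unfolding Q_def by blast
  qed
  with x(1) show ?thesis by blast
qed

section \<open>Sections of bivariate polynomials\<close>

text \<open>The inner variable is the parameter \<open>t\<close>, the outer variable is the
  coordinate \<open>x\<close> on the fibre over \<open>t\<close>.\<close>

definition poly2 :: "'a::comm_ring_1 poly poly \<Rightarrow> 'a \<Rightarrow> 'a \<Rightarrow> 'a" where
  "poly2 P t x = poly (poly P [:x:]) t"

lemma poly2_simps [simp]:
  "poly2 (P + Q) t x = poly2 P t x + poly2 Q t x"
  "poly2 (P * Q) t x = poly2 P t x * poly2 Q t x"
  "poly2 0 t x = 0"
  "poly2 (pCons p P) t x = poly p t + x * poly2 P t x"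
  by (auto simp: poly2_def)

lemma poly2_prod_mset: "poly2 (prod_mset M) t x = (\<Prod>P\<in>#M. poly2 P t x)"
  by (induction M) (auto simp: poly2_def)

lemma poly2_section: "poly2 P t x = poly (map_poly (\<lambda>c. poly c t) P) x"
  by (induction P) (auto simp: map_poly_pCons)

lemma polyfuns_poly2:
  assumes "f \<in> polyfuns {fst, snd} UNIV" shows "\<exists>P. \<forall>t x. f (t, x) = poly2 P t x"
  using assms
proof induction
  case (const c) show ?case by (rule exI[of _ "[:[:c:]:]"]) auto
next
  case (coord f) then show ?case
    by (auto intro: exI[of _ "[:[:0,1:]:]"] exI[of _ "[:0,1:]"])
next
  case (add f g) then show ?case by (metis poly2_simps(1))
next
  case (mult f g) then show ?case by (metis poly2_simps(2))
qed

lemma poly2_prime_factor: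
  fixes P :: "'a::field_gcd poly poly"
  assumes "P \<noteq> 0" "poly2 P t x = 0"
  obtains q where "prime_elem q" "q dvd P" "poly2 q t x = 0"
proof -
  obtain M where M: "\<forall>q\<in>#M. prime q" "normalize (prod_mset M) = normalize P"
    using prime_factorization_exists'[OF assms(1)] by metis
  then have dvd: "P dvd prod_mset M" "prod_mset M dvd P" by (simp_all add: associated_iff_dvd)
  then have "poly2 (prod_mset M) t x = 0" using assms(2) by auto
  then obtain q where q: "q \<in># M" "poly2 q t x = 0" by (auto simp: poly2_prod_mset)
  moreover have "q dvd P" using q(1) dvd(2) dvd_prod_mset dvd_trans by blast
  ultimately show thesis using that M(1) by auto
qed

text \<open>Divisors of a polynomial in \<open>x\<close> over \<open>K[t]\<close> with constant leading coefficient again have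
  constant leading coefficient, so their degree in \<open>x\<close> does not drop when \<open>t\<close> is specialised.\<close>

lemma dvd_constant_lead:
  fixes P Q :: "'a::field_gcd poly poly"
  assumes "lead_coeff P = [:c:]" "c \<noteq> 0" "Q dvd P"
  obtains d where "lead_coeff Q = [:d:]" "d \<noteq> 0"
proof -
  obtain R where "P = Q * R" using assms(3) by auto
  then have m: "lead_coeff Q * lead_coeff R = [:c:]" using assms(1) by (simp add: lead_coeff_mult)
  then have "lead_coeff Q \<noteq> 0" "lead_coeff R \<noteq> 0" using assms(2) by auto
  then have "degree (lead_coeff Q) + degree (lead_coeff R) = 0"
    using m degree_mult_eq[of "lead_coeff Q" "lead_coeff R"] by simp
  then have "degree (lead_coeff Q) = 0" by simp
  then obtain d where "lead_coeff Q = [:d:]" by (metis degree_eq_zeroE)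
  with that \<open>lead_coeff Q \<noteq> 0\<close> show thesis by auto
qed

lemma constant_lead_section:
  assumes "lead_coeff P = [:c:]" "c \<noteq> 0"
  shows "degree (map_poly (\<lambda>c. poly c t) P) = degree P" "map_poly (\<lambda>c. poly c t) P \<noteq> 0"
proof -
  have "coeff (map_poly (\<lambda>c. poly c t) P) (degree P) = c"
    using assms by (simp add: coeff_map_poly)
  then have *: "coeff (map_poly (\<lambda>c. poly c t) P) (degree P) \<noteq> 0" using assms by simp
  then show "map_poly (\<lambda>c. poly c t) P \<noteq> 0" by auto
  have "degree (map_poly (\<lambda>c. poly c t) P) \<le> degree P"
    by (rule map_poly_degree_leq)
  then show "degree (map_poly (\<lambda>c. poly c t) P) = degree P" using le_degree[OF *] by simp
qed

lemma constant_lead_root: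
  fixes P :: "'a::alg_closed_field poly poly"
  assumes "lead_coeff P = [:c:]" "c \<noteq> 0" "degree P > 0"
  obtains x where "poly2 P t x = 0"
  using alg_closed_imp_poly_has_root[of "map_poly (\<lambda>c. poly c t) P"] constant_lead_section(1)[OF assms(1,2)]
    assms(3) by (auto simp: poly2_section)

lemma constant_lead_finite:
  fixes P :: "'a::idom poly poly"
  assumes "lead_coeff P = [:c:]" "c \<noteq> 0"
  shows "finite {x. poly2 P t x = 0}"
  unfolding poly2_section by (rule poly_roots_finite[OF constant_lead_section(2)[OF assms]])

text \<open>A common factor of positive degree in \<open>x\<close> would have a root over
  \<open>t0\<close>, where there are no common zeros. So a nonzero polynomial \<open>r\<close> in
  \<open>t\<close> alone lies in the ideal, \<open>t\<close> is one of its roots, and each fibre of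
  \<open>P = 0\<close> is finite.\<close>

lemma bivariate_finite_zeros:
  fixes P Q :: "'a::{alg_closed_field,field_gcd} poly poly"
  assumes lead: "lead_coeff P = [:c:]" "c \<noteq> 0"
    and no: "\<And>x. poly2 P t0 x = 0 \<Longrightarrow> poly2 Q t0 x \<noteq> 0"
  shows "finite {(t, x). poly2 P t x = 0 \<and> poly2 Q t x = 0}"
proof -
  have P0: "P \<noteq> 0" using lead by auto
  have "degree q = 0" if q: "prime_elem q" "q dvd P" "q dvd Q" for q
  proof (rule ccontr)
    assume "degree q \<noteq> 0"
    obtain d where "lead_coeff q = [:d:]" "d \<noteq> 0" using dvd_constant_lead[OF lead q(2)] by blast
    then obtain x where "poly2 q t0 x = 0" using constant_lead_root[of q d t0] \<open>degree q \<noteq> 0\<close> by auto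
    then have "poly2 P t0 x = 0" "poly2 Q t0 x = 0" using q(2,3) by auto
    with no show False by blast
  qed
  then obtain a b r where r: "r \<noteq> 0" "a * P + b * Q = [:r:]" using bezout_poly_poly[OF P0, of Q] by blast
  have "{(t, x). poly2 P t x = 0 \<and> poly2 Q t x = 0} \<subseteq> (SIGMA t:{t. poly r t = 0}. {x. poly2 P t x = 0})"
  proof (rule subrelI)
    fix t x assume "(t, x) \<in> {(t, x). poly2 P t x = 0 \<and> poly2 Q t x = 0}"
    then have z: "poly2 P t x = 0" "poly2 Q t x = 0" by auto
    have "poly2 [:r:] t x = 0" unfolding r(2)[symmetric] using z by simp
    then show "(t, x) \<in> (SIGMA t:{t. poly r t = 0}. {x. poly2 P t x = 0})" using z by simp
  qed
  moreover have "finite (SIGMA t:{t. poly r t = 0}. {x. poly2 P t x = 0})"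
    using poly_roots_finite[OF r(1)] constant_lead_finite[OF lead] by (intro finite_SigmaI) auto
  ultimately show ?thesis by (rule finite_subset)
qed

text \<open>If the prime \<open>q\<close> did not divide \<open>Q\<close>, some nonzero
  \<open>r\<close> in \<open>t\<close> alone would be a combination of both. But \<open>q\<close>
  has a zero over every \<open>t\<close>, where \<open>Q\<close> vanishes too, so \<open>r\<close>
  would vanish everywhere.\<close>

lemma prime_dvd_vanishing:
  fixes P Q q :: "'a::{alg_closed_field,field_gcd} poly poly"
  assumes lead: "lead_coeff P = [:c:]" "c \<noteq> 0"
    and q: "prime_elem q" "q dvd P" "degree q > 0"
    and van: "\<And>t x. poly2 P t x = 0 \<Longrightarrow> poly2 Q t x = 0"
  shows "q dvd Q"
proof (rule ccontr)
  assume nd: "\<not> q dvd Q"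
  obtain d where d: "lead_coeff q = [:d:]" "d \<noteq> 0" using dvd_constant_lead[OF lead q(2)] by blast
  have "degree k = 0" if k: "prime_elem k" "k dvd q" "k dvd Q" for k
  proof -
    have "q dvd k" using prime_elem_imp_irreducible[OF q(1)] k(1,2)
      by (metis irreducibleD' prime_elem_not_unit)
    with k(3) nd show ?thesis using dvd_trans by blast
  qed
  moreover have "q \<noteq> 0" using q(1) by auto
  ultimately obtain a b r where r: "r \<noteq> 0" "a * q + b * Q = [:r:]" using bezout_poly_poly[of q Q] by blast
  have "poly r t = 0" for t
  proof -
    obtain x where x: "poly2 q t x = 0" using constant_lead_root[OF d q(3)] by blast
    then have "poly2 P t x = 0" using q(2) by auto
    then have "poly2 Q t x = 0" by (rule van)
    with x have "poly2 [:r:] t x = 0" unfolding r(2)[symmetric] by simp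
    then show ?thesis by simp
  qed
  then have "r = 0" using poly_eq_0_infinite[OF infinite_alg_closed] by blast
  with r(1) show False by simp
qed

text \<open>The leading coefficient of the factor is a nonzero constant, so its root in
  \<open>x\<close> is a polynomial in \<open>t\<close>, not just a rational function.\<close>

lemma linear_factor_section:
  fixes L P :: "'a::field_gcd poly poly"
  assumes lead: "lead_coeff P = [:c:]" "c \<noteq> 0" and L: "L dvd P" "degree L = 1"
  obtains r where "\<And>t. poly2 P t (poly r t) = 0" "\<And>t. poly2 L t 0 = 0 \<Longrightarrow> poly r t = 0"
proof -
  obtain d where d: "lead_coeff L = [:d:]" "d \<noteq> 0" using dvd_constant_lead[OF lead L(1)] by blast
  obtain l0 l1 where l: "L = [:l0, l1:]"
    using L(2) by (metis One_nat_def degree_eq_zeroE degree_pCons_eq_if nat.distinct(1) old.nat.inject pCons_cases)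
  then have "l1 = [:d:]" using L(2) d(1) by (auto split: if_splits)
  then have pe: "poly2 L t x = poly l0 t + x * d" for t x by (simp add: l)
  define r where "r = smult (- 1 / d) l0"
  have "poly2 L t (poly r t) = 0" for t using d(2) by (simp add: pe r_def)
  then have "poly2 P t (poly r t) = 0" for t using L(1) by auto
  moreover have "poly r t = 0" if "poly2 L t 0 = 0" for t using that by (simp add: pe r_def)
  ultimately show thesis using that by blast
qed

lemma PV_common_nonzero:
  fixes f g :: "(nat \<Rightarrow> 'a::alg_closed_field) \<Rightarrow> 'a"
  assumes "f \<in> PV" "g \<in> PV" "f a \<noteq> 0" "g b \<noteq> 0"
  obtains x where "f x \<noteq> 0" "g x \<noteq> 0"
  using irred_setD[OF irred_UNIV assms(1,2) UNIV_I assms(3) UNIV_I assms(4)] by blast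

section \<open>Points lying on all tangent hyperplanes\<close>

context smooth_cubic
begin

definition unit_vec :: "nat \<Rightarrow> nat \<Rightarrow> 'a" where
  "unit_vec l = (\<lambda>i. if i = l then 1 else 0)"

lemma A_expand: "A x v = (\<Sum>l\<le>N. v l * A x (unit_vec l))"
proof -
  have "A x v = A x (\<lambda>i. \<Sum>l\<in>{..N}. v l * unit_vec l i)"
    unfolding A_def by (intro sum.cong refl) (use idx in \<open>auto simp: unit_vec_def if_distrib cong: if_cong\<close>)
  also have "\<dots> = (\<Sum>l\<le>N. v l * A x (unit_vec l))" by (rule lin_sum[OF lin_A]) simp
  finally show ?thesis .
qed

lemma A_unit_form:
  assumes "l \<le> N" obtains q where "q \<in> forms N 2" "\<And>x. mp_eval q x = A x (unit_vec l)"
proof -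
  define m where "m i j k = (if i = l then mp_var j * mp_var k else 0 :: 'a mpoly)" for i j k
  define q where "q = (\<Sum>e\<in>E. mp_const (cf e) * (m (ia e) (ja e) (ka e) + m (ja e) (ia e) (ka e) + m (ka e) (ia e) (ja e)))"
  have m: "m i j k \<in> forms N 2" if "j \<le> N" "k \<le> N" for i j k
    using forms_mult[OF var_in_forms[OF that(1)] var_in_forms[OF that(2)]]
    by (auto simp: m_def mspan.zero numeral_2_eq_2)
  have ev: "mp_eval (m i j k) x = unit_vec l i * x j * x k" for i j k x
    by (auto simp: m_def unit_vec_def mp_eval_mult)
  have "q \<in> forms N 2" unfolding q_def
    by (intro mspan_sum mspan_scale mspan_add m) (use idx in auto)
  moreover have "mp_eval q x = A x (unit_vec l)" for x
    unfolding q_def A_def mp_eval_sum mp_eval_mult mp_eval_add ev mp_eval_const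
    by (intro sum.cong) (auto simp: algebra_simps)
  ultimately show thesis using that by blast
qed

text \<open>If \<open>w\<close> lay on all tangent hyperplanes, every line through \<open>w\<close>
  would be tangent to the cubic at its other intersection points. Outside characteristic two the
  vanishing discriminant forces a hyperplane into the cubic; in characteristic two it makes the
  partial derivatives dependent, which produces a singular point.\<close>

lemma not_strange:
  assumes w: "F w = 0" "nz w" shows "\<exists>u. F u = 0 \<and> A u w \<noteq> 0"
proof (rule ccontr)
  assume "\<not> ?thesis"
  then have contra: "\<And>u. F u = 0 \<Longrightarrow> A u w = 0" by blast
  obtain e where e: "A w e \<noteq> 0" using smooth w by blast
  \<comment> \<open>As \<open>F w = 0\<close>, the cubic on the line \<open>u + x w\<close> is
    \<open>F u + x * A u w + x^2 * A w u\<close>. By assumption the derivative vanishes at each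
    root, so roots are double.\<close>
  have disc: "(A u w)^2 = 4 * F u * A w u" for u
  proof (rule ccontr)
    assume "(A u w)^2 \<noteq> 4 * F u * A w u"
    moreover have "(\<lambda>u. (A u w)^2 - 4 * F u * A w u) \<in> PV" "(\<lambda>u. A w u) \<in> PV"
      by (intro cubic_intros)+
    ultimately obtain u where u: "(A u w)^2 - 4 * F u * A w u \<noteq> 0" "A w u \<noteq> 0"
      using PV_common_nonzero[of "\<lambda>u. (A u w)^2 - 4 * F u * A w u" "\<lambda>u. A w u" u e] e by auto
    obtain x where x: "F u + x * A u w + x^2 * A w u = 0" using quadratic_root[OF u(2)] by blast
    then have "F (lc 1 u x w) = 0" by (simp add: F_lc w)
    then have "A (lc 1 u x w) w = 0" by (rule contra)
    then have 1: "A u w = - (2 * x * A w u)"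
      by (simp add: A_lc' B_diag A_self w algebra_simps eq_neg_iff_add_eq_0)
    have 2: "F u = x^2 * A w u" using x by (simp add: 1 algebra_simps power2_eq_square)
    show False using u(1) unfolding 1 2 by (simp add: algebra_simps power2_eq_square)
  qed
  show False
  proof (cases "(2::'a) = 0")
    case False
    \<comment> \<open>At \<open>u + t e\<close> the left side of \<open>disc\<close> is divisible by
      \<open>t^2\<close>, while the right side is \<open>t\<close> times
      \<open>k * F (lc 1 u t e)\<close>. So \<open>k * F\<close> vanishes at \<open>t = 0\<close>,
      and the hyperplane \<open>A w u = 0\<close> lies in the cubic.\<close>
    have "F u = 0" if u: "A w u = 0" for u
    proof -
      have Auw: "A u w = 0" using disc[of u] u by simp
      define a b k where "a = A e w" and "b = B u e w" and "k = 4 * A w e"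
      have "k * F u + t * (k * A u e - b^2) + t^2 * (k * A e u - 2 * a * b) + t^3 * (k * F e - a^2) = 0"
        if t: "t \<notin> {0}" for t
      proof -
        have "t * (t * (b + t * a)^2) = t * (k * (F u + t * A u e + t^2 * A e u + t^3 * F e))"
          using disc[of "lc 1 u t e"] u Auw
          by (simp add: A_lc A_lc' F_lc a_def b_def k_def algebra_simps power2_eq_square power3_eq_cube)
        then have "t * (b + t * a)^2 = k * (F u + t * A u e + t^2 * A e u + t^3 * F e)"
          using t by simp
        then show ?thesis by (simp add: algebra_simps power2_eq_square power3_eq_cube)
      qed
      then have "k * F u = 0" using cubic_coeffs_eq_0[of "{0}"] by blast
      moreover have "k \<noteq> 0"
        using False e mult_eq_0_iff[of "2::'a" 2] by (simp add: k_def)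
      ultimately show ?thesis by simp
    qed
    then show False using no_hyperplane[OF lin_A e] by blast
  next
    case True
    have "(4::'a) = 2 * 2" by simp
    also have "\<dots> = 0" using True by (metis mult_zero_left)
    finally have Aw: "A u w = 0" for u using disc[of u] by simp
    \<comment> \<open>\<open>A u w = 0\<close> for all \<open>u\<close> expresses the partial
      derivative with index \<open>i0\<close> by the other \<open>N\<close>. A common zero of those
      kills the whole gradient, and Euler's formula with \<open>3 = 1\<close> puts it on the
      cubic.\<close>
    obtain i0 where i0: "i0 \<le> N" "w i0 \<noteq> 0" using w(2) by (auto simp: nz_def)
    have "\<forall>l\<in>{..N} - {i0}. \<exists>q. q \<in> forms N 2 \<and> (\<forall>x. mp_eval q x = A x (unit_vec l))"
    proof
      fix l assume "l \<in> {..N} - {i0}"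
      then show "\<exists>q. q \<in> forms N 2 \<and> (\<forall>x. mp_eval q x = A x (unit_vec l))"
        using A_unit_form[of l] by (metis DiffD1 atMost_iff)
    qed
    then obtain q where q: "\<And>l. l \<in> {..N} - {i0} \<Longrightarrow> q l \<in> forms N 2 \<and> (\<forall>x. mp_eval (q l) x = A x (unit_vec l))"
      by metis
    obtain x where x: "\<exists>i\<le>N. x i \<noteq> 0" "\<forall>l\<in>{..N} - {i0}. mp_eval (q l) x = 0"
      using common_zero[of "{..N} - {i0}" N q] q i0(1) by auto
    have 1: "A x (unit_vec l) = 0" if "l \<le> N" "l \<noteq> i0" for l using q x(2) that by auto
    have "A x w = w i0 * A x (unit_vec i0) + (\<Sum>l\<in>{..N} - {i0}. w l * A x (unit_vec l))"
      using i0(1) by (subst A_expand) (simp add: sum.remove)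
    then have "A x (unit_vec i0) = 0" using Aw[of x] 1 i0(2) by simp
    with 1 have "A x (unit_vec l) = 0" if "l \<le> N" for l using that by (cases "l = i0") auto
    then have A0: "A x v = 0" for v by (subst A_expand) simp
    have "(3::'a) = 2 + 1" by simp
    also have "\<dots> = 1" using True by (metis add_0)
    finally have "F x = 0" using A_self[of x] A0 by simp
    then show False using smooth x(1) A0 unfolding nz_def by blast
  qed
qed

lemma line_tangent':
  assumes "\<And>t. F (lc (1 - t) x t y) = 0"
  shows "F x = 0 \<and> A x y = 0 \<and> A y x = 0 \<and> F y = 0"
proof (rule line_tangent)
  show "finite {- 1 :: 'a}" by simp
  fix t :: 'a assume "t \<notin> {- 1}"
  then have t: "1 + t \<noteq> 0" by (auto simp: add_eq_0_iff)
  define c where "c = inverse (1 + t)"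
  have c: "(1 + t) * c = 1" using t by (simp add: c_def)
  then have c': "1 - t * c = c" by (simp add: algebra_simps)
  have "(1 + t) * lc c x (t * c) y i = ((1 + t) * c) * (x i + t * y i)" for i
    unfolding lc_def by (simp only: algebra_simps)
  then have "lc 1 x t y = (\<lambda>i. (1 + t) * lc c x (t * c) y i)"
    unfolding c by (auto simp: lc_def)
  then have "F (lc 1 x t y) = (1 + t)^3 * F (lc (1 - t * c) x (t * c) y)"
    unfolding c' by (simp only: F_scale)
  then show "F (lc 1 x t y) = 0" using assms by simp
qed

end

section \<open>Irreducibility of a smooth cubic hypersurface\<close>

context smooth_cubic begin
text \<open>In the plane of \<open>z1\<close>, \<open>z2\<close> and \<open>b\<close>, the component
  \<open>q\<close> through \<open>z1\<close> lies where \<open>g\<close> vanishes, so it misses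
  \<open>z2\<close>, which is on the cofactor \<open>k\<close>. The degrees of \<open>q\<close> and
  \<open>k\<close> add up to three, so one of them is a line. The point \<open>y\<close> is where it
  meets the line joining the other of \<open>z1\<close>, \<open>z2\<close> to
  \<open>b\<close>.\<close>

lemma plane_section_line:
  assumes z1: "F z1 = 0" "f z1 \<noteq> 0" and z2: "F z2 = 0" "g z2 \<noteq> 0" and f: "f \<in> PV" and g: "g \<in> PV"
    and van: "\<And>x. F x = 0 \<Longrightarrow> f x = 0 \<or> g x = 0" and b: "F b \<noteq> 0"
  shows "\<exists>c. (let y = lc 1 z2 c b in A z1 y = 0 \<and> A y z1 = 0 \<and> F y = 0) \<or>
             (let y = lc 1 z1 c b in A z2 y = 0 \<and> A y z2 = 0 \<and> F y = 0)"
proof -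
  define f0 where "f0 = [:0, A z1 z2, A z2 z1 - 2 * A z1 z2, A z1 z2 - A z2 z1:]"
  define f1 where "f1 = [:A z1 b, B z1 z2 b - 2 * A z1 b, A z1 b - B z1 z2 b + A z2 b:]"
  define f2 where "f2 = [:A b z1, A b z2 - A b z1:]"
  define P where "P = [:f0, f1, f2, [:F b:]:]"
  define v where "v t x = lc 1 (lc (1 - t) z1 t z2) x b" for t x
  have f0: "poly f0 t = F (lc (1 - t) z1 t z2)" for t
    by (simp add: f0_def F_lc z1(1) z2(1) algebra_simps power2_eq_square)
  have f1: "poly f1 t = A (lc (1 - t) z1 t z2) b" for t
    by (simp add: f1_def A_lc' algebra_simps power2_eq_square)
  have f2: "poly f2 t = A b (lc (1 - t) z1 t z2)" for t
    by (simp add: f2_def A_lc algebra_simps)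
  have P: "poly2 P t x = F (v t x)" for t x
    unfolding v_def F_lc[of 1] f0[symmetric] f1[symmetric] f2[symmetric]
    by (simp add: P_def algebra_simps power2_eq_square power3_eq_cube)
  have lead: "lead_coeff P = [:F b:]" and degP: "degree P = 3" using b by (auto simp: P_def)
  have P0: "P \<noteq> 0" using degP by auto
  have vp: "(\<lambda>p. v (fst p) (snd p) i) \<in> polyfuns {fst, snd} UNIV" for i
  proof -
    have "fst \<in> polyfuns {fst, snd} (UNIV :: 'a set)" "snd \<in> polyfuns {fst, snd} (UNIV :: 'a set)"
      by (auto intro: polyfuns.coord)
    then have "(\<lambda>p. 1 * ((1 - fst p) * z1 i + fst p * z2 i) + snd p * b i) \<in> polyfuns {fst, snd} UNIV"
      by (intro polyfuns.add polyfuns.mult polyfuns_diff[OF _ _ UNIV_I] polyfuns.const UNIV_I)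
    then show ?thesis unfolding v_def lc_def .
  qed
  have "(\<lambda>p. f (v (fst p) (snd p))) \<in> polyfuns {fst, snd} UNIV" by (rule PV_subst[OF f vp])
  from polyfuns_poly2[OF this] obtain G where G: "\<And>t x. poly2 G t x = f (v t x)"
    by auto
  have "(\<lambda>p. g (v (fst p) (snd p))) \<in> polyfuns {fst, snd} UNIV" by (rule PV_subst[OF g vp])
  from polyfuns_poly2[OF this] obtain H where H: "\<And>t x. poly2 H t x = g (v t x)"
    by auto
  have v0: "v 0 0 = z1" "v 1 0 = z2" by (auto simp: v_def lc_def)
  have "poly2 P 0 0 = 0" by (simp add: P v0 z1)
  then obtain q where q: "prime_elem q" "q dvd P" "poly2 q 0 0 = 0" using poly2_prime_factor[OF P0] by blast
  obtain k where k: "P = q * k" using q(2) by auto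
  have pos: "degree L > 0" if L: "L dvd P" "poly2 L t x = 0" for L t x
  proof (rule ccontr)
    assume "\<not> degree L > 0"
    then obtain l where l: "L = [:l:]" using degree_eq_zeroE by blast
    obtain d where "lead_coeff L = [:d:]" "d \<noteq> 0" using dvd_constant_lead[OF lead b L(1)] by blast
    then show False using l L(2) by simp
  qed
  have "q dvd G * H"
    by (rule prime_dvd_vanishing[OF lead b q(1,2) pos[OF q(2,3)]]) (use van in \<open>auto simp: P G H\<close>)
  moreover have "\<not> q dvd G"
  proof
    assume "q dvd G"
    then have "poly2 G 0 0 = 0" using q(3) by auto
    then show False using z1(2) by (simp add: G v0)
  qed
  ultimately have "q dvd H" using prime_elem_dvd_multD[OF q(1)] by blast
  have "poly2 q 1 0 \<noteq> 0"
  proof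
    assume "poly2 q 1 0 = 0"
    then have "poly2 H 1 0 = 0" using \<open>q dvd H\<close> by auto
    then show False using z2(2) by (simp add: H v0)
  qed
  moreover have "poly2 P 1 0 = 0" by (simp add: P v0 z2)
  ultimately have k0: "poly2 k 1 0 = 0" by (simp add: k)
  have kd: "k dvd P" by (simp add: k)
  have "degree q + degree k = 3" using degP P0 unfolding k by (subst degree_mult_eq[symmetric]) auto
  then have "degree q = 1 \<or> degree k = 1" using pos[OF q(2,3)] pos[OF kd k0] by linarith
  moreover have linear: "\<exists>a0 a1. (\<forall>t. F (v t (a0 + t * a1)) = 0) \<and> (\<forall>t. poly2 L t 0 = 0 \<longrightarrow> a0 + t * a1 = 0)"
    if L: "L dvd P" "degree L = 1" for L
  proof -
    obtain r where r: "\<And>t. poly2 P t (poly r t) = 0" "\<And>t. poly2 L t 0 = 0 \<Longrightarrow> poly r t = 0"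
      using linear_factor_section[OF lead b L] by blast
    have ev: "poly (f0 + r * f1 + r^2 * f2 + smult (F b) (r^3)) t = poly2 P t (poly r t)" for t
      by (simp add: P_def algebra_simps power2_eq_square power3_eq_cube)
    have z: "f0 + r * f1 + r^2 * f2 + smult (F b) (r^3) = 0"
      by (rule poly_eq_0_infinite[OF infinite_alg_closed]) (simp only: ev r(1))
    \<comment> \<open>The plane cubic has total degree three. A component that is a graph
      \<open>x = r(t)\<close> of higher degree is impossible, since the term in \<open>r^3\<close>
      would dominate.\<close>
    have "degree r \<le> 1"
    proof (rule ccontr)
      assume "\<not> degree r \<le> 1"
      then have m: "degree r \<ge> 2" and "r \<noteq> 0" by auto
      have "degree [:x1, x2, x3, x4:] \<le> 3" "degree [:x1, x2, x3:] \<le> 2" "degree [:x1, x2:] \<le> 1"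
        for x1 x2 x3 x4 :: 'a by simp_all
      then have "degree f0 \<le> 3" "degree f1 \<le> 2" "degree f2 \<le> 1"
        unfolding f0_def f1_def f2_def by blast+
      then have "degree (r * f1) \<le> degree r + 2" "degree (r^2 * f2) \<le> 2 * degree r + 1"
        using degree_mult_le[of r f1] degree_mult_le[of "r^2" f2] degree_power_le[of r 2] by linarith+
      then have "degree (f0 + r * f1 + r^2 * f2) \<le> 2 * degree r + 1"
        using \<open>degree f0 \<le> 3\<close> m by (intro degree_add_le) auto
      moreover have "f0 + r * f1 + r^2 * f2 = - smult (F b) (r^3)" using z by (simp add: eq_neg_iff_add_eq_0)
      then have "degree (f0 + r * f1 + r^2 * f2) = 3 * degree r"
        using b degree_power_eq[OF \<open>r \<noteq> 0\<close>, of 3] by simp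
      ultimately show False using m by simp
    qed
    then have "r = [:coeff r 0, coeff r 1:]"
      by (intro poly_eqI) (auto simp: coeff_pCons coeff_eq_0 split: nat.split)
    then obtain a0 a1 where "r = [:a0, a1:]" by blast
    then show ?thesis using r by (intro exI[of _ a0] exI[of _ a1]) (auto simp: P)
  qed
  ultimately show ?thesis
  proof (elim disjE)
    assume "degree q = 1"
    then obtain a0 a1 where a: "\<And>t. F (v t (a0 + t * a1)) = 0" "poly2 q 0 0 = 0 \<longrightarrow> a0 + 0 * a1 = 0"
      using linear[OF q(2)] by blast
    then have "a0 = 0" using q(3) by simp
    have "v t (t * a1) = lc (1 - t) z1 t (lc 1 z2 a1 b)" for t
      by (auto simp: v_def lc_def algebra_simps)
    then have "F (lc (1 - t) z1 t (lc 1 z2 a1 b)) = 0" for t using a(1)[of t] \<open>a0 = 0\<close> by simp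
    from line_tangent'[OF this] show ?thesis by (auto simp: Let_def)
  next
    assume "degree k = 1"
    then obtain a0 a1 where a: "\<And>t. F (v t (a0 + t * a1)) = 0" "poly2 k 1 0 = 0 \<longrightarrow> a0 + 1 * a1 = 0"
      using linear[OF kd] by blast
    then have "a1 = - a0" using k0 by (simp add: add_eq_0_iff2)
    have "v t (a0 + t * a1) = lc (1 - t) (lc 1 z1 a0 b) t z2" for t
      by (auto simp: v_def lc_def algebra_simps \<open>a1 = - a0\<close>)
    then have "F (lc (1 - t) (lc 1 z1 a0 b) t z2) = 0" for t using a(1)[of t] by simp
    from line_tangent'[OF this] show ?thesis by (auto simp: Let_def)
  qed
qed


lemma X_meets_line:
  assumes "nz y'"
  obtains a b where "a \<noteq> 0 \<or> b \<noteq> 0" "F (lc a y b y') = 0"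
proof (cases "F y' = 0")
  case True
  with that[of 0 1] show thesis by simp
next
  case False
  then obtain t where "F y + t * A y y' + t^2 * A y' y + t^3 * F y' = 0" using cubic_root by blast
  with that[of 1 t] show thesis by (simp add: F_lc)
qed

lemma X_point_in_kernel:
  assumes "lin \<phi>1" "lin \<phi>2"
  obtains w where "nz w" "F w = 0" "\<phi>1 w = 0" "\<phi>2 w = 0"
proof -
  obtain y y' i where y: "\<phi>1 y = 0" "\<phi>2 y = 0" "\<phi>1 y' = 0" "\<phi>2 y' = 0" "i \<le> N" "y i \<noteq> 0" "y' i = 0" "nz y'"
    using kernel2_pair[OF assms] by metis
  obtain a b where ab: "a \<noteq> 0 \<or> b \<noteq> 0" "F (lc a y b y') = 0" using X_meets_line[OF y(8)] by blast
  have "nz (lc a y b y')" using nz_lc[of i y y' a b] y ab(1) by simp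
  with ab y that show thesis by (simp add: lin_lc[OF assms(1)] lin_lc[OF assms(2)])
qed

text \<open>By \<open>plane_section_line\<close>, every general plane through \<open>z1\<close> and
  \<open>z2\<close> contains a line of the cubic through one of them. The position of the point
  \<open>y\<close> is forced by tangency, and a general \<open>b\<close> keeps that forced point off
  the cubic.\<close>

lemma irreducible_aux:
  assumes z1: "F z1 = 0" "nz z1" "f z1 \<noteq> 0" and z2: "F z2 = 0" "nz z2" "g z2 \<noteq> 0"
    and f: "f \<in> PV" and g: "g \<in> PV"
  shows "\<exists>x. F x = 0 \<and> f x \<noteq> 0 \<and> g x \<noteq> 0"
proof (rule ccontr)
  assume "\<not> ?thesis"
  then have van: "\<And>x. F x = 0 \<Longrightarrow> f x = 0 \<or> g x = 0" by blast
  have not_line: "\<not> (A z1 z2 = 0 \<and> A z2 z1 = 0)"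
  proof
    assume 0: "A z1 z2 = 0 \<and> A z2 z1 = 0"
    define l where "l t = lc (1 - t) z1 t z2" for t
    have l: "(\<lambda>t. l t i) \<in> PU" for i unfolding l_def lc_def by (intro polyfuns_intros)
    have l01: "l 0 = z1" "l 1 = z2" by (auto simp: l_def)
    obtain t where "f (l t) \<noteq> 0" "g (l t) \<noteq> 0"
      using PU_mult_nonzero[of "\<lambda>t. f (l t)" "\<lambda>t. g (l t)" 0 1 "{}"] PV_subst[OF f l] PV_subst[OF g l]
        z1(3) z2(3) l01 by auto
    moreover have "F (l t) = 0" using 0 by (simp add: l_def F_lc z1 z2)
    ultimately show False using van by blast
  qed
  \<comment> \<open>Tangency at \<open>z1\<close> determines \<open>y = z2 + c b\<close>, and the
    argument of \<open>F\<close> is its multiple by \<open>A z1 b\<close>. If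
    \<open>A z1 z2 = 0\<close>, then \<open>c = 0\<close> and \<open>y = z2\<close> is excluded by
    \<open>not_line\<close>, so the value 1 is a placeholder.\<close>
  define c1 where "c1 b = (if A z1 z2 = 0 then 1 else F (lc (A z1 b) z2 (- A z1 z2) b))" for b
  define c2 where "c2 b = (if A z2 z1 = 0 then 1 else F (lc (A z2 b) z1 (- A z2 z1) b))" for b
  have F_PV: "(\<lambda>b. F (lc (A z b) y a b)) \<in> PV" for z y a
    by (intro cubic_intros)
  have c_PV: "c1 \<in> PV" "c2 \<in> PV"
  proof -
    show "c1 \<in> PV"
      unfolding c1_def by (cases "A z1 z2 = 0") (simp_all add: F_PV polyfuns.const)
    show "c2 \<in> PV"
      unfolding c2_def by (cases "A z2 z1 = 0") (simp_all add: F_PV polyfuns.const)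
  qed
  obtain e1 e2 where e: "A z1 e1 \<noteq> 0" "A z2 e2 \<noteq> 0" using smooth z1 z2 by blast
  have hyper: "\<exists>b. F (lc (A z b) y (- a) b) \<noteq> 0" if "A z e \<noteq> 0" "a \<noteq> 0" for z y a e
  proof (rule ccontr)
    assume "\<not> ?thesis"
    then have *: "F (lc (A z b) y (- a) b) = 0" for b by blast
    have "F v = 0" if "A z v = 0" for v
      using *[of v] that \<open>a \<noteq> 0\<close> by (simp add: F_lc)
    then show False using no_hyperplane[OF lin_A \<open>A z e \<noteq> 0\<close>] by blast
  qed
  obtain b1 where b1: "c1 b1 \<noteq> 0" using hyper[OF e(1), of "A z1 z2" z2] unfolding c1_def by (cases "A z1 z2 = 0") auto
  obtain b2 where b2: "c2 b2 \<noteq> 0" using hyper[OF e(2), of "A z2 z1" z1] unfolding c2_def by (cases "A z2 z1 = 0") auto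
  obtain b3 where b3: "F b3 \<noteq> 0" using F_nonzero by blast
  obtain x1 where x1: "A z1 x1 \<noteq> 0" "A z2 x1 \<noteq> 0"
    by (rule PV_common_nonzero[OF lin_PV[OF lin_A] lin_PV[OF lin_A] e])
  obtain x2 where x2: "c1 x2 \<noteq> 0" "c2 x2 \<noteq> 0"
    by (rule PV_common_nonzero[OF c_PV b1 b2])
  have m: "(\<lambda>x. A z1 x * A z2 x) \<in> PV" "(\<lambda>x. c1 x * c2 x) \<in> PV" "F \<in> PV"
    using polyfuns.mult[OF lin_PV[OF lin_A[of z1]] lin_PV[OF lin_A[of z2]]] polyfuns.mult[OF c_PV]
      F_PV[of z1 "\<lambda>_. 0" 1] by (simp_all add: lc_def)
  obtain x3 where x3: "A z1 x3 * A z2 x3 \<noteq> 0" "c1 x3 * c2 x3 \<noteq> 0"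
    by (rule PV_common_nonzero[OF m(1,2), of x1 x2]) (use x1 x2 in auto)
  have m': "(\<lambda>x. (A z1 x * A z2 x) * (c1 x * c2 x)) \<in> PV" by (rule polyfuns.mult[OF m(1,2)])
  obtain b where b: "(A z1 b * A z2 b) * (c1 b * c2 b) \<noteq> 0" "F b \<noteq> 0"
    by (rule PV_common_nonzero[OF m' m(3), of x3 b3]) (use x3 b3 in auto)
  have case1: False
    if "A z y = 0" "A y z = 0" "F y = 0" "y = lc 1 z' c b" "A z b \<noteq> 0"
      and c: "(if A z z' = 0 then 1 else F (lc (A z b) z' (- A z z') b)) \<noteq> 0"
      and nl: "\<not> (A z z' = 0 \<and> A z' z = 0)" for z z' y c
  proof -
    have 1: "A z z' = - (c * A z b)" using that(1,4) by (simp add: A_lc eq_neg_iff_add_eq_0)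
    show False
    proof (cases "A z z' = 0")
      case True
      then have "c = 0" using 1 that(5) by simp
      then show False using that(2,4) True nl by simp
    next
      case False
      have "lc (A z b) z' (- A z z') b = (\<lambda>i. A z b * y i)"
        by (auto simp: 1 that(4) lc_def algebra_simps)
      then show False using c False that(3) by (simp add: F_scale)
    qed
  qed
  obtain c where "(let y = lc 1 z2 c b in A z1 y = 0 \<and> A y z1 = 0 \<and> F y = 0) \<or>
             (let y = lc 1 z1 c b in A z2 y = 0 \<and> A y z2 = 0 \<and> F y = 0)"
    using plane_section_line[OF z1(1,3) z2(1,3) f g van b(2)] by blast
  then show False
  proof (elim disjE)
    assume "let y = lc 1 z2 c b in A z1 y = 0 \<and> A y z1 = 0 \<and> F y = 0"
    then show False
      using case1[of z1 "lc 1 z2 c b" z2 c] b(1) not_line by (auto simp: Let_def c1_def)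
  next
    assume "let y = lc 1 z1 c b in A z2 y = 0 \<and> A y z2 = 0 \<and> F y = 0"
    then show False
      using case1[of z2 "lc 1 z1 c b" z1 c] b(1) not_line by (auto simp: Let_def c2_def)
  qed
qed

theorem irreducible_X: "irred_set {x. F x = 0}"
  unfolding irred_set_def
proof (intro conjI ballI impI)
  show "{x. F x = 0} \<noteq> {}" using not_nz(1)[of "\<lambda>_. 0"] by (auto simp: nz_def)
  fix f g :: "(nat \<Rightarrow> 'a) \<Rightarrow> 'a" assume f: "f \<in> PV" and g: "g \<in> PV"
  assume "\<exists>a\<in>{x. F x = 0}. f a \<noteq> 0" "\<exists>b\<in>{x. F x = 0}. g b \<noteq> 0"
  then obtain a b where ab: "F a = 0" "f a \<noteq> 0" "F b = 0" "g b \<noteq> 0" by auto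
  obtain w where w: "nz w" "F w = 0" using X_point_in_kernel[OF lin_coord lin_coord] by metis
  \<comment> \<open>Vectors whose coordinates up to \<open>N\<close> vanish also satisfy
    \<open>F x = 0\<close>, and test functions may involve later coordinates. Adding a nonzero
    multiple of \<open>w\<close> gives a genuine projective point.\<close>
  have nz: "\<exists>z. F z = 0 \<and> nz z \<and> h z \<noteq> 0" if h: "h \<in> PV" and a: "F a = 0" "h a \<noteq> 0" for h a
  proof (cases "nz a")
    case False
    have l: "(\<lambda>t. lc 1 a t w i) \<in> PU" for i unfolding lc_def by (intro polyfuns_intros)
    obtain t where t: "t \<notin> {0}" "h (lc 1 a t w) \<noteq> 0"
      using PU_mult_nonzero[of "\<lambda>t. h (lc 1 a t w)" "\<lambda>t. h (lc 1 a t w)" 0 0 "{0}"] PV_subst[OF h l] a by auto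
    have "F (lc 1 a t w) = 0" using not_nz[OF False] w by (simp add: F_lc)
    moreover have "nz (lc 1 a t w)" using w(1) False t(1) by (auto simp: nz_def lc_def)
    ultimately show ?thesis using t(2) by blast
  qed (use a in blast)
  obtain z1 z2 where "F z1 = 0" "nz z1" "f z1 \<noteq> 0" "F z2 = 0" "nz z2" "g z2 \<noteq> 0"
    using nz[OF f ab(1,2)] nz[OF g ab(3,4)] by blast
  from irreducible_aux[OF this f g] show "\<exists>x\<in>{x. F x = 0}. f x \<noteq> 0 \<and> g x \<noteq> 0" by auto
qed

end

section \<open>Residual points of tangent lines\<close>

context smooth_cubic
begin

text \<open>For \<open>F u = 0\<close> and tangent \<open>v\<close>, \<open>F (lc a u b v)\<close>
  is \<open>b^2 * (a * A v u + b * F v)\<close>. The tangent section is a cone with vertex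
  \<open>u\<close> exactly if this never involves \<open>a\<close>.\<close>

definition noncone :: "(nat \<Rightarrow> 'a) \<Rightarrow> bool" where
  "noncone u \<longleftrightarrow> (\<exists>v. A u v = 0 \<and> A v u \<noteq> 0)"

text \<open>The root of the linear factor \<open>a * A v u + b * F v\<close> left on a tangent line
  at \<open>u\<close>. It is a polynomial expression and becomes the zero vector when the line lies
  in the cubic.\<close>

definition resid :: "(nat \<Rightarrow> 'a) \<Rightarrow> (nat \<Rightarrow> 'a) \<Rightarrow> nat \<Rightarrow> 'a" where
  "resid u v = lc (F v) u (- A v u) v"

text \<open>Free vectors \<open>w\<close>, \<open>w'\<close> are turned polynomially into a tangent
  vector. All tangent directions arise, up to a nonzero factor, by taking \<open>w\<close> tangent
  and \<open>w'\<close> not.\<close>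

definition tangent_vec :: "(nat \<Rightarrow> 'a) \<Rightarrow> (nat \<Rightarrow> 'a) \<Rightarrow> (nat \<Rightarrow> 'a) \<Rightarrow> nat \<Rightarrow> 'a" where
  "tangent_vec u w w' = lc (A u w') w (- A u w) w'"

lemma A_tangent_vec [simp]: "A u (tangent_vec u w w') = 0"
  by (simp add: tangent_vec_def A_lc)

lemma tangent_vec_tangent: "A u v = 0 \<Longrightarrow> tangent_vec u v w = (\<lambda>i. A u w * v i)"
  by (auto simp: tangent_vec_def lc_def)

lemma noncone_nz: "noncone u \<Longrightarrow> nz u"
  using nz_A(1) unfolding noncone_def by blast

lemma noncone_iff:
  assumes "F u = 0"
  shows "noncone u \<longleftrightarrow> (\<exists>w w'. A (tangent_vec u w w') u \<noteq> 0)"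
proof
  assume nc: "noncone u"
  then obtain v where v: "A u v = 0" "A v u \<noteq> 0" unfolding noncone_def by blast
  obtain w where "A u w \<noteq> 0" using smooth[OF assms noncone_nz[OF nc]] by blast
  then have "A (tangent_vec u v w) u \<noteq> 0" using v by (simp add: tangent_vec_tangent A_scale)
  then show "\<exists>w w'. A (tangent_vec u w w') u \<noteq> 0" by blast
next
  assume "\<exists>w w'. A (tangent_vec u w w') u \<noteq> 0"
  then show "noncone u" unfolding noncone_def using A_tangent_vec by blast
qed

lemma noncone_scale:
  assumes "noncone (\<lambda>i. c * u i)" shows "noncone u"
proof -
  obtain v where "A (\<lambda>i. c * u i) v = 0" "A v (\<lambda>i. c * u i) \<noteq> 0" using assms unfolding noncone_def by blast
  then show ?thesis unfolding noncone_def by (intro exI[of _ v]) (auto simp: A_scale A_scale')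
qed

lemma resid_X:
  assumes "F u = 0" "A u v = 0"
  shows "F (resid u v) = 0" "A u (resid u v) = 0" "A (resid u v) u = (A v u)^3"
    "A (resid u v) v = (A v u)^2 * F v"
  using assms
  by (simp_all add: resid_def F_lc A_lc A_lc' B_diag A_self)
    (simp_all add: algebra_simps power2_eq_square power3_eq_cube)

lemma resid_scale: "resid u (\<lambda>i. c * v i) = (\<lambda>i. c^3 * resid u v i)"
  by (auto simp: resid_def lc_def F_scale A_scale algebra_simps power2_eq_square power3_eq_cube)

lemma resid_scale': "resid (\<lambda>i. c * u i) v = (\<lambda>i. c * resid u v i)"
  by (auto simp: resid_def lc_def A_scale' algebra_simps)

text \<open>The differentials along the line are quadratic in \<open>t\<close>. If almost all are
  multiples of \<eta>, so are their three coefficients, and a root of the resulting scalar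
  quadratic, or \<open>y\<close> if it has no quadratic term, is a singular point.\<close>

lemma line_gauss_varies:
  assumes line: "F x = 0" "F y = 0" "A x y = 0" "A y x = 0"
    and nz: "\<And>a b. a \<noteq> 0 \<or> b \<noteq> 0 \<Longrightarrow> nz (lc a x b y)"
    and T: "finite T" "\<And>t. t \<notin> T \<Longrightarrow> \<exists>\<kappa>. \<forall>w. A (lc 1 x t y) w = \<kappa> * \<eta> w"
  shows False
proof -
  have sm: "\<exists>w. A (lc a x b y) w \<noteq> 0" if "a \<noteq> 0 \<or> b \<noteq> 0" for a b
    by (rule smooth[OF _ nz[OF that]]) (simp add: F_lc line)
  obtain t0 where t0: "t0 \<notin> T" using T(1) infinite_alg_closed ex_new_if_finite by blast
  obtain w' where w': "\<eta> w' \<noteq> 0" using T(2)[OF t0] sm[of 1 t0] by (metis mult_zero_right one_neq_zero)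
  have pr: "A x w * \<eta> w' = A x w' * \<eta> w \<and> B x y w * \<eta> w' = B x y w' * \<eta> w \<and> A y w * \<eta> w' = A y w' * \<eta> w" for w
  proof -
    have "(A x w * \<eta> w' - A x w' * \<eta> w) + t * (B x y w * \<eta> w' - B x y w' * \<eta> w)
        + t^2 * (A y w * \<eta> w' - A y w' * \<eta> w) + t^3 * 0 = 0" if "t \<notin> T" for t
    proof -
      obtain \<kappa> where "\<And>w. A (lc 1 x t y) w = \<kappa> * \<eta> w" using T(2)[OF \<open>t \<notin> T\<close>] by blast
      then have "A (lc 1 x t y) w * \<eta> w' - A (lc 1 x t y) w' * \<eta> w = 0" by simp
      then show ?thesis by (simp add: A_lc' algebra_simps)
    qed
    from cubic_coeffs_eq_0[OF T(1) this] show ?thesis by simp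
  qed
  show False
  proof (cases "A y w' = 0")
    case True
    then have "A y w = 0" for w using pr[of w] w' by simp
    then show False using sm[of 0 1] by simp
  next
    case False
    then obtain t where t: "A x w' + t * B x y w' + t^2 * A y w' = 0" using quadratic_root by blast
    have "A (lc 1 x t y) w = 0" for w
    proof -
      have "\<eta> w' * A (lc 1 x t y) w = (A x w * \<eta> w') + t * (B x y w * \<eta> w') + t^2 * (A y w * \<eta> w')"
        by (simp add: A_lc' algebra_simps)
      also have "\<dots> = (A x w' + t * B x y w' + t^2 * A y w') * \<eta> w"
        using pr[of w] by (simp only: algebra_simps)
      finally show ?thesis using t w' by simp
    qed
    then show False using sm[of 1 t] by simp
  qed
qed

text \<open>If every point of the line were a cone vertex, the discriminant of the differentials
  along it would vanish. Outside characteristic two this yields a singular point on the line; in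
  characteristic two it puts \<open>z\<close> on all tangent hyperplanes.\<close>

lemma line_has_noncone:
  assumes line: "F z = 0" "F u = 0" "A z u = 0" "A u z = 0"
    and nz: "\<And>a b. a \<noteq> 0 \<or> b \<noteq> 0 \<Longrightarrow> nz (lc a z b u)"
  shows "\<exists>a b. (a \<noteq> 0 \<or> b \<noteq> 0) \<and> noncone (lc a z b u)"
proof (rule ccontr)
  assume "\<not> ?thesis"
  then have cone: "a * A v z + b * A v u = 0" if "a \<noteq> 0 \<or> b \<noteq> 0" "a^2 * A z v + a * b * B z u v + b^2 * A u v = 0" for a b v
    using that unfolding noncone_def A_lc A_lc' by blast
  have sm: "\<exists>w. a^2 * A z w + a * b * B z u w + b^2 * A u w \<noteq> 0" if "a \<noteq> 0 \<or> b \<noteq> 0" for a b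
    using smooth[OF _ nz[OF that]] by (simp add: F_lc line A_lc')
  have "nz z" using nz[of 1 0] by simp
  then obtain vz where vz: "A vz z \<noteq> 0" using not_strange[OF line(1)] by blast
  \<comment> \<open>The points of the line whose tangent hyperplane contains \<open>v\<close> are
    the roots of a binary quadratic form. By the cone condition the linear form
    \<open>a * A v z + b * A v u\<close> vanishes at each, so the roots coincide where it is not
    zero.\<close>
  have disc: "(B z u v)^2 = 4 * A z v * A u v" for v
  proof (rule ccontr)
    assume "(B z u v)^2 \<noteq> 4 * A z v * A u v"
    moreover have "(\<lambda>v. (B z u v)^2 - 4 * A z v * A u v) \<in> PV" "(\<lambda>v. A v z) \<in> PV"
      by (intro cubic_intros)+
    ultimately obtain v where v: "(B z u v)^2 - 4 * A z v * A u v \<noteq> 0" "A v z \<noteq> 0"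
      using PV_common_nonzero[of "\<lambda>v. (B z u v)^2 - 4 * A z v * A u v" "\<lambda>v. A v z" v vz] vz by auto
    have A0: "A z v \<noteq> 0" using cone[of 1 0 v] v(2) by auto
    obtain a1 where a1: "A u v + a1 * B z u v + a1^2 * A z v = 0" using quadratic_root[OF A0] by blast
    define a2 where "a2 = - B z u v / A z v - a1"
    have Bz: "B z u v = - (a1 + a2) * A z v" using A0 by (simp add: a2_def field_simps)
    have Au: "A u v = a1 * a2 * A z v" using a1 by (simp add: Bz algebra_simps power2_eq_square)
    have 1: "a1 * A v z + 1 * A v u = 0" by (rule cone) (use a1 in \<open>simp_all add: algebra_simps\<close>)
    have 2: "a2 * A v z + 1 * A v u = 0"
      by (rule cone) (simp_all add: Bz Au algebra_simps power2_eq_square)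
    have "(a1 - a2) * A v z = (a1 * A v z + 1 * A v u) - (a2 * A v z + 1 * A v u)"
      by (simp add: algebra_simps)
    then have "(a1 - a2) * A v z = 0" unfolding 1 2 by simp
    then have "a1 = a2" using v(2) by simp
    then show False using v(1) by (simp add: Bz Au algebra_simps power2_eq_square)
  qed
  show False
  proof (cases "(2::'a) = 0")
    case False
    then have four: "(4::'a) \<noteq> 0" using mult_eq_0_iff[of "2::'a" 2] by simp
    obtain v1 where v1: "A z v1 \<noteq> 0" using sm[of 1 0] by auto
    define \<beta> where "\<beta> = B z u v1 / A z v1"
    have Bz: "B z u v = \<beta> * A z v" for v
    proof -
      define v0 where "v0 = lc 1 v (- (A z v / A z v1)) v1"
      have "A z v0 = 0" using v1 by (simp add: v0_def A_lc)
      then have "B z u v0 = 0" using disc[of v0] by simp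
      then show ?thesis by (simp add: v0_def B_lc \<beta>_def)
    qed
    have Au: "4 * A u v = \<beta>^2 * A z v" if "A z v \<noteq> 0" for v
      using disc[of v] that by (simp add: Bz power2_eq_square mult.assoc)
    have Au': "4 * A u v = \<beta>^2 * A z v" for v
    proof (cases "A z v = 0")
      case True
      then have "A z (lc 1 v 1 v1) \<noteq> 0" using v1 by (simp add: A_lc)
      then have "4 * (A u v + A u v1) = \<beta>^2 * A z v1" using Au[of "lc 1 v 1 v1"] True by (simp add: A_lc)
      then have "4 * A u v = 0" using Au[OF v1] by (simp add: algebra_simps)
      with True show ?thesis by simp
    qed (rule Au)
    \<comment> \<open>Four times the differential at \<open>lc a z b u\<close> is now the square of
      \<open>2 * a + \<beta> * b\<close> times \<open>A z\<close>, so the root of this square is a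
      singular point.\<close>
    have "(-\<beta>)^2 * A z w + (-\<beta>) * 2 * B z u w + 2^2 * A u w = 0" for w
      using Au'[of w] by (simp add: Bz power2_eq_square)
    then show False using sm[of "-\<beta>" 2] False by blast
  next
    case True
    have "(4::'a) = 2 * 2" by simp
    also have "\<dots> = 0" using True by (metis mult_zero_left)
    finally have four: "(4::'a) = 0" .
    have Bz: "B z u v = 0" for v using disc[of v] four by simp
    have sqrt: "\<exists>a. a^2 = c" for c :: 'a
      using quadratic_root[of 1 "- c" 0] by (auto simp: algebra_simps)
    have key: "A u v * (A v z)^2 = A z v * (A v u)^2" for v
    proof (cases "A u v = 0 \<and> A z v = 0")
      case False
      obtain a b where ab: "a^2 = A u v" "b^2 = A z v" using sqrt by metis
      have "a * A v z + b * A v u = 0"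
      proof (rule cone)
        show "a \<noteq> 0 \<or> b \<noteq> 0" using ab False by auto
        have "a^2 * A z v + a * b * B z u v + b^2 * A u v = 2 * (A z v * A u v)" by (simp add: ab Bz)
        then show "a^2 * A z v + a * b * B z u v + b^2 * A u v = 0" using True by simp
      qed
      then have "(a * A v z)^2 = (b * A v u)^2" by (simp add: eq_neg_iff_add_eq_0[symmetric])
      then show ?thesis by (simp add: power_mult_distrib ab)
    qed simp
    have "\<exists>e2. A z e2 = 0 \<and> A u e2 \<noteq> 0"
    proof (rule ccontr)
      assume "\<not> ?thesis"
      then have ker: "A z v = 0 \<Longrightarrow> A u v = 0" for v by blast
      obtain v1 where v1: "A z v1 \<noteq> 0" using sm[of 1 0] by auto
      define k where "k = A u v1 / A z v1"
      have Auk: "A u v = k * A z v" for v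
      proof -
        have "A u (lc 1 v (- (A z v / A z v1)) v1) = 0" by (rule ker) (use v1 in \<open>simp add: A_lc\<close>)
        then show ?thesis by (simp add: A_lc k_def)
      qed
      obtain a where a: "a^2 = - k" using sqrt by blast
      have "a^2 * A z w + a * 1 * B z u w + 1^2 * A u w = 0" for w by (simp add: a Auk Bz)
      then show False using sm[of a 1] by simp
    qed
    then obtain e2 where e2: "A z e2 = 0" "A u e2 \<noteq> 0" by blast
    have qz: "A v z = 0" if "A z v = 0" for v using cone[of 1 0 v] that by simp
    have qu: "A v u = 0" if "A u v = 0" for v using cone[of 0 1 v] that by simp
    have "A v z = 0" for v
    proof (cases "A z v = 0")
      case False
      define s where "s = A u v / A u e2"
      define w where "w = lc 1 v (- s) e2"
      have w: "A u w = 0" "A z w = A z v" using e2 by (simp_all add: w_def A_lc s_def)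
      have v: "v = lc 1 w s e2" by (auto simp: w_def lc_def)
      define p where "p = A z v"
      define a \<beta> \<gamma> \<delta> where "a = A w z" and "\<beta> = B w e2 z" and "\<gamma> = B w e2 u" and "\<delta> = A e2 u"
      \<comment> \<open>Along \<open>w + t e2\<close> the relation \<open>key\<close> equates a
        square with \<open>t\<close> times a square. With \<open>2 = 0\<close>, one side has only
        even powers of \<open>t\<close> and the other only odd ones, so \<open>a\<close> and \<beta>
        vanish.\<close>
      have "A u e2 * a^2 + t * (2 * A u e2 * a * \<beta> - p * \<gamma>^2) + t^2 * (A u e2 * \<beta>^2 - 2 * p * \<gamma> * \<delta>) + t^3 * (- p * \<delta>^2) = 0"
        if t: "t \<notin> {0}" for t
      proof -
        have "A u (lc 1 w t e2) = t * A u e2" "A z (lc 1 w t e2) = p"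
          "A (lc 1 w t e2) z = a + t * \<beta>" "A (lc 1 w t e2) u = t * (\<gamma> + t * \<delta>)"
          using w e2 qz[OF e2(1)] qu[OF w(1)]
          by (simp_all add: A_lc A_lc' p_def a_def \<beta>_def \<gamma>_def \<delta>_def algebra_simps power2_eq_square)
        then have "t * (A u e2 * (a + t * \<beta>)^2) = t * (p * t * (\<gamma> + t * \<delta>)^2)"
          using key[of "lc 1 w t e2"] by (simp add: algebra_simps power2_eq_square)
        then have "A u e2 * (a + t * \<beta>)^2 = p * t * (\<gamma> + t * \<delta>)^2" using t by simp
        then show ?thesis by (simp add: algebra_simps power2_eq_square power3_eq_cube)
      qed
      from cubic_coeffs_eq_0[OF _ this]
      have "A u e2 * a^2 = 0" "A u e2 * \<beta>^2 - 2 * p * \<gamma> * \<delta> = 0" by auto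
      then have "a = 0" "\<beta> = 0" using e2(2) True by auto
      then show ?thesis unfolding v using qz[OF e2(1)] by (simp add: A_lc' a_def \<beta>_def)
    qed (rule qz)
    then show False using vz by blast
  qed
qed

end

section \<open>Tangent hyperplanes in a pencil\<close>

text \<open>Vanishing for all arguments means that the three functionals are dependent, that is, the
  hyperplanes they define belong to a pencil.\<close>

definition det3 :: "('v \<Rightarrow> 'a::comm_ring_1) \<Rightarrow> ('v \<Rightarrow> 'a) \<Rightarrow> ('v \<Rightarrow> 'a) \<Rightarrow> 'v \<Rightarrow> 'v \<Rightarrow> 'v \<Rightarrow> 'a" where
  "det3 l1 l2 l3 x y z = l1 x * (l2 y * l3 z - l2 z * l3 y) - l1 y * (l2 x * l3 z - l2 z * l3 x)
     + l1 z * (l2 x * l3 y - l2 y * l3 x)"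

lemma det3_kernel:
  fixes a :: "'a::idom"
  assumes "a * l1 x + b * l1 y + c * l1 z = 0" "a * l2 x + b * l2 y + c * l2 z = 0"
    "a * l3 x + b * l3 y + c * l3 z = 0" "det3 l1 l2 l3 x y z \<noteq> 0"
  shows "a = 0 \<and> b = 0 \<and> c = 0"
proof -
  have 1: "a * det3 l1 l2 l3 x y z = (a * l1 x + b * l1 y + c * l1 z) * (l2 y * l3 z - l2 z * l3 y)
     - (a * l2 x + b * l2 y + c * l2 z) * (l1 y * l3 z - l1 z * l3 y)
     + (a * l3 x + b * l3 y + c * l3 z) * (l1 y * l2 z - l1 z * l2 y)"
    by (simp add: det3_def algebra_simps)
  have 2: "b * det3 l1 l2 l3 x y z = (a * l1 x + b * l1 y + c * l1 z) * (l2 z * l3 x - l2 x * l3 z)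
     - (a * l2 x + b * l2 y + c * l2 z) * (l1 z * l3 x - l1 x * l3 z)
     + (a * l3 x + b * l3 y + c * l3 z) * (l1 z * l2 x - l1 x * l2 z)"
    by (simp add: det3_def algebra_simps)
  have 3: "c * det3 l1 l2 l3 x y z = (a * l1 x + b * l1 y + c * l1 z) * (l2 x * l3 y - l2 y * l3 x)
     - (a * l2 x + b * l2 y + c * l2 z) * (l1 x * l3 y - l1 y * l3 x)
     + (a * l3 x + b * l3 y + c * l3 z) * (l1 x * l2 y - l1 y * l2 x)"
    by (simp add: det3_def algebra_simps)
  from 1 2 3 have "a * det3 l1 l2 l3 x y z = 0" "b * det3 l1 l2 l3 x y z = 0" "c * det3 l1 l2 l3 x y z = 0"
    unfolding assms(1-3) by simp_all
  then show ?thesis using assms(4) by simp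
qed

definition homog :: "nat \<Rightarrow> ((nat \<Rightarrow> 'a::comm_ring_1) \<Rightarrow> 'a) \<Rightarrow> bool" where
  "homog d G \<longleftrightarrow> G \<in> PV \<and> (\<forall>c x. G (\<lambda>i. c * x i) = c ^ d * G x)"

lemma homog_PV: "homog d G \<Longrightarrow> G \<in> PV"
  and homog_scale: "homog d G \<Longrightarrow> G (\<lambda>i. c * x i) = c ^ d * G x"
  by (auto simp: homog_def)

lemma homog_lc_0: "homog d G \<Longrightarrow> G (lc 0 x b y) = b ^ d * G y" "homog d G \<Longrightarrow> G (lc a x 0 y) = a ^ d * G x"
  by (simp_all add: lc_def homog_scale)

context smooth_cubic
begin

text \<open>On the line through two points of the cubic, \<open>F (lc a x b y)\<close> is
  \<open>a * b * (a * A x y + b * A y x)\<close>. The last factor gives the third intersection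
  point.\<close>

definition third :: "(nat \<Rightarrow> 'a) \<Rightarrow> (nat \<Rightarrow> 'a) \<Rightarrow> nat \<Rightarrow> 'a" where
  "third x y = lc (A y x) x (- A x y) y"

lemma third_X:
  assumes "F x = 0" "F y = 0"
  shows "F (third x y) = 0" "A (third x y) x = - (A y x * (A x y)^2)" "A x (third x y) = - ((A x y)^2)"
    "third x (third x y) = (\<lambda>i. - ((A x y)^3) * y i)"
proof -
  show 1: "A (third x y) x = - (A y x * (A x y)^2)" "A x (third x y) = - ((A x y)^2)"
    using assms by (simp_all add: third_def A_lc A_lc' B_diag A_self algebra_simps power2_eq_square)
  show "F (third x y) = 0"
    using assms by (simp add: third_def F_lc algebra_simps power2_eq_square)
  show "third x (third x y) = (\<lambda>i. - ((A x y)^3) * y i)"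
    unfolding third_def[of x "third x y"] 1
    by (auto simp: third_def lc_def algebra_simps power2_eq_square power3_eq_cube)
qed

text \<open>An open condition met somewhere on the cubic. Irreducibility lets finitely many such
  conditions be multiplied and met at one point.\<close>

definition nonvan :: "((nat \<Rightarrow> 'a) \<Rightarrow> 'a) \<Rightarrow> bool" where
  "nonvan f \<longleftrightarrow> f \<in> PV \<and> (\<exists>x. F x = 0 \<and> f x \<noteq> 0)"

lemma nonvanI: "f \<in> PV \<Longrightarrow> F x = 0 \<Longrightarrow> f x \<noteq> 0 \<Longrightarrow> nonvan f"
  by (auto simp: nonvan_def)

lemma nonvan_mult: "nonvan f \<Longrightarrow> nonvan g \<Longrightarrow> nonvan (\<lambda>x. f x * g x)"
proof -
  assume "nonvan f" "nonvan g"
  then obtain a b where *: "f \<in> PV" "g \<in> PV" "F a = 0" "f a \<noteq> 0" "F b = 0" "g b \<noteq> 0"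
    unfolding nonvan_def by blast
  then obtain x where "x \<in> {x. F x = 0}" "f x \<noteq> 0" "g x \<noteq> 0"
    using irred_setD[OF irreducible_X *(1,2), of a b] by blast
  then show "nonvan (\<lambda>x. f x * g x)" using * by (intro nonvanI[of _ x]) (auto intro: polyfuns.mult)
qed

lemma nonvan_lin: "lin l \<Longrightarrow> l w \<noteq> 0 \<Longrightarrow> nonvan l"
  using lin_nonzero_on_X lin_PV unfolding nonvan_def by blast

text \<open>Where \<open>A z w\<close> is nonzero, \<open>third z\<close> is an involution up to
  scalars. So \<open>third z\<close> sends the point \<open>third z w\<close> back to a multiple of
  the given point \<open>w\<close>, where \<open>G\<close> is nonzero.\<close>

lemma nonvan_third:
  assumes G: "homog d G" "nonvan G" and z: "F z = 0" "A z v \<noteq> 0"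
  shows "nonvan (\<lambda>w. G (third z w))"
proof -
  obtain w where w: "F w = 0" "G w * A z w \<noteq> 0"
    using nonvan_mult[OF G(2) nonvan_lin[OF lin_A z(2)]] by (auto simp: nonvan_def)
  have "G (third z (third z w)) = (- ((A z w)^3)) ^ d * G w"
    unfolding third_X(4)[OF z(1) w(1)] by (rule homog_scale[OF G(1)])
  then have "G (third z (third z w)) \<noteq> 0" using w(2) by simp
  moreover have "(\<lambda>w. G (third z w)) \<in> PV"
    by (rule PV_subst[OF homog_PV[OF G(1)]]) (unfold third_def, intro cubic_intros)
  ultimately show ?thesis using third_X(1)[OF z(1) w(1)] by (intro nonvanI)
qed

text \<open>For general points \<open>z\<close> and \<open>w\<close> of the cubic, their line meets
  it only in \<open>z\<close>, \<open>w\<close> and \<open>third z w\<close>, and \<open>G\<close>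
  is nonzero at all three. Another point of the line serves as \<open>b\<close>; the remaining
  inequalities are open conditions used later to choose a plane.\<close>

lemma line_avoiding_zeros:
  assumes G: "homog d G" "nonvan G" and u0: "A u0 e0 \<noteq> 0"
    and l: "A u1 e1 * A u2 e2 - A u1 e2 * A u2 e1 \<noteq> 0"
  obtains z b where "F z = 0" "F b \<noteq> 0" "A u0 z \<noteq> 0" "A u1 z * A u2 b - A u2 z * A u1 b \<noteq> 0"
    "\<And>x. F (lc x b 1 z) = 0 \<Longrightarrow> G (lc x b 1 z) \<noteq> 0"
proof -
  have "A u1 e1 \<noteq> 0 \<or> A u1 e2 \<noteq> 0" using l by auto
  then have "nonvan (A u1)" using nonvan_lin[OF lin_A] by blast
  then have "nonvan (\<lambda>x. A u1 x * (A u0 x * G x))"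
    using nonvan_mult G(2) nonvan_lin[OF lin_A u0] by blast
  then obtain z where z: "F z = 0" "A u1 z \<noteq> 0" "A u0 z \<noteq> 0" "G z \<noteq> 0" by (auto simp: nonvan_def)
  obtain v where v: "A z v \<noteq> 0" using smooth[OF z(1)] nz_A(1)[OF z(2)] by blast
  have "A u1 z * A u2 e1 - A u2 z * A u1 e1 \<noteq> 0 \<or> A u1 z * A u2 e2 - A u2 z * A u1 e2 \<noteq> 0"
  proof (rule ccontr)
    assume "\<not> ?thesis"
    then have "A u1 z * A u2 e1 = A u2 z * A u1 e1" "A u1 z * A u2 e2 = A u2 z * A u1 e2" by auto
    then have "A u1 z * (A u1 e1 * A u2 e2 - A u1 e2 * A u2 e1) = 0"
      by (simp add: right_diff_distrib mult.left_commute[of "A u1 z"])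
    then show False using z(2) l by simp
  qed
  moreover have lin': "lin (\<lambda>x. A u1 z * A u2 x + (- A u2 z) * A u1 x)"
    by (intro lin_comb lin_A)
  ultimately have "nonvan (\<lambda>x. A u1 z * A u2 x + (- A u2 z) * A u1 x)"
    using nonvan_lin[OF lin'] by auto
  then have "nonvan (\<lambda>x. (A u1 z * A u2 x + (- A u2 z) * A u1 x) * (A z x * (G x * G (third z x))))"
    using nonvan_mult G(2) nonvan_lin[OF lin_A v] nonvan_third[OF G z(1) v] by blast
  then obtain w where w: "F w = 0" "A u1 z * A u2 w - A u2 z * A u1 w \<noteq> 0" "A z w \<noteq> 0" "G w \<noteq> 0"
    "G (third z w) \<noteq> 0" by (auto simp: nonvan_def)
  have avoid: "G (lc a z c w) \<noteq> 0" if "a \<noteq> 0 \<or> c \<noteq> 0" "F (lc a z c w) = 0" for a c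
  proof -
    have "a * c * (a * A z w + c * A w z) = 0" using that(2)
      by (simp add: F_lc z w algebra_simps power2_eq_square)
    then consider "a = 0" | "c = 0" | "a \<noteq> 0" "c \<noteq> 0" "a * A z w + c * A w z = 0" by auto
    then show ?thesis
    proof cases
      case 1
      then show ?thesis using that(1) w(4) by (simp add: homog_lc_0[OF G(1)])
    next
      case 2
      then show ?thesis using that(1) z(4) by (simp add: homog_lc_0[OF G(1)])
    next
      case 3
      define k where "k = - c / A z w"
      have c: "c = - (k * A z w)" using w(3) by (simp add: k_def)
      have "a * A z w = (k * A w z) * A z w" using 3(3) by (simp add: c algebra_simps)
      then have a: "a = k * A w z" using w(3) by simp
      have "lc a z c w = (\<lambda>i. k * third z w i)"
        by (auto simp: lc_def third_def a c algebra_simps)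
      moreover have "k \<noteq> 0" using c 3(2) by auto
      ultimately show ?thesis using w(5) by (simp add: homog_scale[OF G(1)])
    qed
  qed
  have "finite ({0, - A z w / A w z})" by simp
  then obtain \<mu> where \<mu>: "\<mu> \<notin> {0, - A z w / A w z}" using infinite_alg_closed ex_new_if_finite by blast
  define b where "b = lc 1 z \<mu> w"
  have "A z w + \<mu> * A w z \<noteq> 0"
  proof (cases "A w z = 0")
    case False
    show ?thesis
    proof
      assume "A z w + \<mu> * A w z = 0"
      then have "\<mu> * A w z = - A z w" by (simp add: eq_neg_iff_add_eq_0 add.commute)
      then have "\<mu> = - A z w / A w z" using False by (metis nonzero_mult_div_cancel_right)
      then show False using \<mu> by simp
    qed
  qed (use w(3) in simp)
  moreover have "F b = \<mu> * (A z w + \<mu> * A w z)"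
    by (simp add: b_def F_lc z w algebra_simps power2_eq_square)
  ultimately have "F b \<noteq> 0" using \<mu> by simp
  moreover have "A u1 z * A u2 b - A u2 z * A u1 b = \<mu> * (A u1 z * A u2 w - A u2 z * A u1 w)"
    by (simp add: b_def A_lc algebra_simps)
  then have "A u1 z * A u2 b - A u2 z * A u1 b \<noteq> 0" using w(2) \<mu> by simp
  moreover have "G (lc x b 1 z) \<noteq> 0" if "F (lc x b 1 z) = 0" for x
  proof -
    have eq: "lc x b 1 z = lc (x + 1) z (x * \<mu>) w" by (auto simp: b_def lc_def algebra_simps)
    show ?thesis unfolding eq by (rule avoid) (use that \<mu> in \<open>auto simp: eq add_eq_0_iff2\<close>)
  qed
  ultimately show thesis using that[of z b] z by blast
qed

definition plane_pt :: "(nat \<Rightarrow> 'a) \<Rightarrow> (nat \<Rightarrow> 'a) \<Rightarrow> (nat \<Rightarrow> 'a) \<Rightarrow> 'a \<times> 'a \<times> 'a \<Rightarrow> nat \<Rightarrow> 'a" where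
  "plane_pt b z y p = (case p of (\<alpha>, \<beta>, \<gamma>) \<Rightarrow> lc 1 (lc \<alpha> b \<beta> z) \<gamma> y)"

lemma A_plane_pt: "A u (plane_pt b z y (\<alpha>, \<beta>, \<gamma>)) = \<alpha> * A u b + \<beta> * A u z + \<gamma> * A u y"
  by (simp add: plane_pt_def A_lc)

text \<open>Where the \<open>z\<close>-coordinate is 1, \<open>bivariate_finite_zeros\<close>
  applies: the fibres are lines through \<open>b\<close>, the leading coefficient is
  \<open>F b\<close>, and the fibre over 0 is the line avoiding the zeros of \<open>G\<close>. The
  other points of the cubic lie on the line through \<open>b\<close> and \<open>y\<close> and are
  finitely many because \<open>F b \<noteq> 0\<close>.\<close>

lemma plane_finite_zeros:
  assumes G: "homog d G" and b: "F b \<noteq> 0"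
    and avoid: "\<And>x. F (lc x b 1 z) = 0 \<Longrightarrow> G (lc x b 1 z) \<noteq> 0"
  obtains T :: "('a \<times> 'a \<times> 'a) set" where "finite T" "(0, 0, 0) \<notin> T"
    "\<And>p. p \<noteq> (0, 0, 0) \<Longrightarrow> F (plane_pt b z y p) = 0 \<Longrightarrow> G (plane_pt b z y p) = 0 \<Longrightarrow>
      \<exists>\<kappa>. \<exists>q\<in>T. plane_pt b z y p = (\<lambda>i. \<kappa> * plane_pt b z y q i) \<and> \<kappa> \<noteq> 0"
proof -
  define l where "l t = lc 1 z t y" for t
  have l: "(\<lambda>t. l t i) \<in> PU" for i unfolding l_def lc_def by (intro polyfuns_intros)
  have "(\<lambda>t. F (l t)) \<in> PU" "(\<lambda>t. A (l t) b) \<in> PU" "(\<lambda>t. A b (l t)) \<in> PU"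
    by (intro cubic_intros l)+
  then obtain f0 f1 f2 where f: "\<And>t. F (l t) = poly f0 t" "\<And>t. A (l t) b = poly f1 t" "\<And>t. A b (l t) = poly f2 t"
    by (metis PU_poly)
  define P where "P = [:f0, f1, f2, [:F b:]:]"
  have P: "poly2 P t x = F (lc x b 1 (l t))" for t x
    unfolding F_lc f by (simp add: P_def f algebra_simps power2_eq_square power3_eq_cube)
  have lead: "lead_coeff P = [:F b:]" using b by (auto simp: P_def)
  have "(\<lambda>p. G (lc (snd p) b 1 (l (fst p)))) \<in> polyfuns {fst, snd} UNIV"
  proof (rule PV_subst[OF homog_PV[OF G]])
    fix i
    have "fst \<in> polyfuns {fst, snd} (UNIV :: 'a set)" "snd \<in> polyfuns {fst, snd} (UNIV :: 'a set)"
      by (auto intro: polyfuns.coord)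
    then have "(\<lambda>p. snd p * b i + 1 * (1 * z i + fst p * y i)) \<in> polyfuns {fst, snd} UNIV"
      by (intro polyfuns.add polyfuns.mult polyfuns.const UNIV_I)
    then show "(\<lambda>p. lc (snd p) b 1 (l (fst p)) i) \<in> polyfuns {fst, snd} UNIV"
      unfolding l_def lc_def .
  qed
  from polyfuns_poly2[OF this] obtain Q where Q: "\<And>t x. poly2 Q t x = G (lc x b 1 (l t))" by auto
  have l0: "l 0 = z" by (simp add: l_def)
  have fin1: "finite {(t, x). poly2 P t x = 0 \<and> poly2 Q t x = 0}"
    by (rule bivariate_finite_zeros[OF lead b, of 0]) (use avoid in \<open>auto simp: P Q l0\<close>)
  define R where "R = [:F y, A y b, A b y, F b:]"
  have R: "poly R x = F (lc x b 1 y)" for x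
    by (simp add: R_def F_lc algebra_simps power2_eq_square power3_eq_cube)
  have fin2: "finite {x. poly R x = 0}" using b by (intro poly_roots_finite) (auto simp: R_def)
  define T where "T = (\<lambda>(t, x). (x, 1::'a, t)) ` {(t, x). poly2 P t x = 0 \<and> poly2 Q t x = 0} \<union>
      (\<lambda>x. (x, 0::'a, 1::'a)) ` {x. poly R x = 0}"
  show thesis
  proof (rule that[of T])
    show "finite T" unfolding T_def using fin1 fin2 by blast
    show "(0, 0, 0) \<notin> T" by (auto simp: T_def)
    fix p assume p: "p \<noteq> (0, 0, 0)" "F (plane_pt b z y p) = 0" "G (plane_pt b z y p) = 0"
    obtain \<alpha> \<beta> \<gamma> where abc: "p = (\<alpha>, \<beta>, \<gamma>)" by (cases p)
    have scale: "plane_pt b z y p = (\<lambda>i. \<kappa> * plane_pt b z y q i)" "F (plane_pt b z y q) = 0" "G (plane_pt b z y q) = 0"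
      if "\<kappa> \<noteq> 0" "\<alpha> = \<kappa> * a" "\<beta> = \<kappa> * b'" "\<gamma> = \<kappa> * c" "q = (a, b', c)" for \<kappa> a b' c q
    proof -
      show e: "plane_pt b z y p = (\<lambda>i. \<kappa> * plane_pt b z y q i)"
        by (auto simp: plane_pt_def that abc lc_def algebra_simps)
      have "\<kappa>^3 * F (plane_pt b z y q) = 0" using p(2) unfolding e F_scale .
      then show "F (plane_pt b z y q) = 0" using that(1) by simp
      have "\<kappa>^d * G (plane_pt b z y q) = 0" using p(3) unfolding e homog_scale[OF G] .
      then show "G (plane_pt b z y q) = 0" using that(1) by simp
    qed
    consider "\<beta> \<noteq> 0" | "\<beta> = 0" "\<gamma> \<noteq> 0" | "\<beta> = 0" "\<gamma> = 0" "\<alpha> \<noteq> 0" using p(1) abc by auto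
    then show "\<exists>\<kappa>. \<exists>q\<in>T. plane_pt b z y p = (\<lambda>i. \<kappa> * plane_pt b z y q i) \<and> \<kappa> \<noteq> 0"
    proof cases
      case 1
      define q where "q = (\<alpha> / \<beta>, 1::'a, \<gamma> / \<beta>)"
      have s: "plane_pt b z y p = (\<lambda>i. \<beta> * plane_pt b z y q i)" "F (plane_pt b z y q) = 0" "G (plane_pt b z y q) = 0"
        using scale[of \<beta> "\<alpha> / \<beta>" 1 "\<gamma> / \<beta>" q] 1 by (simp_all add: q_def)
      have "plane_pt b z y q = lc (\<alpha> / \<beta>) b 1 (l (\<gamma> / \<beta>))"
        by (auto simp: plane_pt_def q_def l_def lc_def algebra_simps)
      then have "(\<gamma> / \<beta>, \<alpha> / \<beta>) \<in> {(t, x). poly2 P t x = 0 \<and> poly2 Q t x = 0}" using s by (simp add: P Q)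
      then have "q \<in> T" unfolding T_def q_def by (intro UnI1 image_eqI[of _ _ "(\<gamma> / \<beta>, \<alpha> / \<beta>)"]) simp_all
      then show ?thesis using s(1) 1 by blast
    next
      case 2
      define q where "q = (\<alpha> / \<gamma>, 0::'a, 1::'a)"
      have s: "plane_pt b z y p = (\<lambda>i. \<gamma> * plane_pt b z y q i)" "F (plane_pt b z y q) = 0"
        using scale[of \<gamma> "\<alpha> / \<gamma>" 0 1 q] 2 by (simp_all add: q_def)
      have "plane_pt b z y q = lc (\<alpha> / \<gamma>) b 1 y"
        by (auto simp: plane_pt_def q_def lc_def)
      then have "poly R (\<alpha> / \<gamma>) = 0" using s by (simp add: R)
      then have "q \<in> T" unfolding T_def q_def by blast
      then show ?thesis using s(1) 2 by blast
    next
      case 3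
      then have "plane_pt b z y p = (\<lambda>i. \<alpha> * b i)" by (auto simp: plane_pt_def abc lc_def)
      then have "\<alpha>^3 * F b = 0" using p(2) by (simp add: F_scale)
      then show ?thesis using 3 b by simp
    qed
  qed
qed

text \<open>In the plane spanned by \<open>u\<close> and the pencil, dividing the parametrisation \<open>resid u\<close> by the
  greatest common divisor of its two coefficients leaves a residual curve that meets the line of the pencil.\<close>

lemma pencil_point:
  assumes G: "homog d G" and van: "\<And>v. A u v = 0 \<Longrightarrow> G (resid u v) = 0"
    and v: "A u v2 = 0" "A u v3 = 0" "A v2 u \<noteq> 0"
  shows "(F v2 = 0 \<and> G v2 = 0) \<or> (\<exists>t. F (lc 1 v3 t v2) = 0 \<and> G (lc 1 v3 t v2) = 0)"
proof (cases "F v2 = 0")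
  case True
  then have "G (lc 0 u (- A v2 u) v2) = 0" using van[OF v(1)] by (simp add: resid_def)
  then show ?thesis using True v(3) by (simp add: homog_lc_0[OF G])
next
  case False
  define l where "l t = lc 1 v3 t v2" for t
  have l: "(\<lambda>t. l t i) \<in> PU" for i unfolding l_def lc_def by (intro polyfuns_intros)
  define c where "c = [:F v3, A v3 v2, A v2 v3, F v2:]"
  define q where "q = [:A v3 u, B v3 v2 u, A v2 u:]"
  have c: "poly c t = F (l t)" and q: "poly q t = A (l t) u" for t
    by (simp_all add: c_def q_def l_def F_lc A_lc' algebra_simps power2_eq_square power3_eq_cube)
  have dc: "degree c = 3" and dq: "degree q = 2" using False v(3) by (simp_all add: c_def q_def)
  have "q \<noteq> 0" using dq by auto
  then obtain g q' c' where g: "q = g * q'" "c = g * c'" "g \<noteq> 0" "\<And>x. poly q' x = 0 \<Longrightarrow> poly c' x \<noteq> 0"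
    using gcd_cofactors[of q c] by metis
  have "q' \<noteq> 0" "c' \<noteq> 0" using g dc dq by auto
  then have "degree g + degree q' = 2" "degree g + degree c' = 3"
    using g dc dq by (metis degree_mult_eq)+
  then have "degree c' > 0" by simp
  \<comment> \<open>\<open>c'\<close> has positive degree because \<open>g\<close> divides a
    quadratic. At its root the divided parametrisation loses its component along \<open>u\<close>
    and gives a multiple of the point \<open>l t\<close> of the pencil, nonzero by
    coprimality.\<close>
  then obtain t where t: "poly c' t = 0" using alg_closed_imp_poly_has_root by blast
  have qt: "poly q' t \<noteq> 0" using g(4) t by blast
  have pu: "(\<lambda>s. G (lc (poly c' s) u (- poly q' s) (l s))) \<in> PU"
  proof (rule PV_subst[OF homog_PV[OF G]])
    fix i
    have p: "(\<lambda>s. poly c' s) \<in> PU" "(\<lambda>s. poly q' s) \<in> PU" using poly_in_PU[of c'] poly_in_PU[of q'] by simp_all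
    show "(\<lambda>s. lc (poly c' s) u (- poly q' s) (l s) i) \<in> PU"
      unfolding lc_def by (intro polyfuns.add polyfuns.mult polyfuns_uminus[OF _ UNIV_I] polyfuns.const UNIV_I p l)
  qed
  have "G (lc (poly c' s) u (- poly q' s) (l s)) = 0" for s
  proof (rule PU_eq_0[OF pu poly_roots_finite[OF g(3)]])
    fix s assume s: "s \<notin> {x. poly g x = 0}"
    have "A u (l s) = 0" using v by (simp add: l_def A_lc)
    then have "G (resid u (l s)) = 0" by (rule van)
    moreover have "resid u (l s) = (\<lambda>i. poly g s * lc (poly c' s) u (- poly q' s) (l s) i)"
      unfolding resid_def c[symmetric] q[symmetric] g(1,2) by (auto simp: lc_def algebra_simps)
    ultimately show "G (lc (poly c' s) u (- poly q' s) (l s)) = 0"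
      using s by (simp add: homog_scale[OF G])
  qed
  from this[of t] have "G (l t) = 0" using t qt by (simp add: homog_lc_0[OF G])
  moreover have "F (l t) = 0" using c[of t] t by (simp add: g(2))
  ultimately show ?thesis unfolding l_def by blast
qed

end

lemma det3_transpose: "det3 (\<lambda>l. l x) (\<lambda>l. l y) (\<lambda>l. l z) l1 l2 l3 = det3 l1 l2 l3 x y z"
  by (simp add: det3_def algebra_simps)

lemma det3_expand: "det3 l1 l2 l3 x y z = (l1 y * l2 z - l1 z * l2 y) * l3 x
    - (l1 x * l2 z - l1 z * l2 x) * l3 y + (l1 x * l2 y - l1 y * l2 x) * l3 z"
  by (simp add: det3_def algebra_simps)

lemma det3_rows: "det3 l1 l2 l3 x y z = (l2 x * l3 y - l2 y * l3 x) * l1 z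
    + (l3 x * l1 y - l3 y * l1 x) * l2 z + (l1 x * l2 y - l1 y * l2 x) * l3 z"
  by (simp add: det3_def algebra_simps)

context smooth_cubic
begin

text \<open>Inside a suitable plane the zeros of \<open>F\<close> and \<open>G\<close> are finite in number, and each tangent
  hyperplane at a point of \<open>Z\<close> passes through one of them. By irreducibility one point lies on all
  of these hyperplanes. As the plane can be moved, the hyperplanes vary in a pencil.\<close>

lemma gauss_image_pencil:
  assumes G: "homog d G" "nonvan G" and Z: "irred_set Z" "\<And>u. u \<in> Z \<Longrightarrow> F u = 0"
    and u0: "u0 \<in> Z" "noncone u0"
    and van: "\<And>u v. u \<in> Z \<Longrightarrow> noncone u \<Longrightarrow> A u v = 0 \<Longrightarrow> G (resid u v) = 0"
    and u: "u1 \<in> Z" "u2 \<in> Z" "u3 \<in> Z"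
  shows "det3 (A u1) (A u2) (A u3) w1 w2 w3 = 0"
proof (rule ccontr)
  assume det: "det3 (A u1) (A u2) (A u3) w1 w2 w3 \<noteq> 0"
  obtain v0 where v0: "A u0 v0 = 0" "A v0 u0 \<noteq> 0" using u0(2) unfolding noncone_def by blast
  obtain e0 where e0: "A u0 e0 \<noteq> 0" using smooth[OF Z(2)[OF u0(1)] noncone_nz[OF u0(2)]] by blast
  have "\<exists>e1 e2. A u1 e1 * A u2 e2 - A u1 e2 * A u2 e1 \<noteq> 0"
    using det unfolding det3_expand by (metis diff_0_right add_0 mult_zero_left)
  then obtain e1 e2 where e: "A u1 e1 * A u2 e2 - A u1 e2 * A u2 e1 \<noteq> 0" by blast
  obtain z b where zb: "F z = 0" "F b \<noteq> 0" "A u0 z \<noteq> 0" "A u1 z * A u2 b - A u2 z * A u1 b \<noteq> 0"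
    "\<And>x. F (lc x b 1 z) = 0 \<Longrightarrow> G (lc x b 1 z) \<noteq> 0"
    using line_avoiding_zeros[OF G e0 e] by blast
  have "\<exists>y. det3 (A u1) (A u2) (A u3) b z y \<noteq> 0"
  proof (rule ccontr)
    assume "\<not> ?thesis"
    then have 0: "det3 (A u1) (A u2) (A u3) b z y = 0" for y by blast
    define c1 c2 c3 where "c1 = A u2 b * A u3 z - A u2 z * A u3 b"
      and "c2 = A u3 b * A u1 z - A u3 z * A u1 b" and "c3 = A u1 b * A u2 z - A u1 z * A u2 b"
    have "c1 * A u1 y + c2 * A u2 y + c3 * A u3 y = 0" for y
      using 0[of y] unfolding det3_rows c1_def c2_def c3_def .
    then have "c3 = 0"
      using det3_kernel[of c1 "\<lambda>l. l w1" "A u1" c2 "A u2" c3 "A u3" "\<lambda>l. l w2" "\<lambda>l. l w3"] det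
      unfolding det3_transpose by blast
    then show False using zb(4) by (simp add: c3_def algebra_simps)
  qed
  then obtain y0 where y0: "det3 (A u1) (A u2) (A u3) b z y0 \<noteq> 0" by blast
  have PV1: "(\<lambda>y. det3 (A u1) (A u2) (A u3) b z y) \<in> PV"
    unfolding det3_rows by (intro cubic_intros)
  have PV2: "(\<lambda>y. A (lc (A u0 y) z (- A u0 z) y) u0) \<in> PV" by (intro cubic_intros)
  have "A (lc (A u0 v0) z (- A u0 z) v0) u0 \<noteq> 0" using v0 zb(3) by (simp add: A_lc')
  from PV_common_nonzero[OF PV1 PV2 y0 this]
  obtain y where y: "det3 (A u1) (A u2) (A u3) b z y \<noteq> 0" "A (lc (A u0 y) z (- A u0 z) y) u0 \<noteq> 0" by blast
  obtain T where T: "finite T" "(0, 0, 0) \<notin> T"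
    "\<And>p. p \<noteq> (0, 0, 0) \<Longrightarrow> F (plane_pt b z y p) = 0 \<Longrightarrow> G (plane_pt b z y p) = 0 \<Longrightarrow>
      \<exists>\<kappa>. \<exists>q\<in>T. plane_pt b z y p = (\<lambda>i. \<kappa> * plane_pt b z y q i) \<and> \<kappa> \<noteq> 0"
    using plane_finite_zeros[OF G(1) zb(2,5)] by blast
  \<comment> \<open>The tangent hyperplane at \<open>u\<close> cuts the plane in the span of
    \<open>v2\<close> and \<open>v3\<close>: the first is on the line through \<open>z\<close> and
    \<open>y\<close>, the second has a nonzero \<open>b\<close>-coordinate.\<close>
  have meet: "\<exists>q\<in>T. A u (plane_pt b z y q) = 0" if uZ: "u \<in> Z" and nz: "A (lc (A u y) z (- A u z) y) u \<noteq> 0" for u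
  proof -
    define v2 where "v2 = lc (A u y) z (- A u z) y"
    have v2: "A u v2 = 0" "A v2 u \<noteq> 0" using nz by (simp_all add: v2_def A_lc)
    have nc: "noncone u" using v2 unfolding noncone_def by blast
    have v2p: "v2 = plane_pt b z y (0, A u y, - A u z)" by (auto simp: v2_def plane_pt_def lc_def)
    have "A u y \<noteq> 0 \<or> A u z \<noteq> 0"
    proof (rule ccontr)
      assume "\<not> ?thesis"
      then have "v2 = (\<lambda>i. 0 * v2 i)" by (auto simp: v2_def lc_def)
      then have "A v2 u = 0" using A_scale[of 0 v2 u] by simp
      then show False using v2(2) by simp
    qed
    then obtain \<alpha> \<beta> \<gamma> where abc: "\<alpha> \<noteq> 0" "\<alpha> * A u b + \<beta> * A u z + \<gamma> * A u y = 0"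
    proof (elim disjE)
      assume "A u y \<noteq> 0"
      then show thesis using that[of "A u y" 0 "- A u b"] by simp
    next
      assume "A u z \<noteq> 0"
      then show thesis using that[of "A u z" "- A u b" 0] by simp
    qed
    define v3 where "v3 = plane_pt b z y (\<alpha>, \<beta>, \<gamma>)"
    have v3: "A u v3 = 0" using abc(2) by (simp add: v3_def A_plane_pt)
    have comb: "lc 1 v3 t v2 = plane_pt b z y (\<alpha>, \<beta> + t * A u y, \<gamma> - t * A u z)" for t
      by (auto simp: v3_def v2p plane_pt_def lc_def algebra_simps)
    have pp: "(F v2 = 0 \<and> G v2 = 0) \<or> (\<exists>t. F (lc 1 v3 t v2) = 0 \<and> G (lc 1 v3 t v2) = 0)"
      by (rule pencil_point[OF G(1) _ v2(1) v3 v2(2)]) (rule van[OF uZ nc])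
    have "\<exists>p. p \<noteq> (0, 0, 0) \<and> F (plane_pt b z y p) = 0 \<and> G (plane_pt b z y p) = 0 \<and> A u (plane_pt b z y p) = 0"
      using pp
    proof (elim disjE exE conjE)
      assume "F v2 = 0" "G v2 = 0"
      then show ?thesis using \<open>A u y \<noteq> 0 \<or> A u z \<noteq> 0\<close> v2(1) unfolding v2p
        by (intro exI[of _ "(0, A u y, - A u z)"]) auto
    next
      fix t assume t: "F (lc 1 v3 t v2) = 0" "G (lc 1 v3 t v2) = 0"
      moreover have "A u (lc 1 v3 t v2) = 0" using v2 v3 by (simp add: A_lc)
      ultimately show ?thesis unfolding comb using abc(1) by blast
    qed
    then obtain p where p: "p \<noteq> (0, 0, 0)" "F (plane_pt b z y p) = 0" "G (plane_pt b z y p) = 0" "A u (plane_pt b z y p) = 0"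
      by blast
    then obtain \<kappa> q where q: "q \<in> T" "plane_pt b z y p = (\<lambda>i. \<kappa> * plane_pt b z y q i)" "\<kappa> \<noteq> 0"
      using T(3) by blast
    then have "A u (plane_pt b z y q) = 0" using p(4) by (simp add: A_scale')
    with q(1) show ?thesis by blast
  qed
  \<comment> \<open>The condition of \<open>meet\<close> is open and holds at \<open>u0\<close>. If
    each point of \<open>T\<close> were missed by some hyperplane, irreducibility of
    \<open>Z\<close> would give one \<open>u\<close> satisfying that condition and missing all of
    \<open>T\<close>.\<close>
  have "\<exists>q\<in>T. \<forall>u\<in>Z. A u (plane_pt b z y q) = 0"
  proof (rule ccontr)
    assume "\<not> ?thesis"
    then have nz: "\<And>q. q \<in> T \<Longrightarrow> \<exists>u\<in>Z. A u (plane_pt b z y q) \<noteq> 0" by blast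
    have pv: "(\<lambda>u. A u v) \<in> PV" for v by (intro cubic_intros)
    obtain x where x: "x \<in> Z" "\<And>q. q \<in> T \<Longrightarrow> A x (plane_pt b z y q) \<noteq> 0"
      using irred_set_prod[OF Z(1) T(1), of "\<lambda>q u. A u (plane_pt b z y q)"] pv nz by blast
    have prod: "(\<lambda>u. \<Prod>q\<in>T. A u (plane_pt b z y q)) \<in> PV" by (intro polyfuns_prod pv) auto
    have "(\<lambda>u. A (lc (A u y) z (- A u z) y) u) \<in> PV" by (intro cubic_intros)
    from irred_setD[OF Z(1) this prod u0(1) y(2) x(1)] x(2) T(1)
    obtain u where "u \<in> Z" "A (lc (A u y) z (- A u z) y) u \<noteq> 0" "(\<Prod>q\<in>T. A u (plane_pt b z y q)) \<noteq> 0"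
      by auto
    then show False using meet[of u] T(1) by auto
  qed
  then obtain q where q: "q \<in> T" "\<And>u. u \<in> Z \<Longrightarrow> A u (plane_pt b z y q) = 0" by blast
  obtain \<alpha> \<beta> \<gamma> where abc: "q = (\<alpha>, \<beta>, \<gamma>)" by (cases q)
  have "\<alpha> = 0 \<and> \<beta> = 0 \<and> \<gamma> = 0"
    by (rule det3_kernel[OF _ _ _ y(1)]) (use q(2) u in \<open>simp_all add: abc A_plane_pt\<close>)
  then show False using q(1) T(2) abc by simp
qed

text \<open>Two independent tangent hyperplanes give the dual basis by Cramer's rule. If all are
  proportional, a second form is added arbitrarily, so that the axis still has codimension
  two.\<close>

lemma dual_pair:
  assumes Z: "irred_set Z" "\<And>u. u \<in> Z \<Longrightarrow> F u = 0" "u0 \<in> Z" "nz u0"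
    and det: "\<And>u1 u2 u3 w1 w2 w3. u1 \<in> Z \<Longrightarrow> u2 \<in> Z \<Longrightarrow> u3 \<in> Z \<Longrightarrow> det3 (A u1) (A u2) (A u3) w1 w2 w3 = 0"
  obtains l1 l2 e1 e2 where "lin l1" "lin l2" "l1 e1 = 1" "l1 e2 = 0" "l2 e1 = 0" "l2 e2 = 1"
    "\<forall>u\<in>Z. \<forall>v. A u v = A u e1 * l1 v + A u e2 * l2 v"
proof (cases "\<exists>u1\<in>Z. \<exists>u2\<in>Z. \<exists>w1 w2. A u1 w1 * A u2 w2 - A u1 w2 * A u2 w1 \<noteq> 0")
  case True
  then obtain u1 u2 w1 w2 where u: "u1 \<in> Z" "u2 \<in> Z" and "A u1 w1 * A u2 w2 - A u1 w2 * A u2 w1 \<noteq> 0" by blast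
  define D where "D = A u1 w1 * A u2 w2 - A u1 w2 * A u2 w1"
  have D: "D \<noteq> 0" unfolding D_def by fact
  define l1 where "l1 v = (A u2 w2 / D) * A u1 v + (- A u1 w2 / D) * A u2 v" for v
  define l2 where "l2 v = (- A u2 w1 / D) * A u1 v + (A u1 w1 / D) * A u2 v" for v
  have "lin l1" "lin l2" unfolding l1_def l2_def by (intro lin_comb lin_A)+
  moreover have "l1 w1 = 1" "l1 w2 = 0" "l2 w1 = 0" "l2 w2 = 1"
    using D by (simp_all add: l1_def l2_def field_simps) (simp_all add: D_def algebra_simps)
  moreover have "A x v = A x w1 * l1 v + A x w2 * l2 v" if "x \<in> Z" for x v
  proof -
    have "D * A x v = A x w1 * (A u2 w2 * A u1 v - A u1 w2 * A u2 v) + A x w2 * (A u1 w1 * A u2 v - A u2 w1 * A u1 v)"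
      using det[OF u that, of w1 w2 v] by (simp add: det3_def D_def algebra_simps)
    moreover have "D * l1 v = A u2 w2 * A u1 v - A u1 w2 * A u2 v" "D * l2 v = A u1 w1 * A u2 v - A u2 w1 * A u1 v"
      using D by (simp_all add: l1_def l2_def field_simps)
    ultimately have "D * A x v = D * (A x w1 * l1 v + A x w2 * l2 v)"
      by (simp only: distrib_left mult.left_commute[of D])
    then show ?thesis using D by simp
  qed
  ultimately show thesis using that by blast
next
  case False
  then have prop2: "A u1 w1 * A u2 w2 = A u1 w2 * A u2 w1" if "u1 \<in> Z" "u2 \<in> Z" for u1 u2 w1 w2
    using that by auto
  obtain e where e: "A u0 e \<noteq> 0" using smooth Z by blast
  define l1 where "l1 v = (1 / A u0 e) * A u0 v + 0 * A u0 v" for v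
  have l1: "lin l1" unfolding l1_def by (intro lin_comb lin_A)
  obtain x where x: "nz x" "l1 x = 0" using kernel3[OF l1 l1 l1] by blast
  then obtain i where i: "i \<le> N" "x i \<noteq> 0" by (auto simp: nz_def)
  define l2 where "l2 v = (1 / x i) * v i + (- e i / x i) * l1 v" for v
  define e2 where "e2 = x"
  have l2: "lin l2" unfolding l2_def by (intro lin_comb lin_coord l1)
  have 1: "l1 e = 1" using e by (simp add: l1_def)
  have "A u v = A u e * l1 v + A u e2 * l2 v" if "u \<in> Z" for u v
  proof -
    have "A u v * A u0 e = A u e * A u0 v" using prop2[OF that Z(3), of v e] .
    then have v: "A u v = A u e * l1 v" for v
      using e prop2[OF that Z(3), of v e] by (simp add: l1_def field_simps)
    have "A u e2 = 0" using v[of e2] x by (simp add: e2_def)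
    then show ?thesis using v[of v] by simp
  qed
  moreover have "l1 e2 = 0" "l2 e = 0" "l2 e2 = 1" using x i 1 by (simp_all add: e2_def l2_def)
  ultimately show thesis using that[OF l1 l2 1] by blast
qed

text \<open>Otherwise \<open>gauss_image_pencil\<close> for the whole cubic puts all tangent
  hyperplanes into one pencil. Its axis meets the cubic, and such an intersection point contradicts
  \<open>not_strange\<close>.\<close>

theorem resid_dense:
  assumes G: "homog d G" and van: "\<And>u v. F u = 0 \<Longrightarrow> noncone u \<Longrightarrow> A u v = 0 \<Longrightarrow> G (resid u v) = 0"
    and nc: "F u0 = 0" "noncone u0" and x: "F x = 0"
  shows "G x = 0"
proof (rule ccontr)
  assume "G x \<noteq> 0"
  then have nv: "nonvan G" using x G by (auto simp: nonvan_def homog_PV)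
  let ?Z = "{x. F x = 0}"
  have det: "det3 (A u1) (A u2) (A u3) w1 w2 w3 = 0" if "u1 \<in> ?Z" "u2 \<in> ?Z" "u3 \<in> ?Z" for u1 u2 u3 w1 w2 w3
    by (rule gauss_image_pencil[OF G nv irreducible_X _ _ nc(2) _ that]) (use nc van in auto)
  have ZF: "\<And>u. u \<in> ?Z \<Longrightarrow> F u = 0" and u0: "u0 \<in> ?Z" using nc by auto
  obtain l1 l2 e1 e2 where l: "lin l1" "lin l2" and "l1 e1 = 1" "l1 e2 = 0" "l2 e1 = 0" "l2 e2 = 1"
    and l': "\<forall>u\<in>?Z. \<forall>v. A u v = A u e1 * l1 v + A u e2 * l2 v"
    by (rule dual_pair[OF irreducible_X ZF u0 noncone_nz[OF nc(2)] det])
  obtain w where w: "nz w" "F w = 0" "l1 w = 0" "l2 w = 0" using X_point_in_kernel[OF l(1,2)] by blast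
  then obtain u where u: "u \<in> ?Z" "A u w \<noteq> 0" using not_strange by blast
  have "A u w = A u e1 * l1 w + A u e2 * l2 w" using l' u(1) by blast
  then show False using u(2) w(3,4) by simp
qed

end

lemma dual_pair_span:
  assumes l: "lin l1" "lin l2" "l1 e1 = 1" "l1 e2 = 0" "l2 e1 = 0" "l2 e2 = (1::'a::comm_ring_1)"
    and f: "lin f" "\<And>w. l1 w = 0 \<Longrightarrow> l2 w = 0 \<Longrightarrow> f w = 0"
  shows "f v = f e1 * l1 v + f e2 * l2 v"
proof -
  define w where "w = lc 1 (lc 1 v (- l1 v) e1) (- l2 v) e2"
  have "l1 w = 0" "l2 w = 0"
    using l(3-6) by (simp_all add: w_def lin_lc[OF l(1)] lin_lc[OF l(2)])
  then have "f w = 0" by (rule f(2))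
  then show ?thesis by (simp add: w_def lin_lc[OF f(1)] algebra_simps)
qed

section \<open>Axes of pencils of tangent hyperplanes\<close>

context smooth_cubic
begin

text \<open>If the tangent hyperplanes along the residual of the tangent section at \<open>u\<close> all contain a
  subspace \<open>S\<close> of codimension two, then \<open>S\<close> does not stick out of the tangent hyperplane at \<open>u\<close>:
  otherwise the cubic \<open>F\<close> is divisible by the quadric \<open>v \<mapsto> A v u\<close> on that hyperplane, the residual is linear,
  and it is contained in \<open>S\<close>.\<close>

lemma axis_in_tangent:
  assumes u: "F u = 0" "noncone u" and l: "lin l1" "lin l2" "l1 e1 = 1" "l1 e2 = 0" "l2 e1 = 0" "l2 e2 = 1"
    and span: "\<And>v w. A u v = 0 \<Longrightarrow> l1 w = 0 \<Longrightarrow> l2 w = 0 \<Longrightarrow> A (resid u v) w = 0"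
    and s: "l1 s = 0" "l2 s = 0"
  shows "A u s = 0"
proof (rule ccontr)
  assume As: "A u s \<noteq> 0"
  define lam where "lam v = F v / A v u" for v
  define pt where "pt v = lc (lam v) u (- 1) v" for v
  have resid_pt: "resid u v = (\<lambda>i. A v u * pt v i)" if "A v u \<noteq> 0" for v
    using that by (auto simp: resid_def pt_def lam_def lc_def algebra_simps)
  have pt_span: "A (pt v) w = 0" if "A u v = 0" "A v u \<noteq> 0" "l1 w = 0" "l2 w = 0" for v w
    using span[OF that(1,3,4)] that(2) by (simp add: resid_pt A_scale)
  have Auu: "A u u = 0" using u by (simp add: A_self)
  have q_pencil: "finite {t. A (lc 1 v1 t v2) u = 0}" if "A v2 u \<noteq> 0" for v1 v2
  proof -
    have "poly [:A v1 u, B v1 v2 u, A v2 u:] t = A (lc 1 v1 t v2) u" for t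
      by (simp add: A_lc' algebra_simps power2_eq_square)
    then show ?thesis using poly_roots_finite[of "[:A v1 u, B v1 v2 u, A v2 u:]"] that by simp
  qed
  have pencil: "pt (lc 1 v1 t v2) = lc 1 (pt v1) t (pt v2)"
    if v: "A u v1 = 0" "A u v2 = 0" "A v1 u \<noteq> 0" "A v2 u \<noteq> 0" and t: "A (lc 1 v1 t v2) u \<noteq> 0" for v1 v2 t
  proof -
    define l where "l t = lc 1 v1 t v2" for t
    define c where "c = [:F v1, A v1 v2, A v2 v1, F v2:]"
    define q where "q = [:A v1 u, B v1 v2 u, A v2 u:]"
    have c: "poly c t = F (l t)" and q: "poly q t = A (l t) u" for t
      by (simp_all add: c_def q_def l_def F_lc A_lc' algebra_simps power2_eq_square power3_eq_cube)
    have dq: "degree q = 2" using v(4) by (simp add: q_def)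
    then have "q \<noteq> 0" by auto
    then obtain g q' c' where g: "q = g * q'" "c = g * c'" "g \<noteq> 0" "\<And>x. poly q' x = 0 \<Longrightarrow> poly c' x \<noteq> 0"
      using gcd_cofactors[of q c] by metis
    \<comment> \<open>This is the hypothesis \<open>span\<close> in the direction
      \<open>l x\<close>. The coefficients of \<open>resid\<close> are both divisible by
      \<open>g\<close>, and the square of \<open>g\<close> cancels.\<close>
    have star: "(poly c' x)^2 * A u s = poly q' x * (poly c' x * B u (l x) s - poly q' x * A (l x) s)" for x
    proof -
      have lPU: "(\<lambda>t. l t i) \<in> PU" for i unfolding l_def lc_def by (intro polyfuns_intros)
      have p: "(\<lambda>s. poly c' s) \<in> PU" "(\<lambda>s. poly q' s) \<in> PU" using poly_in_PU[of c'] poly_in_PU[of q'] by simp_all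
      have "(\<lambda>x. (poly c' x)^2 * A u s - poly q' x * (poly c' x * B u (l x) s - poly q' x * A (l x) s)) \<in> PU"
        by (intro cubic_intros p lPU)
      moreover have "(poly c' x)^2 * A u s - poly q' x * (poly c' x * B u (l x) s - poly q' x * A (l x) s) = 0"
        if "x \<notin> {x. poly g x = 0}" for x
      proof -
        have "A u (l x) = 0" using v by (simp add: l_def A_lc)
        from span[OF this s] have "(F (l x))^2 * A u s - F (l x) * A (l x) u * B u (l x) s + (A (l x) u)^2 * A (l x) s = 0"
          by (simp add: resid_def A_lc')
        then have "(poly g x)^2 * ((poly c' x)^2 * A u s - poly q' x * (poly c' x * B u (l x) s - poly q' x * A (l x) s)) = 0"
          unfolding c[symmetric] q[symmetric] g(1,2) by (simp add: algebra_simps power2_eq_square)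
        then show ?thesis using that by simp
      qed
      ultimately have "(poly c' x)^2 * A u s - poly q' x * (poly c' x * B u (l x) s - poly q' x * A (l x) s) = 0"
        using PU_eq_0[OF _ poly_roots_finite[OF g(3)]] by blast
      then show ?thesis by simp
    qed
    \<comment> \<open>A root of \<open>q'\<close> would also be a root of \<open>c'\<close> by
      \<open>star\<close>, as \<open>A u s\<close> is nonzero. So the quadric divides the cubic
      along the pencil, and \<open>lam\<close> is affine linear there.\<close>
    have "degree q' = 0"
    proof (rule ccontr)
      assume "degree q' \<noteq> 0"
      then obtain x where x: "poly q' x = 0" using alg_closed_imp_poly_has_root[of q'] by auto
      then have "(poly c' x)^2 * A u s = 0" using star[of x] by simp
      then show False using g(4)[OF x] As by simp
    qed
    then obtain k where k: "q' = [:k:]" using degree_eq_zeroE by blast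
    have k0: "k \<noteq> 0" using \<open>q \<noteq> 0\<close> g(1) k by auto
    have dg: "degree g = 2" using dq g(1) k k0 by (simp add: mult.commute)
    have "degree c' \<le> 1"
    proof (cases "c' = 0")
      case False
      have "degree c \<le> 3" unfolding c_def by simp
      moreover have "degree c = degree g + degree c'" using g(2,3) False by (simp add: degree_mult_eq)
      ultimately show ?thesis using dg by simp
    qed simp
    then have "c' = [:coeff c' 0, coeff c' 1:]"
      by (intro poly_eqI) (auto simp: coeff_pCons coeff_eq_0 split: nat.split)
    then obtain a0 a1 where a: "c' = [:k * a0, k * a1:]" using k0
      by (metis mult.left_commute mult.right_neutral nonzero_mult_div_cancel_left times_divide_eq_right)
    have "c = q * [:a0, a1:]" unfolding g(1,2) k a by (simp add: mult.commute)
    then have Fl: "F (l t) = A (l t) u * (a0 + t * a1)" for t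
      unfolding c[symmetric] q[symmetric] by (simp add: algebra_simps)
    have F2: "F v2 = A v2 u * a1"
    proof -
      have "coeff c 3 = coeff (q * [:a0, a1:]) 3" using \<open>c = q * [:a0, a1:]\<close> by simp
      then show ?thesis by (simp add: c_def q_def numeral_3_eq_3)
    qed
    have F1: "F v1 = A v1 u * a0" using Fl[of 0] by (simp add: l_def)
    have "A (l t) u \<noteq> 0" using t by (simp add: l_def)
    then have "lam (l t) = a0 + t * a1" "lam v1 = a0" "lam v2 = a1"
      using v(3,4) unfolding lam_def Fl F1 F2 by simp_all
    then show ?thesis
      by (auto simp: pt_def l_def[symmetric]) (auto simp: lc_def l_def algebra_simps)
  qed
  have pt_X: "F (pt v) = 0" if "A u v = 0" "A v u \<noteq> 0" for v
    using that u by (simp add: pt_def F_lc lam_def power2_eq_square power3_eq_cube)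
  have pt_line: "F (lc 1 (pt v1) t (pt v2)) = 0"
    if v: "A u v1 = 0" "A u v2 = 0" "A v1 u \<noteq> 0" "A v2 u \<noteq> 0" and t: "A (lc 1 v1 t v2) u \<noteq> 0" for v1 v2 t
    unfolding pencil[OF that, symmetric] by (rule pt_X) (use v t in \<open>simp_all add: A_lc\<close>)
  have pt_tangent: "F (pt v1) = 0 \<and> A (pt v1) (pt v2) = 0 \<and> A (pt v2) (pt v1) = 0 \<and> F (pt v2) = 0"
    if v: "A u v1 = 0" "A u v2 = 0" "A v1 u \<noteq> 0" "A v2 u \<noteq> 0" for v1 v2
    by (rule line_tangent[OF q_pencil[OF v(4), of v1]]) (use pt_line[OF v] in auto)
  obtain v1 where v1: "A u v1 = 0" "A v1 u \<noteq> 0" using u(2) unfolding noncone_def by blast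
  obtain i where i: "i \<le> N" "u i \<noteq> 0" using noncone_nz[OF u(2)] by (auto simp: nz_def)
  have "\<exists>j\<le>N. u i * v1 j - u j * v1 i \<noteq> 0"
  proof (rule ccontr)
    assume "\<not> ?thesis"
    then have "\<not> nz (lc 1 v1 (- (v1 i / u i)) u)" using i(2) by (auto simp: nz_def lc_def field_simps)
    then have "A (lc 1 v1 (- (v1 i / u i)) u) u = 0" by (rule not_nz)
    then show False using v1 by (simp add: A_lc' B_diag Auu)
  qed
  then obtain j where j: "j \<le> N" "u i * v1 j - u j * v1 i \<noteq> 0" by blast
  \<comment> \<open>A form separating \<open>v1\<close> from \<open>u\<close>. With the coordinate
    \<open>i\<close> it shows that the residual points in the directions \<open>v1\<close> and
    \<open>v2\<close> are independent.\<close>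
  define \<psi> where "\<psi> x = u i * x j + (- u j) * x i" for x
  have "lin \<psi>" unfolding \<psi>_def by (intro lin_comb lin_coord)
  moreover have "\<psi> u = 0" "\<psi> v1 \<noteq> 0" using j by (simp_all add: \<psi>_def)
  ultimately have \<psi>: "lin \<psi>" "\<psi> u = 0" "\<psi> v1 \<noteq> 0" by blast+
  obtain y where y: "nz y" "A u y = 0" "\<psi> y = 0" "y i = 0" using kernel3[OF lin_A \<psi>(1) lin_coord[of i]] by blast
  obtain \<epsilon> where \<epsilon>: "A (lc 1 y \<epsilon> v1) u \<noteq> 0"
    using q_pencil[OF v1(2), of y] infinite_alg_closed ex_new_if_finite by blast
  define v2 where "v2 = lc 1 y \<epsilon> v1"
  have v2: "A u v2 = 0" "A v2 u \<noteq> 0" using y v1 \<epsilon> by (simp_all add: v2_def A_lc)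
  have indep: "nz (lc a (pt v1) b (pt v2))" if ab: "a \<noteq> 0 \<or> b \<noteq> 0" for a b
  proof (rule ccontr)
    assume "\<not> nz (lc a (pt v1) b (pt v2))"
    moreover have eq: "lc a (pt v1) b (pt v2) = lc 1 (lc (a * lam v1 + b * lam v2) u (- (a + b * \<epsilon>)) v1) (- b) y"
      by (auto simp: pt_def v2_def lc_def algebra_simps)
    ultimately have z: "lc 1 (lc (a * lam v1 + b * lam v2) u (- (a + b * \<epsilon>)) v1) (- b) y k = 0" if "k \<le> N" for k
      using that by (auto simp: nz_def)
    have "\<psi> (lc 1 (lc (a * lam v1 + b * lam v2) u (- (a + b * \<epsilon>)) v1) (- b) y) = 0"
      unfolding \<psi>_def using z[OF i(1)] z[OF j(1)] by simp
    then have "- ((a + b * \<epsilon>) * \<psi> v1) = 0" unfolding lin_lc[OF \<psi>(1)] using \<psi>(2) y(3)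
      by (simp del: minus_add_distrib neg_equal_0_iff_equal)
    then have ab0: "a + b * \<epsilon> = 0" using \<psi>(3) unfolding neg_equal_0_iff_equal mult_eq_0_iff by blast
    have "a * lam v1 + b * lam v2 = 0" using z[OF i(1)] y(4) i(2) ab0 by (simp add: lc_def)
    then have "b * y k = 0" if "k \<le> N" for k using z[OF that] ab0 by (simp add: lc_def)
    then have "b = 0" using y(1) by (auto simp: nz_def)
    then show False using ab ab0 by simp
  qed
  have "\<exists>t. A (lc 1 v1 t v2) u \<noteq> 0 \<and> \<not> (\<exists>\<kappa>. \<forall>w. A (lc 1 (pt v1) t (pt v2)) w = \<kappa> * A (pt v1) w)"
    using line_gauss_varies[of "pt v1" "pt v2" "{t. A (lc 1 v1 t v2) u = 0}" "A (pt v1)"]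
      pt_tangent[OF v1(1) v2(1) v1(2) v2(2)] indep q_pencil[OF v2(2)] by blast
  then obtain t where t: "A (lc 1 v1 t v2) u \<noteq> 0" "\<not> (\<exists>\<kappa>. \<forall>w. A (lc 1 (pt v1) t (pt v2)) w = \<kappa> * A (pt v1) w)"
    by blast
  define v3 where "v3 = lc 1 v1 t v2"
  have v3: "A u v3 = 0" "A v3 u \<noteq> 0" using v1 v2 t by (simp_all add: v3_def A_lc)
  have pt3: "pt v3 = lc 1 (pt v1) t (pt v2)" unfolding v3_def by (rule pencil[OF v1(1) v2(1) v1(2) v2(2) t(1)])
  define a1 b1 a3 b3 where "a1 = A (pt v1) e1" and "b1 = A (pt v1) e2" and "a3 = A (pt v3) e1" and "b3 = A (pt v3) e2"
  have s1: "A (pt v1) w = a1 * l1 w + b1 * l2 w" for w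
    unfolding a1_def b1_def by (rule dual_pair_span[OF l lin_A]) (rule pt_span[OF v1])
  have s3: "A (pt v3) w = a3 * l1 w + b3 * l2 w" for w
    unfolding a3_def b3_def by (rule dual_pair_span[OF l lin_A]) (rule pt_span[OF v3])
  have D: "a1 * b3 - a3 * b1 \<noteq> 0"
  proof
    assume D0: "a1 * b3 - a3 * b1 = 0"
    obtain w where "A (pt v1) w \<noteq> 0" using smooth[OF pt_X[OF v1]] indep[of 1 0] by auto
    then have "a1 \<noteq> 0 \<or> b1 \<noteq> 0" using s1 by auto
    then have "\<exists>\<kappa>. \<forall>w. A (pt v3) w = \<kappa> * A (pt v1) w"
    proof
      assume "a1 \<noteq> 0"
      then have "b3 = (a3 / a1) * b1" using D0 by (simp add: field_simps)
      then show ?thesis using \<open>a1 \<noteq> 0\<close> unfolding s1 s3 by (intro exI[of _ "a3 / a1"]) (simp add: algebra_simps)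
    next
      assume "b1 \<noteq> 0"
      then have "a3 = (b3 / b1) * a1" using D0 by (simp add: field_simps)
      then show ?thesis using \<open>b1 \<noteq> 0\<close> unfolding s1 s3 by (intro exI[of _ "b3 / b1"]) (simp add: algebra_simps)
    qed
    then show False using t(2) unfolding pt3 by blast
  qed
  \<comment> \<open>Lines joining residual points lie in the cubic, so each residual point is on the
    tangent hyperplanes at the others. Those at \<open>pt v1\<close> and \<open>pt v3\<close> are
    distinct members of the pencil and intersect in its axis.\<close>
  have in_S: "l1 (pt v) = 0 \<and> l2 (pt v) = 0" if v: "A u v = 0" "A v u \<noteq> 0" for v
  proof -
    have e1: "a1 * l1 (pt v) + b1 * l2 (pt v) = 0" using pt_tangent[OF v1(1) v(1) v1(2) v(2)] s1 by simp
    have e3: "a3 * l1 (pt v) + b3 * l2 (pt v) = 0" using pt_tangent[OF v3(1) v(1) v3(2) v(2)] s3 by simp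
    have "(a1 * b3 - a3 * b1) * l1 (pt v) = b3 * (a1 * l1 (pt v) + b1 * l2 (pt v)) - b1 * (a3 * l1 (pt v) + b3 * l2 (pt v))"
      "(a1 * b3 - a3 * b1) * l2 (pt v) = a1 * (a3 * l1 (pt v) + b3 * l2 (pt v)) - a3 * (a1 * l1 (pt v) + b1 * l2 (pt v))"
      by (simp_all add: algebra_simps)
    then show ?thesis using D unfolding e1 e3 by simp
  qed
  \<comment> \<open>The member of the pencil through \<open>u\<close>, if \<open>u\<close> is off
    the axis. It vanishes on the tangent hyperplane at \<open>u\<close> and at \<open>s\<close>,
    hence identically. So \<open>u\<close> is on the axis, against
    \<open>resid_X(3)\<close>.\<close>
  define \<eta> where "\<eta> w = l1 u * l2 w + (- l2 u) * l1 w" for w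
  have "lin \<eta>" unfolding \<eta>_def by (intro lin_comb l)
  moreover have "\<eta> u = 0" by (simp add: \<eta>_def)
  ultimately have \<eta>: "lin \<eta>" "\<eta> u = 0" by blast+
  have \<eta>q: "\<eta> v = 0" if "A u v = 0" "A v u \<noteq> 0" for v
  proof -
    have "\<eta> (pt v) = 0" using in_S[OF that] by (simp add: \<eta>_def)
    then show ?thesis using \<eta>(2) by (simp add: pt_def lin_lc[OF \<eta>(1)])
  qed
  have \<eta>T: "\<eta> v = 0" if v: "A u v = 0" for v
  proof -
    obtain r where "A (lc 1 v r v1) u \<noteq> 0"
      using q_pencil[OF v1(2), of v] infinite_alg_closed ex_new_if_finite by blast
    then have "\<eta> (lc 1 v r v1) = 0" using v v1 by (intro \<eta>q) (simp_all add: A_lc)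
    then show ?thesis using \<eta>q[OF v1] by (simp add: lin_lc[OF \<eta>(1)])
  qed
  have "\<eta> w = 0" for w
  proof -
    have "\<eta> (lc 1 w (- (A u w / A u s)) s) = 0" by (rule \<eta>T) (use As in \<open>simp add: A_lc\<close>)
    moreover have "\<eta> s = 0" using s by (simp add: \<eta>_def)
    ultimately show ?thesis by (simp add: lin_lc[OF \<eta>(1)])
  qed
  from this[of e1] this[of e2] have "l1 u = 0" "l2 u = 0" using l by (simp_all add: \<eta>_def)
  then have "A (resid u v1) u = 0" by (rule span[OF v1(1)])
  then show False using resid_X(3)[OF u(1) v1(1)] v1(2) by simp
qed

text \<open>The axis misses \<open>u\<close>, since the tangent hyperplane at a residual point
  contains the axis but not \<open>u\<close>, by \<open>resid_X(3)\<close>. So the tangent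
  hyperplane at \<open>u\<close> is spanned by \<open>u\<close> and the axis, and a direction with
  \<open>A v u\<close> nonzero can be moved into the axis. There \<open>resid_X(4)\<close> gives
  \<open>F w = 0\<close> on a dense subset.\<close>

lemma axis_linear:
  assumes u: "F u = 0" "noncone u" and l: "lin l1" "lin l2" "l1 e1 = 1" "l1 e2 = 0" "l2 e1 = 0" "l2 e2 = 1"
    and span: "\<And>v w. A u v = 0 \<Longrightarrow> l1 w = 0 \<Longrightarrow> l2 w = 0 \<Longrightarrow> A (resid u v) w = 0"
  shows "\<not> (l1 u = 0 \<and> l2 u = 0)" "\<exists>w. l1 w = 0 \<and> l2 w = 0 \<and> A w u \<noteq> 0"
    "\<And>w. l1 w = 0 \<Longrightarrow> l2 w = 0 \<Longrightarrow> F w = 0"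
proof -
  have tangent: "A u w = 0" if "l1 w = 0" "l2 w = 0" for w
    by (rule axis_in_tangent[OF u l span that])
  obtain v where v: "A u v = 0" "A v u \<noteq> 0" using u(2) unfolding noncone_def by blast
  show nS: "\<not> (l1 u = 0 \<and> l2 u = 0)"
    using span[OF v(1), of u] resid_X(3)[OF u(1) v(1)] v(2) by auto
  have Auu: "A u u = 0" using u by (simp add: A_self)
  have Au: "A u w = A u e1 * l1 w + A u e2 * l2 w" for w
    by (rule dual_pair_span[OF l lin_A tangent])
  obtain w where "A u w \<noteq> 0" using smooth[OF u(1) noncone_nz[OF u(2)]] by blast
  then have nz: "A u e1 \<noteq> 0 \<or> A u e2 \<noteq> 0" using Au[of w] by auto
  have z: "A u e1 * l1 v + A u e2 * l2 v = 0" "A u e1 * l1 u + A u e2 * l2 u = 0"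
    by (simp_all only: Au[symmetric] v(1) Auu)
  have "A u e1 * (l1 v * l2 u - l2 v * l1 u)
      = (A u e1 * l1 v + A u e2 * l2 v) * l2 u - (A u e1 * l1 u + A u e2 * l2 u) * l2 v"
    "A u e2 * (l1 v * l2 u - l2 v * l1 u)
      = (A u e1 * l1 u + A u e2 * l2 u) * l1 v - (A u e1 * l1 v + A u e2 * l2 v) * l1 u"
    by (simp_all only: algebra_simps)
  then have "A u e1 * (l1 v * l2 u - l2 v * l1 u) = 0" "A u e2 * (l1 v * l2 u - l2 v * l1 u) = 0"
    unfolding z by simp_all
  then have cross: "l1 v * l2 u = l2 v * l1 u" using nz by auto
  have "\<exists>x. l1 v = x * l1 u \<and> l2 v = x * l2 u"
  proof (cases "l1 u = 0")
    case True
    then show ?thesis using nS cross by (intro exI[of _ "l2 v / l2 u"]) auto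
  next
    case False
    then show ?thesis using cross by (intro exI[of _ "l1 v / l1 u"]) (auto simp: field_simps)
  qed
  then obtain x where x: "l1 v = x * l1 u" "l2 v = x * l2 u" by blast
  define w0 where "w0 = lc 1 v (- x) u"
  have w0: "l1 w0 = 0" "l2 w0 = 0" "A w0 u \<noteq> 0"
    using x v Auu by (simp_all add: w0_def lin_lc[OF l(1)] lin_lc[OF l(2)] A_lc' B_diag)
  then show "\<exists>w. l1 w = 0 \<and> l2 w = 0 \<and> A w u \<noteq> 0" by blast
  show "F w = 0" if w: "l1 w = 0" "l2 w = 0" for w
  proof (rule ccontr)
    assume Fw: "F w \<noteq> 0"
    define \<pi> where "\<pi> x = lc 1 (lc 1 x (- l1 x) e1) (- l2 x) e2" for x
    have \<pi>: "l1 (\<pi> x) = 0" "l2 (\<pi> x) = 0" for x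
      using l(3-6) by (simp_all add: \<pi>_def lin_lc[OF l(1)] lin_lc[OF l(2)])
    have id: "\<pi> x = x" if "l1 x = 0" "l2 x = 0" for x using that by (auto simp: \<pi>_def lc_def)
    have PVl: "(\<lambda>x. l1 x) \<in> PV" "(\<lambda>x. l2 x) \<in> PV" using lin_PV l by auto
    have "(\<lambda>x. F (\<pi> x)) \<in> PV" "(\<lambda>x. A (\<pi> x) u) \<in> PV"
      unfolding \<pi>_def by (intro cubic_intros PVl)+
    moreover have "F (\<pi> w) \<noteq> 0" "A (\<pi> w0) u \<noteq> 0" using id w w0 Fw by auto
    ultimately obtain x where x: "F (\<pi> x) \<noteq> 0" "A (\<pi> x) u \<noteq> 0"
      using PV_common_nonzero[of "\<lambda>x. F (\<pi> x)" "\<lambda>x. A (\<pi> x) u"] by blast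
    have "A (resid u (\<pi> x)) (\<pi> x) = 0" by (rule span[OF tangent[OF \<pi>] \<pi>])
    then show False using resid_X(4)[OF u(1) tangent[OF \<pi>]] x by simp
  qed
qed

end

section \<open>Density of the iterated residual family\<close>

text \<open>One parameter vector holds independent vectors indexed through
  \<open>prod_encode\<close>. The step from stage \<open>j\<close> to the next reads blocks
  \<open>2 * j\<close> and \<open>2 * j + 1\<close>, so changing these leaves stage \<open>j\<close>
  unchanged.\<close>

definition block :: "nat \<Rightarrow> (nat \<Rightarrow> 'a) \<Rightarrow> nat \<Rightarrow> 'a" where
  "block k t = (\<lambda>i. t (prod_encode (k, i)))"

definition block_upd :: "nat \<Rightarrow> (nat \<Rightarrow> 'a) \<Rightarrow> (nat \<Rightarrow> 'a) \<Rightarrow> (nat \<Rightarrow> 'a) \<Rightarrow> nat \<Rightarrow> 'a" where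
  "block_upd j w w' t = (\<lambda>n. case prod_decode n of (k, i) \<Rightarrow>
     if k = 2 * j then w i else if k = Suc (2 * j) then w' i else t n)"

lemma block_block_upd: "block k (block_upd j w w' t) =
    (if k = 2 * j then w else if k = Suc (2 * j) then w' else block k t)"
  by (auto simp: block_def block_upd_def)

context smooth_cubic
begin

primrec gen :: "nat \<Rightarrow> (nat \<Rightarrow> 'a) \<Rightarrow> (nat \<Rightarrow> 'a) \<Rightarrow> nat \<Rightarrow> 'a" where
  "gen 0 s t = s"
| "gen (Suc j) s t = resid (gen j s t) (tangent_vec (gen j s t) (block (2 * j) t) (block (Suc (2 * j)) t))"

lemma gen_cong: "(\<And>k. k < 2 * j \<Longrightarrow> block k t = block k t') \<Longrightarrow> gen j s t = gen j s t'"
  by (induction j) auto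

lemma gen_block_upd: "gen (Suc j) s (block_upd j w w' t) = resid (gen j s t) (tangent_vec (gen j s t) w w')"
proof -
  have "gen j s (block_upd j w w' t) = gen j s t"
    by (rule gen_cong) (auto simp: block_block_upd)
  then show ?thesis by (simp add: block_block_upd)
qed

lemma gen_X: "F s = 0 \<Longrightarrow> F (gen j s t) = 0"
  by (induction j) (auto intro: resid_X(1))

lemma gen_PV: "(\<lambda>t. gen j s t i) \<in> PV"
proof (induction j arbitrary: i)
  case 0
  show ?case by (simp add: polyfuns.const)
next
  case (Suc j)
  have b: "(\<lambda>t. block k t i) \<in> PV" for k i unfolding block_def by (rule PV_coord)
  show ?case unfolding gen.simps resid_def tangent_vec_def by (intro cubic_intros Suc.IH b)
qed

lemma irred_gen: "irred_set (range (gen j s))"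
  by (rule irred_set_image[OF gen_PV])

lemma gen_step:
  assumes "noncone (gen j s t)" "F s = 0" "A (gen j s t) v = 0"
  obtains c t' where "c \<noteq> 0" "gen (Suc j) s t' = (\<lambda>i. c * resid (gen j s t) v i)"
proof -
  obtain w where w: "A (gen j s t) w \<noteq> 0"
    using smooth[OF gen_X[OF assms(2)] noncone_nz[OF assms(1)]] by blast
  have "gen (Suc j) s (block_upd j v w t) = (\<lambda>i. (A (gen j s t) w)^3 * resid (gen j s t) v i)"
    unfolding gen_block_upd tangent_vec_tangent[OF assms(3)] resid_scale ..
  with w that show thesis by (metis power_not_zero)
qed

text \<open>From a cone vertex the residual construction goes nowhere: with
  \<open>A v u = 0\<close>, the point \<open>resid u v\<close> is a multiple of
  \<open>u\<close>.\<close>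

lemma noncone_gen_pred:
  assumes "noncone (gen (Suc j) s t)" shows "noncone (gen j s t)"
proof (rule ccontr)
  assume nc: "\<not> noncone (gen j s t)"
  define v where "v = tangent_vec (gen j s t) (block (2 * j) t) (block (Suc (2 * j)) t)"
  have "A v (gen j s t) = 0" using nc unfolding noncone_def v_def by auto
  then have "gen (Suc j) s t = (\<lambda>i. F v * gen j s t i)"
    by (simp add: v_def[symmetric] resid_def lc_def)
  then show False using assms nc noncone_scale by metis
qed

text \<open>The factor seven: \<open>tangent_vec\<close> is quadratic in \<open>u\<close>, and
  \<open>resid\<close> is cubic in its direction and linear in its base point, so the degree is
  \<open>3 * 2 + 1\<close>.\<close>

lemma homog_resid:
  assumes G: "homog d G" shows "homog (7 * d) (\<lambda>u. G (resid u (tangent_vec u w w')))"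
  unfolding homog_def
proof (intro conjI allI)
  show "(\<lambda>u. G (resid u (tangent_vec u w w'))) \<in> PV"
    by (rule PV_subst[OF homog_PV[OF G]]) (unfold resid_def tangent_vec_def, intro cubic_intros)
  fix c u
  have "tangent_vec (\<lambda>i. c * u i) w w' = (\<lambda>i. c^2 * tangent_vec u w w' i)"
    by (auto simp: tangent_vec_def lc_def A_scale algebra_simps)
  then have "resid (\<lambda>i. c * u i) (tangent_vec (\<lambda>i. c * u i) w w') = (\<lambda>i. c^7 * resid u (tangent_vec u w w') i)"
    unfolding resid_scale' by (simp add: resid_scale power_mult[symmetric] mult.assoc[symmetric] power_Suc[symmetric])
  then show "G (resid (\<lambda>i. c * u i) (tangent_vec (\<lambda>i. c * u i) w w')) = c ^ (7 * d) * G (resid u (tangent_vec u w w'))"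
    by (simp add: homog_scale[OF G] power_mult)
qed

lemma resid_dense':
  assumes G: "homog d G" and van: "\<And>u w w'. F u = 0 \<Longrightarrow> G (resid u (tangent_vec u w w')) = 0"
    and nc: "F u0 = 0" "noncone u0" and x: "F x = 0"
  shows "G x = 0"
proof (rule resid_dense[OF G _ nc x])
  fix u v assume u: "F u = 0" "noncone u" "A u v = 0"
  obtain w where w: "A u w \<noteq> 0" using smooth[OF u(1) noncone_nz[OF u(2)]] by blast
  have "G (resid u (tangent_vec u v w)) = 0" using van u by blast
  then show "G (resid u v) = 0" using w
    by (simp add: tangent_vec_tangent[OF u(3)] resid_scale homog_scale[OF G])
qed

text \<open>Three steps suffice. If the third stage is not dense, then the tangent hyperplanes along the
  first two stages contain axes \<open>S\<^sub>1\<close> and \<open>S\<^sub>2\<close> of codimension two, \<open>S\<^sub>1\<close> is contained in the cubic, and the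
  tangent hyperplane at a general point of \<open>S\<^sub>1\<close> is \<open>S\<^sub>1 + S\<^sub>2\<close>, which contradicts smoothness.\<close>

theorem gen_dense:
  assumes s: "F s = 0" and t0: "noncone (gen 2 s t0)"
    and G: "homog d G" "\<And>t. G (gen 3 s t) = 0" and x: "F x = 0"
  shows "G x = 0"
proof (rule ccontr)
  assume "G x \<noteq> 0"
  then have nv: "nonvan G" using x G by (auto simp: nonvan_def homog_PV)
  have nc1: "noncone (gen 1 s t0)" using noncone_gen_pred[of 1 s t0] t0 by (simp add: numeral_2_eq_2)
  have nc0: "noncone s" using noncone_gen_pred[of 0 s t0] nc1 by simp
  have van2: "G (resid u v) = 0" if u: "u \<in> range (gen 2 s)" "noncone u" "A u v = 0" for u v
  proof -
    obtain t where t: "u = gen 2 s t" using u(1) by blast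
    obtain c t' where "c \<noteq> 0" "gen (Suc 2) s t' = (\<lambda>i. c * resid u v i)"
      using gen_step[of 2 s t v] u(2,3) s unfolding t by blast
    then show ?thesis using G(2)[of t'] homog_scale[OF G(1), of c "resid u v"]
      by (simp add: numeral_3_eq_3 numeral_2_eq_2)
  qed
  have ZF: "\<And>u. u \<in> range (gen j s) \<Longrightarrow> F u = 0" for j using gen_X[OF s] by auto
  \<comment> \<open>If every form vanishing on the second stage vanished on the cubic, the
    composition of \<open>G\<close> with a tangent step would vanish on the cubic. Then
    \<open>resid_dense'\<close> would kill \<open>G\<close>.\<close>
  have "\<exists>d2 G2. homog d2 G2 \<and> (\<forall>t. G2 (gen 2 s t) = 0) \<and> nonvan G2"
  proof (rule ccontr)
    assume contra: "\<not> ?thesis"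
    have "G x = 0"
    proof (rule resid_dense'[OF G(1) _ ZF[OF rangeI] t0 x])
      fix u w w' assume u: "F u = 0"
      define H where "H u = G (resid u (tangent_vec u w w'))" for u
      have H: "homog (7 * d) H" unfolding H_def by (rule homog_resid[OF G(1)])
      have "H (gen 2 s t) = 0" for t
        using G(2)[of "block_upd 2 w w' t"] gen_block_upd[of 2 s w w' t]
        by (simp add: H_def numeral_3_eq_3 numeral_2_eq_2)
      then have "\<not> nonvan H" using contra H by blast
      then show "G (resid u (tangent_vec u w w')) = 0"
        using u homog_PV[OF H] unfolding nonvan_def H_def by blast
    qed
    then show False using \<open>G x \<noteq> 0\<close> by simp
  qed
  then obtain d2 G2 where G2: "homog d2 G2" "\<And>t. G2 (gen 2 s t) = 0" "nonvan G2" by blast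
  have van1: "G2 (resid u v) = 0" if u: "u \<in> range (gen 1 s)" "noncone u" "A u v = 0" for u v
  proof -
    obtain t where t: "u = gen 1 s t" using u(1) by blast
    obtain c t' where "c \<noteq> 0" "gen (Suc 1) s t' = (\<lambda>i. c * resid u v i)"
      using gen_step[of 1 s t v] u(2,3) s unfolding t by blast
    then show ?thesis using G2(2)[of t'] homog_scale[OF G2(1), of c "resid u v"]
      by (simp add: numeral_2_eq_2)
  qed
  have det1: "det3 (A u1) (A u2) (A u3) w1 w2 w3 = 0"
    if "u1 \<in> range (gen 1 s)" "u2 \<in> range (gen 1 s)" "u3 \<in> range (gen 1 s)" for u1 u2 u3 w1 w2 w3
    by (rule gauss_image_pencil[OF G2(1,3) irred_gen ZF rangeI nc1 van1 that])
  have det2: "det3 (A u1) (A u2) (A u3) w1 w2 w3 = 0"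
    if "u1 \<in> range (gen 2 s)" "u2 \<in> range (gen 2 s)" "u3 \<in> range (gen 2 s)" for u1 u2 u3 w1 w2 w3
    by (rule gauss_image_pencil[OF G(1) nv irred_gen ZF rangeI t0 van2 that])
  have r: "gen 1 s t0 \<in> range (gen 1 s)" "gen 2 s t0 \<in> range (gen 2 s)" by blast+
  obtain l1 l2 e1 e2 where l: "lin l1" "lin l2" "l1 e1 = 1" "l1 e2 = 0" "l2 e1 = 0" "l2 e2 = 1"
    and span1: "\<forall>u\<in>range (gen 1 s). \<forall>v. A u v = A u e1 * l1 v + A u e2 * l2 v"
    by (rule dual_pair[OF irred_gen ZF r(1) noncone_nz[OF nc1] det1])
  obtain m1 m2 f1 f2 where m: "lin m1" "lin m2" "m1 f1 = 1" "m1 f2 = 0" "m2 f1 = 0" "m2 f2 = 1"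
    and span2: "\<forall>u\<in>range (gen 2 s). \<forall>v. A u v = A u f1 * m1 v + A u f2 * m2 v"
    by (rule dual_pair[OF irred_gen ZF r(2) noncone_nz[OF t0] det2])
  have sp1: "A (resid s v) w = 0" if v: "A s v = 0" and w: "l1 w = 0" "l2 w = 0" for v w
  proof -
    obtain c t' where c: "c \<noteq> 0" "gen (Suc 0) s t' = (\<lambda>i. c * resid s v i)"
      using gen_step[of 0 s t0 v] v s nc0 by auto
    have "A (gen 1 s t') w = 0" using span1 w by (metis add_0 mult_zero_right rangeI)
    then show ?thesis using c by (simp add: A_scale)
  qed
  have tangent1: "A s w = 0" if "l1 w = 0" "l2 w = 0" for w
    by (rule axis_in_tangent[OF s nc0 l sp1 that])
  have S1: "F w = 0" if "l1 w = 0" "l2 w = 0" for w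
    by (rule axis_linear(3)[OF s nc0 l sp1 that])
  obtain y where y: "l1 y = 0" "l2 y = 0" "A y s \<noteq> 0" using axis_linear(2)[OF s nc0 l sp1] by blast
  \<comment> \<open>Such a \<open>z\<close> is a first-stage point up to scaling: it is tangent at
    \<open>s\<close>, and \<open>F z = 0\<close> makes \<open>resid s z\<close> a multiple of
    \<open>z\<close>. So the second stage can be studied from \<open>z\<close>.\<close>
  have axis2: "\<not> (m1 z = 0 \<and> m2 z = 0)" "\<And>w. m1 w = 0 \<Longrightarrow> m2 w = 0 \<Longrightarrow> A z w = 0"
    if z: "l1 z = 0" "l2 z = 0" "A z s \<noteq> 0" "noncone z" for z
  proof -
    have As: "A s z = 0" by (rule tangent1[OF z(1,2)])
    obtain c t' where c: "c \<noteq> 0" "gen (Suc 0) s t' = (\<lambda>i. c * resid s z i)"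
      using gen_step[of 0 s t0 z] As s nc0 by auto
    have "resid s z = (\<lambda>i. - A z s * z i)" using S1[OF z(1,2)] by (simp add: resid_def lc_def)
    then have "gen 1 s t' = (\<lambda>i. (- (c * A z s)) * z i)" using c(2) by (simp add: mult.assoc)
    then obtain k where k: "k \<noteq> 0" "gen 1 s t' = (\<lambda>i. k * z i)"
      using c(1) z(3) by (metis mult_eq_0_iff neg_equal_0_iff_equal)
    have "z = (\<lambda>i. inverse k * gen 1 s t' i)" using k by auto
    then have nck: "noncone (gen 1 s t')" using z(4) noncone_scale by metis
    have sp2: "A (resid z v) w = 0" if v: "A z v = 0" and w: "m1 w = 0" "m2 w = 0" for v w
    proof -
      have "A (gen 1 s t') v = 0" unfolding k(2) A_scale using v by simp
      then obtain c' t'' where c': "c' \<noteq> 0" "gen (Suc 1) s t'' = (\<lambda>i. c' * resid (gen 1 s t') v i)"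
        using gen_step[OF nck s] by blast
      have "A (gen 2 s t'') w = 0" using span2 w by (metis add_0 mult_zero_right rangeI)
      then show ?thesis using c' k by (simp add: numeral_2_eq_2 A_scale resid_scale')
    qed
    show "\<not> (m1 z = 0 \<and> m2 z = 0)" by (rule axis_linear(1)[OF S1[OF z(1,2)] z(4) m sp2])
    show "A z w = 0" if "m1 w = 0" "m2 w = 0" for w
      by (rule axis_in_tangent[OF S1[OF z(1,2)] z(4) m sp2 that])
  qed
  obtain i where i: "i \<le> N" "y i \<noteq> 0" using nz_A(2)[OF y(3)] by (auto simp: nz_def)
  obtain y' where y': "nz y'" "l1 y' = 0" "l2 y' = 0" "y' i = 0" using kernel3[OF l(1,2) lin_coord[of i]] by blast
  have nz: "nz (lc a y b y')" if "a \<noteq> 0 \<or> b \<noteq> 0" for a b using nz_lc[of i y y' a b] i y' that by simp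
  have in_S: "l1 (lc a y b y') = 0" "l2 (lc a y b y') = 0" for a b
    using y y' by (simp_all add: lin_lc[OF l(1)] lin_lc[OF l(2)])
  have line: "F y = 0 \<and> A y y' = 0 \<and> A y' y = 0 \<and> F y' = 0"
    by (rule line_tangent[of "{}"]) (use S1[OF in_S] in auto)
  obtain a b where "noncone (lc a y b y')" using line_has_noncone[of y y'] line nz by blast
  then obtain w w' where ww': "A (tangent_vec (lc a y b y') w w') (lc a y b y') \<noteq> 0"
    using noncone_iff[OF S1[OF in_S]] by blast
  \<comment> \<open>A line in \<open>S\<^sub>1\<close>. It has a noncone point by
    \<open>line_has_noncone\<close>, and \<open>A y s\<close> is nonzero, so its general point
    \<open>z\<close> satisfies both conditions.\<close>
  define Y where "Y \<tau> = lc (\<tau> 0) y (\<tau> 1) y'" for \<tau> :: "nat \<Rightarrow> 'a"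
  have "(\<lambda>\<tau>. A (tangent_vec (Y \<tau>) w w') (Y \<tau>)) \<in> PV" "(\<lambda>\<tau>. A (Y \<tau>) s) \<in> PV"
    unfolding Y_def tangent_vec_def by (intro cubic_intros)+
  moreover have "A (tangent_vec (Y (\<lambda>n. if n = 0 then a else b)) w w') (Y (\<lambda>n. if n = 0 then a else b)) \<noteq> 0"
    using ww' by (simp add: Y_def)
  moreover have "A (Y (\<lambda>n. if n = 0 then 1 else 0)) s \<noteq> 0" using y by (simp add: Y_def)
  ultimately obtain \<tau> where \<tau>: "A (tangent_vec (Y \<tau>) w w') (Y \<tau>) \<noteq> 0" "A (Y \<tau>) s \<noteq> 0"
    by (rule PV_common_nonzero)
  define z where "z = Y \<tau>"
  have "\<tau> 0 \<noteq> 0 \<or> \<tau> 1 \<noteq> 0"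
  proof (rule ccontr)
    assume "\<not> ?thesis"
    then have "\<not> nz z" by (auto simp: z_def Y_def nz_def lc_def)
    then show False using \<tau>(2) not_nz(2) unfolding z_def by blast
  qed
  define D where "D = (if \<tau> 0 \<noteq> 0 then y' else y)"
  have combD: "\<exists>a' b'. lc a z b D = lc a' y b' y' \<and> (a' \<noteq> 0 \<or> b' \<noteq> 0)" if "a \<noteq> 0 \<or> b \<noteq> 0" for a b
  proof (cases "\<tau> 0 = 0")
    case True
    then have "lc a z b D = lc b y (a * \<tau> 1) y'" by (auto simp: z_def Y_def D_def lc_def)
    then show ?thesis using that True \<open>\<tau> 0 \<noteq> 0 \<or> \<tau> 1 \<noteq> 0\<close> by (metis mult_eq_0_iff)
  next
    case False
    then have "lc a z b D = lc (a * \<tau> 0) y (a * \<tau> 1 + b) y'" by (auto simp: z_def Y_def D_def lc_def algebra_simps)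
    then show ?thesis using that False by (metis add_0 mult_eq_0_iff mult_zero_left)
  qed
  have nzD: "nz (lc a z b D)" if "a \<noteq> 0 \<or> b \<noteq> 0" for a b using combD[OF that] nz by metis
  have SD: "l1 (lc 1 z t D) = 0" "l2 (lc 1 z t D) = 0" for t using combD[of 1 t] in_S by (metis one_neq_zero)+
  have lineD: "F z = 0 \<and> A z D = 0 \<and> A D z = 0 \<and> F D = 0"
    by (rule line_tangent[of "{}"]) (use S1[OF SD] in auto)
  have pu: "(\<lambda>t. A (tangent_vec (lc 1 z t D) w w') (lc 1 z t D)) \<in> PU" "(\<lambda>t. A (lc 1 z t D) s) \<in> PU"
    unfolding tangent_vec_def by (intro cubic_intros)+
  obtain p where p: "\<And>t. A (tangent_vec (lc 1 z t D) w w') (lc 1 z t D) = poly p t"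
    by (rule PU_poly[OF pu(1)]) blast
  obtain q where q: "\<And>t. A (lc 1 z t D) s = poly q t"
    by (rule PU_poly[OF pu(2)]) blast
  have "poly p 0 \<noteq> 0" "poly q 0 \<noteq> 0" using p[of 0] q[of 0] \<tau> by (simp_all add: z_def)
  then have "p \<noteq> 0" "q \<noteq> 0" by auto
  define T where "T = {t. poly p t = 0} \<union> {t. poly q t = 0}"
  have finT: "finite T" unfolding T_def using poly_roots_finite \<open>p \<noteq> 0\<close> \<open>q \<noteq> 0\<close> by blast
  have gen_pt: "noncone (lc 1 z t D)" "A (lc 1 z t D) s \<noteq> 0" if "t \<notin> T" for t
    using that p[of t] q[of t] noncone_iff[OF S1[OF SD[of t]]] unfolding T_def by auto
  have "0 \<notin> T" using \<open>poly p 0 \<noteq> 0\<close> \<open>poly q 0 \<noteq> 0\<close> by (simp add: T_def)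
  have A2: "A (lc 1 z t D) v = A (lc 1 z t D) f1 * m1 v + A (lc 1 z t D) f2 * m2 v" if "t \<notin> T" for t v
    by (rule dual_pair_span[OF m lin_A]) (rule axis2(2)[OF SD gen_pt(2,1)[OF that]])
  \<comment> \<open>Both hyperplanes belong to the second pencil and contain \<open>z\<close>, which
    is off its axis, and only one member does. Constancy along a line contradicts
    \<open>line_gauss_varies\<close>.\<close>
  have "\<exists>\<kappa>. \<forall>w. A (lc 1 z t D) w = \<kappa> * A z w" if t: "t \<notin> T" for t
  proof -
    define \<alpha> \<beta> \<alpha>0 \<beta>0 where "\<alpha> = A (lc 1 z t D) f1" and "\<beta> = A (lc 1 z t D) f2"
      and "\<alpha>0 = A z f1" and "\<beta>0 = A z f2"
    have At: "A (lc 1 z t D) v = \<alpha> * m1 v + \<beta> * m2 v" for v unfolding \<alpha>_def \<beta>_def by (rule A2[OF t])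
    have Az: "A z v = \<alpha>0 * m1 v + \<beta>0 * m2 v" for v
      using A2[OF \<open>0 \<notin> T\<close>, of v] unfolding \<alpha>0_def \<beta>0_def lc_simps .
    have "A (lc 1 z t D) z = 0" using lineD by (simp add: A_lc' A_self B_diag)
    then have 1: "\<alpha> * m1 z + \<beta> * m2 z = 0" by (simp only: At)
    have "A z z = 0" using lineD by (simp add: A_self)
    then have 2: "\<alpha>0 * m1 z + \<beta>0 * m2 z = 0" by (simp only: Az)
    have m0: "m1 z \<noteq> 0 \<or> m2 z \<noteq> 0"
      using axis2(1)[OF SD gen_pt(2,1)[OF \<open>0 \<notin> T\<close>]] by simp
    have "m1 z * (\<alpha> * \<beta>0 - \<alpha>0 * \<beta>) = \<beta>0 * (\<alpha> * m1 z + \<beta> * m2 z) - \<beta> * (\<alpha>0 * m1 z + \<beta>0 * m2 z)"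
      "m2 z * (\<alpha> * \<beta>0 - \<alpha>0 * \<beta>) = \<alpha> * (\<alpha>0 * m1 z + \<beta>0 * m2 z) - \<alpha>0 * (\<alpha> * m1 z + \<beta> * m2 z)"
      by (simp_all add: algebra_simps)
    then have cross: "\<alpha> * \<beta>0 = \<alpha>0 * \<beta>" using m0 unfolding 1 2 by auto
    obtain e where "A z e \<noteq> 0" using smooth[of z] nzD[of 1 0] lineD by auto
    then have "\<alpha>0 \<noteq> 0 \<or> \<beta>0 \<noteq> 0" using Az[of e] by auto
    then show ?thesis
    proof
      assume a0: "\<alpha>0 \<noteq> 0"
      then have "\<beta> = (\<alpha> / \<alpha>0) * \<beta>0" using cross by (simp add: field_simps)
      then show ?thesis using a0 unfolding At Az by (intro exI[of _ "\<alpha> / \<alpha>0"]) (simp add: algebra_simps)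
    next
      assume b0: "\<beta>0 \<noteq> 0"
      then have "\<alpha> = (\<beta> / \<beta>0) * \<alpha>0" using cross by (simp add: field_simps)
      then show ?thesis using b0 unfolding At Az by (intro exI[of _ "\<beta> / \<beta>0"]) (simp add: algebra_simps)
    qed
  qed
  then show False using line_gauss_varies[of z D T "A z"] lineD nzD finT by blast
qed

end

section \<open>Descent to the ground field\<close>

text \<open>Reduction modulo \<open>\<theta>\<^sup>2 + Q \<theta> + R\<close>: the Weil restriction along the quadratic extension by \<open>\<theta>\<close>.\<close>

lemma weil_restriction:
  assumes f: "f \<in> polyfuns ((\<lambda>g p. g (fst p)) ` C \<union> {snd}) S"
    and Q: "Q \<in> polyfuns C S" and R: "R \<in> polyfuns C S" and S: "0 \<in> S" "1 \<in> S" "- 1 \<in> S"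
  shows "\<exists>\<alpha>\<in>polyfuns C S. \<exists>\<beta>\<in>polyfuns C S. \<forall>t \<theta>. \<theta>^2 + Q t * \<theta> + R t = (0::'a::comm_ring_1) \<longrightarrow> f (t, \<theta>) = \<alpha> t + \<theta> * \<beta> t"
  using f
proof induction
  case (const c)
  then show ?case using S by (intro bexI[of _ "\<lambda>_. c"] bexI[of _ "\<lambda>_. 0"]) (auto intro: polyfuns.const)
next
  case (coord f)
  then consider g where "g \<in> C" "f = (\<lambda>p. g (fst p))" | "f = snd" by auto
  then show ?case
  proof cases
    case 1
    then show ?thesis using S by (intro bexI[of _ g] bexI[of _ "\<lambda>_. 0"]) (auto intro: polyfuns.const polyfuns.coord)
  next
    case 2
    then show ?thesis using S by (intro bexI[of _ "\<lambda>_. 0"] bexI[of _ "\<lambda>_. 1"]) (auto intro: polyfuns.const)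
  qed
next
  case (add f g)
  then obtain a b a' b' where ab: "a \<in> polyfuns C S" "b \<in> polyfuns C S" "a' \<in> polyfuns C S" "b' \<in> polyfuns C S"
    "\<And>t \<theta>. \<theta>^2 + Q t * \<theta> + R t = 0 \<Longrightarrow> f (t, \<theta>) = a t + \<theta> * b t"
    "\<And>t \<theta>. \<theta>^2 + Q t * \<theta> + R t = 0 \<Longrightarrow> g (t, \<theta>) = a' t + \<theta> * b' t" by blast
  show ?case
    by (intro bexI[of _ "\<lambda>t. a t + a' t"] bexI[of _ "\<lambda>t. b t + b' t"])
      (use ab in \<open>auto simp: algebra_simps intro: polyfuns.add\<close>)
next
  case (mult f g)
  then obtain a b a' b' where ab: "a \<in> polyfuns C S" "b \<in> polyfuns C S" "a' \<in> polyfuns C S" "b' \<in> polyfuns C S"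
    "\<And>t \<theta>. \<theta>^2 + Q t * \<theta> + R t = 0 \<Longrightarrow> f (t, \<theta>) = a t + \<theta> * b t"
    "\<And>t \<theta>. \<theta>^2 + Q t * \<theta> + R t = 0 \<Longrightarrow> g (t, \<theta>) = a' t + \<theta> * b' t" by blast
  have "f (t, \<theta>) * g (t, \<theta>) = (a t * a' t - R t * (b t * b' t)) + \<theta> * (a t * b' t + a' t * b t - Q t * (b t * b' t))"
    if th: "\<theta>^2 + Q t * \<theta> + R t = 0" for t \<theta>
  proof -
    have "f (t, \<theta>) * g (t, \<theta>) = (a t * a' t - R t * (b t * b' t)) + \<theta> * (a t * b' t + a' t * b t - Q t * (b t * b' t))
        + (\<theta>^2 + Q t * \<theta> + R t) * (b t * b' t)"
      unfolding ab(5)[OF th] ab(6)[OF th] by (simp add: algebra_simps power2_eq_square)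
    then show ?thesis unfolding th by simp
  qed
  moreover have "(\<lambda>t. a t * a' t - R t * (b t * b' t)) \<in> polyfuns C S"
    "(\<lambda>t. a t * b' t + a' t * b t - Q t * (b t * b' t)) \<in> polyfuns C S"
    by (intro polyfuns.add polyfuns.mult polyfuns_diff ab Q R S)+
  ultimately show ?case
    by (intro bexI[of _ "\<lambda>t. a t * a' t - R t * (b t * b' t)"]
        bexI[of _ "\<lambda>t. a t * b' t + a' t * b t - Q t * (b t * b' t)"] allI impI)
qed

section \<open>Starting points and third points of conjugate pairs\<close>

context smooth_cubic
begin

text \<open>If \<open>z\<close> is a cone vertex, any other point of its tangent section spans with
  it a line in the cubic, and \<open>line_has_noncone\<close> applies to that line.\<close>

lemma exists_noncone: "\<exists>u. F u = 0 \<and> noncone u"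
proof -
  obtain z where z: "nz z" "F z = 0" using X_point_in_kernel[OF lin_coord lin_coord] by metis
  show ?thesis
  proof (cases "noncone z")
    case False
    obtain i where i: "i \<le> N" "z i \<noteq> 0" using z(1) by (auto simp: nz_def)
    obtain u where u: "nz u" "F u = 0" "A z u = 0" "u i = 0" by (rule X_point_in_kernel[OF lin_A lin_coord[of i]])
    have "A u z = 0" using False u(3) unfolding noncone_def by blast
    then obtain a b where "noncone (lc a z b u)" "F (lc a z b u) = 0"
      using line_has_noncone[OF z(2) u(2,3)] nz_lc[of i z u] i u z by (metis F_lc add_0 mult_zero_right)
    then show ?thesis by blast
  qed (use z in blast)
qed

text \<open>Composing \<open>G\<close> with the last step gives a form vanishing on the preceding
  stages for all starting points, hence on the cubic; then \<open>resid_dense'\<close> yields the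
  claim for \<open>G\<close>.\<close>

lemma gen_family_dense:
  assumes "homog d G" "\<And>s t. F s = 0 \<Longrightarrow> G (gen j s t) = 0" "F x = 0"
  shows "G x = 0"
  using assms
proof (induction j arbitrary: G d x)
  case 0
  then show ?case by simp
next
  case (Suc j)
  obtain u0 where u0: "F u0 = 0" "noncone u0" using exists_noncone by blast
  show ?case
  proof (rule resid_dense'[OF Suc.prems(1) _ u0 Suc.prems(3)])
    fix u w w' assume u: "F u = 0"
    show "G (resid u (tangent_vec u w w')) = 0"
    proof (rule Suc.IH[OF homog_resid[OF Suc.prems(1)] _ u])
      fix s t assume s: "F s = 0"
      show "G (resid (gen j s t) (tangent_vec (gen j s t) w w')) = 0"
        using Suc.prems(2)[OF s, of "block_upd j w w' t"] unfolding gen_block_upd .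
    qed
  qed
qed

text \<open>Degree five: \<open>tangent_vec\<close> has degree two in \<open>u\<close> and enters
  quadratically, and \<open>u\<close> enters once more linearly.\<close>

lemma homog_noncone: "homog 5 (\<lambda>u. A (tangent_vec u w w') u)"
  unfolding homog_def
proof (intro conjI allI)
  show "(\<lambda>u. A (tangent_vec u w w') u) \<in> PV" unfolding tangent_vec_def by (intro cubic_intros)
  fix c u
  have "tangent_vec (\<lambda>i. c * u i) w w' = (\<lambda>i. c^2 * tangent_vec u w w' i)"
    by (auto simp: tangent_vec_def lc_def A_scale algebra_simps)
  then show "A (tangent_vec (\<lambda>i. c * u i) w w') (\<lambda>i. c * u i) = c ^ 5 * A (tangent_vec u w w') u"
    by (simp add: A_scale A_scale' power_mult[symmetric] mult.assoc[symmetric] power_Suc[symmetric] power_commutes)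
qed

lemma gen_scale: "gen j (\<lambda>i. c * s i) t = (\<lambda>i. c ^ (7 ^ j) * gen j s t i)"
proof (induction j)
  case (Suc j)
  let ?c = "c ^ (7 ^ j)"
  have tv: "tangent_vec (\<lambda>i. a * u i) w w' = (\<lambda>i. a^2 * tangent_vec u w w' i)" for a u w w'
    by (auto simp: tangent_vec_def lc_def A_scale algebra_simps)
  have "?c * (?c\<^sup>2) ^ 3 = c ^ (7 ^ Suc j)"
    by (simp add: power_mult[symmetric] power_add[symmetric] algebra_simps)
  then show ?case
    unfolding gen.simps Suc tv resid_scale' resid_scale by (simp add: mult.assoc[symmetric])
qed simp

lemma gen_PV': "(\<lambda>s. gen j s t i) \<in> PV"
proof (induction j arbitrary: i)
  case 0
  show ?case by (simp add: PV_coord)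
next
  case (Suc j)
  show ?case unfolding gen.simps resid_def tangent_vec_def by (intro cubic_intros Suc.IH)
qed

text \<open>A line through \<open>p\<close> that meets the cubic in two further, distinct and sufficiently general points.\<close>

lemma good_line:
  assumes p: "F p = 0" "nz p"
  obtains a \<theta>1 \<theta>2 t0 where "\<theta>1 \<noteq> \<theta>2" "\<theta>1 + \<theta>2 = - A a p" "\<theta>1 * \<theta>2 = A p a * F a"
    "noncone (gen 2 (lc (F a) p \<theta>1 a) t0)" "noncone (gen 2 (lc (F a) p \<theta>2 a) t0)"
proof -
  obtain u0 where u0: "F u0 = 0" "noncone u0" using exists_noncone by blast
  obtain w w' where w: "A (tangent_vec u0 w w') u0 \<noteq> 0" using noncone_iff[OF u0(1)] u0(2) by blast
  obtain s0 t0 where st: "F s0 = 0" "A (tangent_vec (gen 2 s0 t0) w w') (gen 2 s0 t0) \<noteq> 0"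
    using gen_family_dense[OF homog_noncone _ u0(1), of 2 w w'] w by blast
  define \<phi> where "\<phi> s = A (tangent_vec (gen 2 s t0) w w') (gen 2 s t0)" for s
  have "\<phi> \<in> PV" unfolding \<phi>_def by (rule PV_subst[OF homog_PV[OF homog_noncone] gen_PV'])
  moreover have "\<phi> (\<lambda>i. c * s i) = c ^ (7^2 * 5) * \<phi> s" for c s
    unfolding \<phi>_def gen_scale homog_scale[OF homog_noncone] by (simp only: power_mult)
  ultimately have \<phi>: "homog (7^2 * 5) \<phi>" unfolding homog_def by blast
  have nv: "nonvan \<phi>" using st \<open>\<phi> \<in> PV\<close> unfolding nonvan_def \<phi>_def by blast
  have nc: "noncone (gen 2 s t0)" if "F s = 0" "\<phi> s \<noteq> 0" for s
    using that noncone_iff[OF gen_X[OF that(1)]] unfolding \<phi>_def by blast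
  obtain v where v: "A p v \<noteq> 0" using smooth[OF p] by blast
  obtain v' where v': "F v' = 0" "A v' p \<noteq> 0" using not_strange[OF p] by blast
  have "(\<lambda>x. A x p) \<in> PV" by (intro cubic_intros)
  then have "nonvan (\<lambda>x. A x p)" using v' by (intro nonvanI)
  then have "nonvan (\<lambda>s. A p s * (A s p * (\<phi> s * \<phi> (third p s))))"
    by (intro nonvan_mult nonvan_lin[OF lin_A v] nv nonvan_third[OF \<phi> nv p(1) v])
  then obtain s where s: "F s = 0" "A p s \<noteq> 0" "A s p \<noteq> 0" "\<phi> s \<noteq> 0" "\<phi> (third p s) \<noteq> 0"
    by (auto simp: nonvan_def)
  define \<alpha> L where "\<alpha> = A s p" and "L = A p s"
  have \<alpha>L: "\<alpha> \<noteq> 0" "L \<noteq> 0" using s by (simp_all add: \<alpha>_def L_def)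
  have "finite {0, - \<alpha> / L}" by simp
  then obtain l where l: "l \<notin> {0, - \<alpha> / L}" using infinite_alg_closed ex_new_if_finite by blast
  define k where "k = \<alpha> + l * L"
  have k: "k \<noteq> 0"
  proof
    assume "k = 0"
    then have "l * L = - \<alpha>" by (simp add: k_def eq_neg_iff_add_eq_0 add.commute)
    then have "l = - \<alpha> / L" using \<alpha>L(2) by (metis nonzero_mult_div_cancel_right)
    then show False using l by simp
  qed
  \<comment> \<open>The line through \<open>p\<close> and \<open>a\<close> is the one through
    \<open>p\<close> and \<open>s\<close>. By the choice of \<open>l\<close>, \<open>a\<close> is
    off the cubic. The roots \<open>- k\<close> and \<open>- (l * L)\<close> belong to
    \<open>s\<close> and \<open>third p s\<close>, and they differ because \<open>A s p\<close> is
    nonzero.\<close>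
  define a where "a = lc 1 s l p"
  have Fa: "F a = l * k"
    using s p by (simp add: a_def F_lc \<alpha>_def L_def k_def algebra_simps power2_eq_square)
  have Apa: "A p a = L" using p by (simp add: a_def A_lc A_self L_def)
  have Aap: "A a p = \<alpha> + 2 * l * L" using p by (simp add: a_def A_lc' A_self B_diag \<alpha>_def L_def)
  have s1: "lc (F a) p (- k) a = (\<lambda>i. (- k) * s i)" unfolding Fa by (auto simp: a_def lc_def algebra_simps)
  have s2: "lc (F a) p (- (l * L)) a = (\<lambda>i. l * third p s i)"
    unfolding Fa by (auto simp: a_def lc_def third_def k_def \<alpha>_def L_def algebra_simps)
  have scale: "noncone (gen 2 (\<lambda>i. c * x i) t0)" if "c \<noteq> 0" "noncone (gen 2 x t0)" for c x
  proof (rule noncone_scale)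
    have "(\<lambda>i. inverse (c ^ (7 ^ 2)) * gen 2 (\<lambda>i. c * x i) t0 i) = gen 2 x t0"
      using that(1) by (auto simp: gen_scale)
    then show "noncone (\<lambda>i. inverse (c ^ (7 ^ 2)) * gen 2 (\<lambda>i. c * x i) t0 i)" using that(2) by simp
  qed
  show thesis
  proof (rule that[of "- k" "- (l * L)" a t0])
    show "- k \<noteq> - (l * L)" using \<alpha>L by (simp add: k_def)
    show "- k + - (l * L) = - A a p" by (simp add: Aap k_def algebra_simps)
    show "- k * - (l * L) = A p a * F a" by (simp add: Apa Fa)
    show "noncone (gen 2 (lc (F a) p (- k) a) t0)"
      unfolding s1 by (rule scale) (use k nc s in auto)
    show "noncone (gen 2 (lc (F a) p (- (l * L)) a) t0)"
      unfolding s2 by (rule scale) (use l nc s third_X(1)[OF p(1) s(1)] in auto)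
  qed
qed

text \<open>Vieta: the cubic \<open>F (lc 1 x \<theta> y)\<close> in \<theta> has leading
  coefficients \<open>F y\<close> and \<open>A y x\<close>, so two roots determine the third through
  their sum. The right-hand combination is symmetric in them, hence rational for a conjugate
  pair.\<close>

lemma third_conjugate:
  assumes x: "F (lc 1 x \<theta>1 y) = 0" "F (lc 1 x \<theta>2 y) = 0" and ne: "\<theta>1 \<noteq> \<theta>2"
  shows "third (lc 1 x \<theta>1 y) (lc 1 x \<theta>2 y) =
    (\<lambda>i. (\<theta>1 - \<theta>2)^3 * lc (F y) x (F y * - (\<theta>1 + \<theta>2) - A y x) y i)"
proof -
  define \<delta> where "\<delta> = \<theta>1 - \<theta>2"
  define u where "u = lc 1 x \<theta>2 y"
  define g c where "g = F y" and "c = A y u"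
  have u1: "lc 1 x \<theta>1 y = lc 1 u \<delta> y" by (auto simp: u_def \<delta>_def lc_def algebra_simps)
  have Fu: "F u = 0" using x(2) by (simp add: u_def)
  have \<delta>: "\<delta> \<noteq> 0" using ne by (simp add: \<delta>_def)
  have "\<delta> * (A u y + \<delta> * (c + \<delta> * g)) = 0"
    using x(1) unfolding u1 by (simp add: F_lc Fu g_def c_def algebra_simps power2_eq_square power3_eq_cube)
  then have Auy: "A u y = - (\<delta> * (c + \<delta> * g))" using \<delta> by (simp add: eq_neg_iff_add_eq_0)
  have cx: "c = A y x + \<theta>2 * (3 * g)" by (simp add: c_def u_def A_lc A_self g_def)
  have 1: "A u (lc 1 u \<delta> y) = - (\<delta>^2 * (c + \<delta> * g))"
    by (simp add: A_lc A_self Fu Auy power2_eq_square)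
  have 2: "A (lc 1 u \<delta> y) u = - (2 * \<delta>^2 * (c + \<delta> * g)) + \<delta>^2 * c"
    by (simp add: A_lc' A_self B_diag Fu Auy c_def power2_eq_square algebra_simps)
  have 3: "third (lc 1 u \<delta> y) u i = \<delta>^3 * (g * u i - (c + \<delta> * g) * y i)" for i
    unfolding third_def 1 2 by (simp add: lc_def algebra_simps power2_eq_square power3_eq_cube)
  have 4: "g * u i - (c + \<delta> * g) * y i = lc g x (g * - (\<theta>1 + \<theta>2) - A y x) y i" for i
    unfolding cx by (simp add: u_def \<delta>_def lc_def algebra_simps)
  have "third (lc 1 u \<delta> y) u = (\<lambda>i. \<delta>^3 * lc g x (g * - (\<theta>1 + \<theta>2) - A y x) y i)"
    by (rule ext) (simp only: 3 4)
  then show ?thesis unfolding u1 u_def[symmetric] \<delta>_def[symmetric] g_def .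
qed

lemma homog_third:
  assumes G: "homog d G"
  shows "homog (2 * d) (\<lambda>x. G (third x y))" "homog (2 * d) (\<lambda>x. G (third y x))"
proof -
  have "third (\<lambda>i. c * x i) y = (\<lambda>i. c^2 * third x y i)" "third y (\<lambda>i. c * x i) = (\<lambda>i. c^2 * third y x i)" for c x
    by (auto simp: third_def lc_def A_scale A_scale' algebra_simps power2_eq_square)
  moreover have "(\<lambda>x. G (third x y)) \<in> PV"
    by (rule PV_subst[OF homog_PV[OF G]], unfold third_def, intro cubic_intros)
  moreover have "(\<lambda>x. G (third y x)) \<in> PV"
    by (rule PV_subst[OF homog_PV[OF G]], unfold third_def, intro cubic_intros)
  ultimately show "homog (2 * d) (\<lambda>x. G (third x y))" "homog (2 * d) (\<lambda>x. G (third y x))"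
    unfolding homog_def by (auto simp: homog_scale[OF G] power_mult)
qed

lemma polyfuns_resid:
  assumes "(\<lambda>x. u x i) \<in> polyfuns D S" "\<And>i. i \<le> N \<Longrightarrow> (\<lambda>x. u x i) \<in> polyfuns D S"
    "(\<lambda>x. v x i) \<in> polyfuns D S" "\<And>i. i \<le> N \<Longrightarrow> (\<lambda>x. v x i) \<in> polyfuns D S"
    and S: "cf ` E \<subseteq> S" "0 \<in> S" "- 1 \<in> S"
  shows "(\<lambda>x. resid (u x) (v x) i) \<in> polyfuns D S"
  unfolding resid_def
  by (intro lc_polyfuns polyfuns_F polyfuns_uminus polyfuns_A assms)

lemma polyfuns_tangent_vec:
  assumes "\<And>i. i \<le> N \<Longrightarrow> (\<lambda>x. u x i) \<in> polyfuns D S"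
    "\<And>i. i \<le> N \<Longrightarrow> (\<lambda>x. w x i) \<in> polyfuns D S" "\<And>i. i \<le> N \<Longrightarrow> (\<lambda>x. w' x i) \<in> polyfuns D S"
    and S: "cf ` E \<subseteq> S" "0 \<in> S" "- 1 \<in> S" and i: "i \<le> N"
  shows "(\<lambda>x. tangent_vec (u x) (w x) (w' x) i) \<in> polyfuns D S"
  unfolding tangent_vec_def
  by (intro lc_polyfuns polyfuns_uminus polyfuns_A assms(1,2,3) S i)

lemma polyfuns_gen:
  assumes s: "\<And>i. i \<le> N \<Longrightarrow> (\<lambda>x. s x i) \<in> polyfuns D S"
    and t: "\<And>k i. k < 2 * j \<Longrightarrow> i \<le> N \<Longrightarrow> (\<lambda>x. block k (t x) i) \<in> polyfuns D S"
    and S: "cf ` E \<subseteq> S" "0 \<in> S" "- 1 \<in> S" and i: "i \<le> N"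
  shows "(\<lambda>x. gen j (s x) (t x) i) \<in> polyfuns D S"
  using t i
proof (induction j arbitrary: i)
  case 0
  then show ?case using s by simp
next
  case (Suc j)
  have IH: "(\<lambda>x. gen j (s x) (t x) i) \<in> polyfuns D S" if "i \<le> N" for i
    using Suc that by simp
  have b: "(\<lambda>x. block (2 * j) (t x) i) \<in> polyfuns D S" "(\<lambda>x. block (Suc (2 * j)) (t x) i) \<in> polyfuns D S"
    if "i \<le> N" for i using Suc.prems(1) that by simp_all
  show ?case unfolding gen.simps
    using Suc.prems(2) by (intro polyfuns_resid polyfuns_tangent_vec IH b S)
qed

text \<open>For a parameter point \<open>a\<close>, the line through \<open>p\<close> in direction \<open>a\<close> meets the cubic in two further points,
  conjugate over the field of parameters. The stages started at these two points have conjugate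
  parametrisations, so the third point of the line through two conjugate points is rational.\<close>

theorem dense_parametrisation:
  assumes p: "F p = 0" "nz p" and S: "cf ` E \<subseteq> S" "0 \<in> S" "1 \<in> S" "- 1 \<in> S" "\<And>i. i \<le> N \<Longrightarrow> p i \<in> S"
  obtains m and z :: "(nat \<Rightarrow> 'a) \<Rightarrow> nat \<Rightarrow> 'a" where "\<And>i. (\<lambda>\<tau>. z \<tau> i) \<in> polyfuns ((\<lambda>n \<tau>. \<tau> n) ` {..<m}) S"
    "\<And>\<tau>. F (z \<tau>) = 0" "\<And>\<tau> i. i > N \<Longrightarrow> z \<tau> i = 0"
    "\<forall>d G x. homog d G \<longrightarrow> (\<forall>x y. (\<forall>i\<le>N. x i = y i) \<longrightarrow> G x = G y) \<longrightarrow>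
      (\<forall>\<tau>. G (z \<tau>) = 0) \<longrightarrow> F x = 0 \<longrightarrow> G x = 0"
proof -
  \<comment> \<open>Block 0 is the direction of the line. Blocks 1 and 2 are the components, with
    respect to 1 and \<theta>, of the parameter vector of the iteration, whose three steps read six
    blocks.\<close>
  define M where "M = prod_encode ` ({0} \<times> {..N}) \<union> prod_encode ` ({1, 2} \<times> prod_encode ` ({..<6} \<times> {..N}))"
  have "finite M" unfolding M_def by simp
  then obtain m where m: "\<And>n. n \<in> M \<Longrightarrow> n < m" by (auto simp: finite_nat_set_iff_bounded)
  define C :: "((nat \<Rightarrow> 'a) \<Rightarrow> 'a) set" where "C = (\<lambda>n \<tau>. \<tau> n) ` {..<m}"
  define C2 where "C2 = (\<lambda>g (q :: (nat \<Rightarrow> 'a) \<times> 'a). g (fst q)) ` C \<union> {snd}"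
  have coordC: "(\<lambda>\<tau>. \<tau> n) \<in> polyfuns C S" if "n \<in> M" for n
    using m[OF that] unfolding C_def by (intro polyfuns.coord) blast
  have coord2: "(\<lambda>q. fst q n) \<in> polyfuns C2 S" if "n \<in> M" for n
    using m[OF that] unfolding C2_def C_def by (intro polyfuns.coord) auto
  have coord_th: "(\<lambda>q. snd q) \<in> polyfuns C2 S" unfolding C2_def by (intro polyfuns.coord) auto
  define a where "a \<tau> = block 0 \<tau>" for \<tau> :: "nat \<Rightarrow> 'a"
  define om where "om \<tau> \<theta> = lc 1 (block 1 \<tau>) \<theta> (block 2 \<tau>)" for \<tau> :: "nat \<Rightarrow> 'a" and \<theta>
  define s where "s \<tau> \<theta> = lc (F (a \<tau>)) p \<theta> (a \<tau>)" for \<tau> \<theta>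
  \<comment> \<open>\<open>F (s \<tau> \<theta>)\<close> is \<open>F (a \<tau>) * \<theta>\<close>
    times \<open>\<theta>^2 + Q \<tau> * \<theta> + R \<tau>\<close>, the equation of the two points
    on the line other than \<open>p\<close>.\<close>
  define Q where "Q \<tau> = A (a \<tau>) p" for \<tau>
  define R where "R \<tau> = A p (a \<tau>) * F (a \<tau>)" for \<tau>
  define u where "u \<tau> \<theta> = gen 3 (s \<tau> \<theta>) (om \<tau> \<theta>)" for \<tau> \<theta>
  have aC: "(\<lambda>\<tau>. a \<tau> i) \<in> polyfuns C S" "(\<lambda>q. a (fst q) i) \<in> polyfuns C2 S" if "i \<le> N" for i
    unfolding a_def block_def using that by (auto intro!: coordC coord2 simp: M_def)
  have pC: "(\<lambda>_. p i) \<in> polyfuns D S" if "i \<le> N" for i and D :: "('d \<Rightarrow> 'a) set"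
    using S(5)[OF that] by (rule polyfuns.const)
  have Q_C: "Q \<in> polyfuns C S" unfolding Q_def by (intro polyfuns_A aC pC S)
  have R_C: "R \<in> polyfuns C S" unfolding R_def by (intro polyfuns.mult polyfuns_A polyfuns_F aC pC S)
  have u_C2: "(\<lambda>q. u (fst q) (snd q) i) \<in> polyfuns C2 S" if i: "i \<le> N" for i
    unfolding u_def
  proof (rule polyfuns_gen[OF _ _ S(1,2,4) i])
    fix i assume i: "i \<le> N"
    show "(\<lambda>q. s (fst q) (snd q) i) \<in> polyfuns C2 S"
      unfolding s_def using i by (intro lc_polyfuns polyfuns_F aC pC coord_th S)
    fix k :: nat assume k: "k < 2 * 3"
    have "prod_encode (1, prod_encode (k, i)) \<in> M" "prod_encode (2, prod_encode (k, i)) \<in> M"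
      using k i unfolding M_def by auto
    then show "(\<lambda>q. block k (om (fst q) (snd q)) i) \<in> polyfuns C2 S"
      unfolding om_def block_def lc_def
      by (intro polyfuns.add polyfuns.mult polyfuns.const coord2 coord_th S)
  qed
  have "\<forall>i\<in>{..N}. \<exists>\<alpha>. \<exists>\<beta>. \<alpha> \<in> polyfuns C S \<and> \<beta> \<in> polyfuns C S \<and>
      (\<forall>\<tau> \<theta>. \<theta>^2 + Q \<tau> * \<theta> + R \<tau> = 0 \<longrightarrow> u \<tau> \<theta> i = \<alpha> \<tau> + \<theta> * \<beta> \<tau>)"
  proof
    fix i assume "i \<in> {..N}"
    then have "(\<lambda>q. u (fst q) (snd q) i) \<in> polyfuns C2 S" using u_C2 by simp
    from weil_restriction[OF this[unfolded C2_def] Q_C R_C S(2,3,4)]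
    show "\<exists>\<alpha>. \<exists>\<beta>. \<alpha> \<in> polyfuns C S \<and> \<beta> \<in> polyfuns C S \<and>
      (\<forall>\<tau> \<theta>. \<theta>^2 + Q \<tau> * \<theta> + R \<tau> = 0 \<longrightarrow> u \<tau> \<theta> i = \<alpha> \<tau> + \<theta> * \<beta> \<tau>)" by auto
  qed
  then obtain \<alpha> \<beta> where ab: "\<And>i. i \<le> N \<Longrightarrow> \<alpha> i \<in> polyfuns C S" "\<And>i. i \<le> N \<Longrightarrow> \<beta> i \<in> polyfuns C S"
    "\<And>i \<tau> \<theta>. i \<le> N \<Longrightarrow> \<theta>^2 + Q \<tau> * \<theta> + R \<tau> = 0 \<Longrightarrow> u \<tau> \<theta> i = \<alpha> i \<tau> + \<theta> * \<beta> i \<tau>"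
    by (metis atMost_iff)
  define x y where "x \<tau> = (\<lambda>i. if i \<le> N then \<alpha> i \<tau> else 0)" and "y \<tau> = (\<lambda>i. if i \<le> N then \<beta> i \<tau> else 0)" for \<tau>
  define z where "z \<tau> = lc (F (y \<tau>)) (x \<tau>) (F (y \<tau>) * Q \<tau> - A (y \<tau>) (x \<tau>)) (y \<tau>)" for \<tau>
  have xyC: "(\<lambda>\<tau>. x \<tau> i) \<in> polyfuns C S" "(\<lambda>\<tau>. y \<tau> i) \<in> polyfuns C S" for i
    unfolding x_def y_def using ab S by (cases "i \<le> N"; simp add: polyfuns.const)+
  have zC: "(\<lambda>\<tau>. z \<tau> i) \<in> polyfuns C S" for i
    unfolding z_def by (intro lc_polyfuns polyfuns_diff polyfuns.mult polyfuns_F polyfuns_A xyC Q_C S)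
  have z_out: "z \<tau> i = 0" if "i > N" for \<tau> i using that by (simp add: z_def lc_def x_def y_def)
  have sX: "F (s \<tau> \<theta>) = 0" if "\<theta>^2 + Q \<tau> * \<theta> + R \<tau> = 0" for \<tau> \<theta>
  proof -
    have "F (s \<tau> \<theta>) = F (a \<tau>) * \<theta> * (\<theta>^2 + Q \<tau> * \<theta> + R \<tau>)"
      using p(1) by (simp add: s_def F_lc Q_def R_def algebra_simps power2_eq_square power3_eq_cube)
    then show ?thesis using that by simp
  qed
  have uxy: "lc 1 (x \<tau>) \<theta> (y \<tau>) i = u \<tau> \<theta> i" if "\<theta>^2 + Q \<tau> * \<theta> + R \<tau> = 0" "i \<le> N" for \<tau> \<theta> i
    using ab(3)[OF that(2,1)] that(2) by (simp add: lc_def x_def y_def)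
  have z_third: "third (lc 1 (x \<tau>) \<theta>1 (y \<tau>)) (lc 1 (x \<tau>) \<theta>2 (y \<tau>)) = (\<lambda>i. (\<theta>1 - \<theta>2)^3 * z \<tau> i)"
    and xyX: "F (lc 1 (x \<tau>) \<theta>1 (y \<tau>)) = 0" "F (lc 1 (x \<tau>) \<theta>2 (y \<tau>)) = 0"
    if th: "\<theta>1 \<noteq> \<theta>2" "\<theta>1 + \<theta>2 = - Q \<tau>" "\<theta>1 * \<theta>2 = R \<tau>" for \<tau> \<theta>1 \<theta>2
  proof -
    have Q: "Q \<tau> = - (\<theta>1 + \<theta>2)" using th(2) by simp
    have r: "\<theta>1^2 + Q \<tau> * \<theta>1 + R \<tau> = 0" "\<theta>2^2 + Q \<tau> * \<theta>2 + R \<tau> = 0"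
      unfolding Q th(3)[symmetric] by (simp_all add: algebra_simps power2_eq_square)
    have "F (lc 1 (x \<tau>) \<theta> (y \<tau>)) = 0" if "\<theta>^2 + Q \<tau> * \<theta> + R \<tau> = 0" for \<theta>
      using F_cong[OF uxy[OF that]] gen_X[OF sX[OF that], of 3 "om \<tau> \<theta>"] by (simp add: u_def)
    then show X: "F (lc 1 (x \<tau>) \<theta>1 (y \<tau>)) = 0" "F (lc 1 (x \<tau>) \<theta>2 (y \<tau>)) = 0" using r by blast+
    show "third (lc 1 (x \<tau>) \<theta>1 (y \<tau>)) (lc 1 (x \<tau>) \<theta>2 (y \<tau>)) = (\<lambda>i. (\<theta>1 - \<theta>2)^3 * z \<tau> i)"
      unfolding third_conjugate[OF X th(1)] z_def Q ..
  qed
  obtain a0 \<theta>1 \<theta>2 t0 where gl: "\<theta>1 \<noteq> \<theta>2" "\<theta>1 + \<theta>2 = - A a0 p" "\<theta>1 * \<theta>2 = A p a0 * F a0"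
    "noncone (gen 2 (lc (F a0) p \<theta>1 a0) t0)" "noncone (gen 2 (lc (F a0) p \<theta>2 a0) t0)"
    by (rule good_line[OF p])
  define par where "par w0 w1 = (\<lambda>n. case prod_decode n of (k, i) \<Rightarrow> if k = 0 then a0 i else if k = 1 then w0 i else w1 i)"
    for w0 w1 :: "nat \<Rightarrow> 'a"
  have par: "a (par w0 w1) = a0" "block 1 (par w0 w1) = w0" "block 2 (par w0 w1) = w1" for w0 w1
    by (auto simp: a_def block_def par_def)
  have QR: "Q (par w0 w1) = A a0 p" "R (par w0 w1) = A p a0 * F a0" for w0 w1 by (simp_all add: Q_def R_def par)
  \<comment> \<open>An identity between polynomials in \<tau>, so it may be checked where the
    discriminant is nonzero. The line from \<open>good_line\<close> shows that the discriminant is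
    not identically zero, in characteristic two as well.\<close>
  have zX: "F (z \<tau>) = 0" for \<tau>
  proof (rule ccontr)
    assume Fz: "F (z \<tau>) \<noteq> 0"
    have sub: "f \<in> PV" if "f \<in> polyfuns C S" for f
      by (rule polyfuns_mono[OF that]) (auto simp: C_def)
    have PVs: "(\<lambda>\<tau>. F (z \<tau>)) \<in> PV" "(\<lambda>\<tau>. (Q \<tau>)^2 - 4 * R \<tau>) \<in> PV"
      by (intro cubic_intros sub[OF zC] sub[OF Q_C] sub[OF R_C])+
    have "(Q (par a0 a0))^2 - 4 * R (par a0 a0) = (\<theta>1 - \<theta>2)^2"
    proof -
      have e: "Q (par a0 a0) = - (\<theta>1 + \<theta>2)" "R (par a0 a0) = \<theta>1 * \<theta>2" using gl by (simp_all add: QR)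
      show ?thesis unfolding e by (simp add: algebra_simps power2_eq_square)
    qed
    then have "(Q (par a0 a0))^2 - 4 * R (par a0 a0) \<noteq> 0" using gl(1) by simp
    then obtain \<sigma> where \<sigma>: "F (z \<sigma>) \<noteq> 0" "(Q \<sigma>)^2 - 4 * R \<sigma> \<noteq> 0"
      by (rule PV_common_nonzero[OF PVs Fz])
    obtain \<theta> where \<theta>: "R \<sigma> + \<theta> * Q \<sigma> + \<theta>^2 * 1 = 0" using quadratic_root[of 1 "R \<sigma>" "Q \<sigma>"] by auto
    define \<theta>' where "\<theta>' = - Q \<sigma> - \<theta>"
    have R: "R \<sigma> = \<theta> * \<theta>'" using \<theta> by (simp add: \<theta>'_def algebra_simps power2_eq_square eq_neg_iff_add_eq_0)
    have "\<theta> \<noteq> \<theta>'"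
    proof
      assume eq: "\<theta> = \<theta>'"
      have e: "Q \<sigma> = - (\<theta> + \<theta>')" by (simp add: \<theta>'_def)
      show False using \<sigma>(2) unfolding e R eq[symmetric] by (simp add: power2_eq_square algebra_simps)
    qed
    moreover have "\<theta> + \<theta>' = - Q \<sigma>" by (simp add: \<theta>'_def)
    ultimately have tc: "third (lc 1 (x \<sigma>) \<theta> (y \<sigma>)) (lc 1 (x \<sigma>) \<theta>' (y \<sigma>)) = (\<lambda>i. (\<theta> - \<theta>')^3 * z \<sigma> i)"
      and tX: "F (lc 1 (x \<sigma>) \<theta> (y \<sigma>)) = 0" "F (lc 1 (x \<sigma>) \<theta>' (y \<sigma>)) = 0"
      using z_third[of \<theta> \<theta>' \<sigma>] xyX[of \<theta> \<theta>' \<sigma>] R by simp_all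
    have "F (\<lambda>i. (\<theta> - \<theta>')^3 * z \<sigma> i) = 0" using third_X(1)[OF tX] unfolding tc .
    then show False using \<sigma>(1) \<open>\<theta> \<noteq> \<theta>'\<close> unfolding F_scale by simp
  qed
  have dense: "G v = 0" if G: "homog d G" and loc: "\<And>x y. (\<And>i. i \<le> N \<Longrightarrow> x i = y i) \<Longrightarrow> G x = G y"
      and van: "\<And>\<tau>. G (z \<tau>) = 0" and v: "F v = 0" for d G v
  proof -
    define s1 s2 where "s1 = lc (F a0) p \<theta>1 a0" and "s2 = lc (F a0) p \<theta>2 a0"
    have r: "\<theta>1^2 + A a0 p * \<theta>1 + A p a0 * F a0 = 0" "\<theta>2^2 + A a0 p * \<theta>2 + A p a0 * F a0 = 0"
    proof -
      have e: "A a0 p = - (\<theta>1 + \<theta>2)" using gl(2) by simp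
      show "\<theta>1^2 + A a0 p * \<theta>1 + A p a0 * F a0 = 0" "\<theta>2^2 + A a0 p * \<theta>2 + A p a0 * F a0 = 0"
        unfolding e gl(3)[symmetric] by (simp_all add: algebra_simps power2_eq_square)
    qed
    have sF: "F s1 = 0" "F s2 = 0"
      using sX[of \<theta>1 "par a0 a0"] sX[of \<theta>2 "par a0 a0"] r by (simp_all add: s_def par QR s1_def s2_def)
    have 1: "G (third (gen 3 s1 w1) (gen 3 s2 w2)) = 0" for w1 w2
    proof -
      \<comment> \<open>As \<theta>1 and \<theta>2 differ, \<open>d0\<close> and \<open>d1\<close>
        can be solved for given values \<open>w1\<close> and \<open>w2\<close>. Over the closure the
        two conjugate parameter vectors are therefore independent.\<close>
      define d1 where "d1 = (\<lambda>i. (w1 i - w2 i) / (\<theta>1 - \<theta>2))"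
      define d0 where "d0 = (\<lambda>i. w1 i - \<theta>1 * d1 i)"
      define \<tau> where "\<tau> = par d0 d1"
      have w: "lc 1 d0 \<theta>1 d1 = w1" "lc 1 d0 \<theta>2 d1 = w2"
      proof -
        show "lc 1 d0 \<theta>1 d1 = w1" by (auto simp: lc_def d0_def)
        have "(\<theta>1 - \<theta>2) * d1 i = w1 i - w2 i" for i using gl(1) by (simp add: d1_def)
        then have "\<theta>2 * d1 i = \<theta>1 * d1 i - (w1 i - w2 i)" for i by (simp add: algebra_simps)
        then show "lc 1 d0 \<theta>2 d1 = w2" by (auto simp: lc_def d0_def)
      qed
      have u12: "u \<tau> \<theta>1 = gen 3 s1 w1" "u \<tau> \<theta>2 = gen 3 s2 w2"
        unfolding u_def s_def om_def \<tau>_def par w s1_def s2_def by simp_all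
      have "third (gen 3 s1 w1) (gen 3 s2 w2) i = (\<theta>1 - \<theta>2)^3 * z \<tau> i" if "i \<le> N" for i
      proof -
        have e: "lc 1 (x \<tau>) \<theta>1 (y \<tau>) i = gen 3 s1 w1 i" "lc 1 (x \<tau>) \<theta>2 (y \<tau>) i = gen 3 s2 w2 i" if "i \<le> N" for i
          using uxy[of \<theta>1 \<tau> i] uxy[of \<theta>2 \<tau> i] r that unfolding u12 by (simp_all add: \<tau>_def QR)
        have A12: "A (lc 1 (x \<tau>) \<theta>1 (y \<tau>)) (lc 1 (x \<tau>) \<theta>2 (y \<tau>)) = A (gen 3 s1 w1) (gen 3 s2 w2)"
          "A (lc 1 (x \<tau>) \<theta>2 (y \<tau>)) (lc 1 (x \<tau>) \<theta>1 (y \<tau>)) = A (gen 3 s2 w2) (gen 3 s1 w1)"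
          by (intro A_cong e; assumption)+
        have "third (lc 1 (x \<tau>) \<theta>1 (y \<tau>)) (lc 1 (x \<tau>) \<theta>2 (y \<tau>)) i = third (gen 3 s1 w1) (gen 3 s2 w2) i"
          unfolding third_def A12 using e[OF that] by (simp add: lc_def[of "A _ _"])
        moreover have "third (lc 1 (x \<tau>) \<theta>1 (y \<tau>)) (lc 1 (x \<tau>) \<theta>2 (y \<tau>)) = (\<lambda>i. (\<theta>1 - \<theta>2)^3 * z \<tau> i)"
          by (rule z_third) (use gl in \<open>simp_all add: \<tau>_def QR\<close>)
        ultimately show ?thesis by simp
      qed
      then have "G (third (gen 3 s1 w1) (gen 3 s2 w2)) = G (\<lambda>i. (\<theta>1 - \<theta>2)^3 * z \<tau> i)" by (intro loc)
      then show ?thesis using van by (simp add: homog_scale[OF G])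
    qed
    have 2: "G (third b (gen 3 s2 w2)) = 0" if "F b = 0" for b w2
      by (rule gen_dense[OF sF(1) _ homog_third(1)[OF G] 1 that]) (use gl in \<open>simp add: s1_def\<close>)
    have 3: "G (third b c) = 0" if "F b = 0" "F c = 0" for b c
      by (rule gen_dense[OF sF(2) _ homog_third(2)[OF G] 2[OF that(1)] that(2)]) (use gl in \<open>simp add: s2_def\<close>)
    \<comment> \<open>Up to a scalar, \<open>c\<close> is the third point of \<open>b\<close> and
      \<open>third b c\<close>. A suitable \<open>b\<close> exists because \<open>c\<close> is not
      on all tangent hyperplanes.\<close>
    have 4: "G c = 0" if c: "F c = 0" "nz c" for c
    proof -
      obtain b where b: "F b = 0" "A b c \<noteq> 0" using not_strange[OF c] by blast
      have "G (third b (third b c)) = 0" by (rule 3[OF b(1) third_X(1)[OF b(1) c(1)]])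
      then have "(- ((A b c)^3)) ^ d * G c = 0" unfolding third_X(4)[OF b(1) c(1)] homog_scale[OF G] .
      then show ?thesis using b(2) by simp
    qed
    show "G v = 0"
    proof (cases "nz v")
      case False
      then have "G v = G (\<lambda>i. 0 * p i)" by (intro loc) (auto simp: nz_def)
      then show ?thesis using 4[OF p] unfolding homog_scale[OF G] by simp
    qed (use 4 v in blast)
  qed
  show thesis
  proof (rule that[OF zC[unfolded C_def] zX])
    show "z \<tau> i = 0" if "i > N" for \<tau> i using z_out that .
    show "\<forall>d G x. homog d G \<longrightarrow> (\<forall>x y. (\<forall>i\<le>N. x i = y i) \<longrightarrow> G x = G y) \<longrightarrow>
      (\<forall>\<tau>. G (z \<tau>) = 0) \<longrightarrow> F x = 0 \<longrightarrow> G x = 0"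
    proof (intro allI impI)
      fix d G x
      assume G: "homog d G" and loc: "\<forall>x y. (\<forall>i\<le>N. x i = y i) \<longrightarrow> G x = G y"
        and van: "\<forall>\<tau>. G (z \<tau>) = 0" and x: "F x = 0"
      have "G x = G y" if "\<And>i. i \<le> N \<Longrightarrow> x i = y i" for x y
        by (rule loc[rule_format]) (rule that)
      then show "G x = 0" by (rule dense[OF G _ van[rule_format] x])
    qed
  qed
qed

end

section \<open>Rational maps and rational points\<close>

lemma lookup_mp_ac [simp]: "Poly_Mapping.lookup (mp_ac p) e = to_ac (Poly_Mapping.lookup p e)"
  by (simp add: mp_ac_def Poly_Mapping.map.rep_eq when_def)

lemma keys_mp_ac [simp]: "Poly_Mapping.keys (mp_ac p) = Poly_Mapping.keys p"
  by (auto simp: in_keys_iff)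

lemma mp_ac_single: "mp_ac (Poly_Mapping.single e c) = Poly_Mapping.single e (to_ac c)"
  by (rule poly_mapping_eqI) (simp add: lookup_single when_def)

lemma mp_ac_0 [simp]: "mp_ac 0 = 0"
  by (rule poly_mapping_eqI) simp

lemma mp_ac_add: "mp_ac (p + q) = mp_ac p + mp_ac q"
  by (rule poly_mapping_eqI) (simp add: lookup_add)

lemma mp_ac_sum: "mp_ac (\<Sum>i\<in>I. f i) = (\<Sum>i\<in>I. mp_ac (f i))"
  by (induction I rule: infinite_finite_induct) (simp_all add: mp_ac_add)

lemma mp_ac_mult: "mp_ac (p * q) = mp_ac p * mp_ac q"
proof -
  let ?s = "\<lambda>p e. Poly_Mapping.single e (Poly_Mapping.lookup p e)"
  have "p * q = (\<Sum>e\<in>Poly_Mapping.keys p. ?s p e) * (\<Sum>e\<in>Poly_Mapping.keys q. ?s q e)"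
    by (rule arg_cong2[where f = "(*)", OF mpoly_sum_single mpoly_sum_single])
  then have "mp_ac (p * q) = (\<Sum>e\<in>Poly_Mapping.keys p. \<Sum>e'\<in>Poly_Mapping.keys q. ?s (mp_ac p) e * ?s (mp_ac q) e')"
    by (simp add: sum_product mult_single mp_ac_sum mp_ac_single)
  also have "\<dots> = (\<Sum>e\<in>Poly_Mapping.keys (mp_ac p). ?s (mp_ac p) e) * (\<Sum>e\<in>Poly_Mapping.keys (mp_ac q). ?s (mp_ac q) e)"
    by (simp add: sum_product)
  also have "\<dots> = mp_ac p * mp_ac q"
    by (rule arg_cong2[where f = "(*)", OF mpoly_sum_single[symmetric] mpoly_sum_single[symmetric]])
  finally show ?thesis .
qed

lemma mp_eval_ac: "mp_eval (mp_ac p) x = (\<Sum>e\<in>Poly_Mapping.keys p. to_ac (Poly_Mapping.lookup p e) * mp_monom e x)"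
  by (simp add: mp_eval_def mp_monom_def)

lemma mp_eval_ac_to_ac: "mp_eval (mp_ac p) (\<lambda>i. to_ac (x i)) = to_ac (mp_eval p x)"
  by (simp add: mp_eval_ac mp_eval_def mp_monom_def to_ac_sum to_ac_prod)

lemma mp_in_add: "mp_in V p \<Longrightarrow> mp_in V q \<Longrightarrow> mp_in V (p + q)"
  unfolding mp_in_def using Poly_Mapping.keys_add[of p q] by blast

lemma mp_in_mult:
  assumes "mp_in V p" "mp_in V (q :: 'a::semiring_0 mpoly)" shows "mp_in V (p * q)"
  unfolding mp_in_def
proof
  fix e assume "e \<in> Poly_Mapping.keys (p * q)"
  then obtain a b where "a \<in> Poly_Mapping.keys p" "b \<in> Poly_Mapping.keys q" "e = a + b"
    using Poly_Mapping.keys_mult[of p q] by blast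
  then show "Poly_Mapping.keys e \<subseteq> V"
    using assms Poly_Mapping.keys_add[of a b] unfolding mp_in_def by blast
qed

lemma polyfuns_mpoly:
  assumes "f \<in> polyfuns ((\<lambda>n \<tau>. \<tau> n) ` {..<m}) (range to_ac)"
  shows "\<exists>q. mp_in {..<m} q \<and> (\<forall>\<tau>. f \<tau> = mp_eval (mp_ac q) \<tau>)"
  using assms
proof induction
  case (const c)
  then obtain b where "c = to_ac b" by blast
  moreover have "mp_in {..<m} (mp_const b)" by (simp add: mp_in_def mp_const_def)
  ultimately show ?case
    by (intro exI[of _ "mp_const b"]) (simp add: mp_const_def mp_ac_single mp_monom_def)
next
  case (coord f)
  then obtain n where "n < m" "f = (\<lambda>\<tau>. \<tau> n)" by blast
  then show ?case
    by (intro exI[of _ "mp_var n"]) (simp add: mp_var_def mp_in_def mp_ac_single mp_monom_def)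
next
  case (add f g)
  then obtain p q where "mp_in {..<m} p" "\<forall>\<tau>. f \<tau> = mp_eval (mp_ac p) \<tau>" "mp_in {..<m} q" "\<forall>\<tau>. g \<tau> = mp_eval (mp_ac q) \<tau>" by blast
  then show ?case by (intro exI[of _ "p + q"]) (simp add: mp_in_add mp_ac_add mp_eval_add)
next
  case (mult f g)
  then obtain p q where "mp_in {..<m} p" "\<forall>\<tau>. f \<tau> = mp_eval (mp_ac p) \<tau>" "mp_in {..<m} q" "\<forall>\<tau>. g \<tau> = mp_eval (mp_ac q) \<tau>" by blast
  then show ?case by (intro exI[of _ "p * q"]) (simp add: mp_in_mult mp_ac_mult mp_eval_mult)
qed

lemma mp_eval_PV: "mp_eval p \<in> PV"
  unfolding mp_eval_def[abs_def] by (intro polyfuns_intros)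

lemma mp_eval_scale:
  assumes "mp_homogeneous d p" shows "mp_eval p (\<lambda>i. c * x i) = c ^ d * mp_eval p x"
proof -
  have "mp_monom e (\<lambda>i. c * x i) = c ^ d * mp_monom e x" if "e \<in> Poly_Mapping.keys p" for e
  proof -
    have "(\<Sum>i\<in>Poly_Mapping.keys e. Poly_Mapping.lookup e i) = d"
      using assms that by (simp add: mp_homogeneous_def)
    then show ?thesis
      by (simp add: mp_monom_def power_mult_distrib prod.distrib power_sum[symmetric])
  qed
  then show ?thesis
    by (simp add: mp_eval_def mp_monom_def sum_distrib_left mult.left_commute)
qed

lemma mp_eval_cong:
  assumes "mp_in V p" "\<And>i. i \<in> V \<Longrightarrow> x i = y i" shows "mp_eval p x = mp_eval p y"
  unfolding mp_eval_def
  by (intro sum.cong refl arg_cong2[where f = "(*)"] prod.cong arg_cong2[where f = "(^)"] assms(2))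
    (use assms(1) in \<open>auto simp: mp_in_def\<close>)

lemma exponent_split:
  fixes e :: "nat \<Rightarrow>\<^sub>0 nat"
  assumes "(\<Sum>i\<in>Poly_Mapping.keys e. Poly_Mapping.lookup e i) = Suc d"
  shows "\<exists>a e'. e = Poly_Mapping.single a 1 + e' \<and> a \<in> Poly_Mapping.keys e \<and>
    Poly_Mapping.keys e' \<subseteq> Poly_Mapping.keys e \<and> (\<Sum>i\<in>Poly_Mapping.keys e'. Poly_Mapping.lookup e' i) = d"
proof -
  have "Poly_Mapping.keys e \<noteq> {}" using assms by (metis sum.empty nat.distinct(1))
  then obtain a where a: "a \<in> Poly_Mapping.keys e" by blast
  define e' where "e' = e - Poly_Mapping.single a 1"
  have e: "e = Poly_Mapping.single a 1 + e'"
    by (rule poly_mapping_eqI)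
      (use a in \<open>auto simp: e'_def lookup_add lookup_minus lookup_single when_def in_keys_iff\<close>)
  have keys: "Poly_Mapping.keys e' \<subseteq> Poly_Mapping.keys e"
    by (auto simp: e'_def in_keys_iff lookup_minus)
  have "Suc d = (\<Sum>i\<in>Poly_Mapping.keys e. (if i = a then 1 else 0) + Poly_Mapping.lookup e' i)"
    unfolding assms[symmetric]
    by (intro sum.cong refl, subst e) (auto simp: lookup_add lookup_single when_def)
  also have "\<dots> = Suc (\<Sum>i\<in>Poly_Mapping.keys e. Poly_Mapping.lookup e' i)"
    using a by (simp add: sum.distrib)
  also have "(\<Sum>i\<in>Poly_Mapping.keys e. Poly_Mapping.lookup e' i) = (\<Sum>i\<in>Poly_Mapping.keys e'. Poly_Mapping.lookup e' i)"
    by (rule sum.mono_neutral_right) (use keys in \<open>auto simp: in_keys_iff\<close>)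
  finally have "(\<Sum>i\<in>Poly_Mapping.keys e'. Poly_Mapping.lookup e' i) = d" by simp
  then show ?thesis using e keys a by blast
qed

lemma cubic_exponent:
  fixes e :: "nat \<Rightarrow>\<^sub>0 nat"
  assumes "(\<Sum>i\<in>Poly_Mapping.keys e. Poly_Mapping.lookup e i) = 3"
  shows "\<exists>a b c. e = Poly_Mapping.single a 1 + (Poly_Mapping.single b 1 + Poly_Mapping.single c 1) \<and>
    {a, b, c} \<subseteq> Poly_Mapping.keys e"
proof -
  obtain a e1 where 1: "e = Poly_Mapping.single a 1 + e1" "a \<in> Poly_Mapping.keys e"
    "Poly_Mapping.keys e1 \<subseteq> Poly_Mapping.keys e" "(\<Sum>i\<in>Poly_Mapping.keys e1. Poly_Mapping.lookup e1 i) = 2"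
    using exponent_split[of e 2] assms by auto
  obtain b e2 where 2: "e1 = Poly_Mapping.single b 1 + e2" "b \<in> Poly_Mapping.keys e1"
    "Poly_Mapping.keys e2 \<subseteq> Poly_Mapping.keys e1" "(\<Sum>i\<in>Poly_Mapping.keys e2. Poly_Mapping.lookup e2 i) = 1"
    using exponent_split[of e1 1] 1(4) by auto
  obtain c e3 where 3: "e2 = Poly_Mapping.single c 1 + e3" "c \<in> Poly_Mapping.keys e2"
    "(\<Sum>i\<in>Poly_Mapping.keys e3. Poly_Mapping.lookup e3 i) = 0"
    using exponent_split[of e2 0] 2(4) by auto
  have "e3 = 0" by (rule poly_mapping_eqI) (use 3(3) in \<open>auto simp: in_keys_iff\<close>)
  then show ?thesis using 1 2 3 by (intro exI[of _ a] exI[of _ b] exI[of _ c]) auto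
qed

lemma mp_monom_single [simp]: "mp_monom (Poly_Mapping.single a 1) x = x a"
  by (simp add: mp_monom_def)

definition dmonom :: "nat \<Rightarrow> (nat \<Rightarrow>\<^sub>0 nat) \<Rightarrow> (nat \<Rightarrow> 'a::comm_semiring_1) \<Rightarrow> 'a" where
  "dmonom l e x = of_nat (Poly_Mapping.lookup e l) * mp_monom (e - Poly_Mapping.single l 1) x"

lemma dmonom_single: "dmonom l (Poly_Mapping.single a 1) x = (if a = l then 1 else 0)"
  by (simp add: dmonom_def lookup_single when_def) (simp add: mp_monom_def)

lemma dmonom_add: "dmonom l (e + e') x = dmonom l e x * mp_monom e' x + mp_monom e x * dmonom l e' x"
proof -
  let ?s = "Poly_Mapping.single l (1::nat)"
  have D: "of_nat (Poly_Mapping.lookup a l) * mp_monom (a + b - ?s) x = dmonom l a x * mp_monom b x" for a b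
  proof (cases "Poly_Mapping.lookup a l = 0")
    case False
    then have "a + b - ?s = (a - ?s) + b"
      by (intro poly_mapping_eqI) (auto simp: lookup_add lookup_minus lookup_single when_def)
    then show ?thesis by (simp add: dmonom_def mp_monom_add mult.assoc)
  qed (simp add: dmonom_def)
  show ?thesis
    using D[of e e'] D[of e' e]
    by (simp add: dmonom_def[of l "e + e'"] lookup_add distrib_right add.commute[of e' e] mult.commute)
qed

lemma mp_eval_pderiv: "mp_eval (mp_ac (mp_pderiv l p)) x =
    (\<Sum>e\<in>Poly_Mapping.keys p. to_ac (Poly_Mapping.lookup p e) * dmonom l e x)"
  by (simp add: mp_pderiv_def mp_ac_sum mp_eval_sum mp_ac_single dmonom_def mult_ac)


lemma digits_inj:
  fixes B :: nat
  assumes "\<And>j. j < m \<Longrightarrow> a j < B" "\<And>j. j < m \<Longrightarrow> b j < B" "(\<Sum>j<m. a j * B ^ j) = (\<Sum>j<m. b j * B ^ j)"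
  shows "\<forall>j<m. a j = b j"
  using assms
proof (induction m arbitrary: a b)
  case (Suc m)
  have e: "(\<Sum>j<Suc m. c j * B ^ j) = c 0 + B * (\<Sum>j<m. c (Suc j) * B ^ j)" for c :: "nat \<Rightarrow> nat"
    by (subst sum.lessThan_Suc_shift) (simp add: sum_distrib_left mult_ac)
  have dm: "(x + B * y) mod B = x" "(x + B * y) div B = y" if "x < B" for x y using that by simp_all
  have lt: "a 0 < B" "b 0 < B" using Suc.prems(1,2) by auto
  have eq: "a 0 + B * (\<Sum>j<m. a (Suc j) * B ^ j) = b 0 + B * (\<Sum>j<m. b (Suc j) * B ^ j)"
    using Suc.prems(3) unfolding e .
  have 0: "a 0 = b 0" and sum: "(\<Sum>j<m. a (Suc j) * B ^ j) = (\<Sum>j<m. b (Suc j) * B ^ j)"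
    using arg_cong[OF eq, of "\<lambda>z. z mod B"] arg_cong[OF eq, of "\<lambda>z. z div B"] unfolding dm[OF lt(1)] dm[OF lt(2)] .
  have "\<forall>j<m. a (Suc j) = b (Suc j)"
    by (rule Suc.IH[OF _ _ sum]) (rule Suc.prems(1,2), simp)+
  then show ?case using 0 by (simp only: All_less_Suc2)
qed simp

text \<open>The substitution \<open>t\<^sub>j = s ^ (B ^ j)\<close> keeps the parametrisation nonzero; the limit for \<open>s = 0\<close>
  of the resulting curve is a rational point.\<close>

lemma parametrised_point:
  fixes F :: "'k::field mpoly"
  assumes F: "mp_homogeneous d F" and f: "rational_map m N f"
    and van: "\<And>t. t \<in> affine_points m \<Longrightarrow> mp_eval (mp_ac F) (rational_map_at N f t) = 0"
  shows "hypersurface_points N F \<noteq> {}"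
proof -
  define D where "D = (\<Union>i\<le>N. \<Union>e\<in>Poly_Mapping.keys (f i). Poly_Mapping.lookup e ` Poly_Mapping.keys e)"
  have "finite (insert 0 D)" unfolding D_def by simp
  then obtain B where B: "\<And>k. k \<in> insert 0 D \<Longrightarrow> k < B" by (auto simp: finite_nat_set_iff_bounded)
  have less_B: "Poly_Mapping.lookup e j < B" if "i \<le> N" "e \<in> Poly_Mapping.keys (f i)" for i e j
  proof (cases "j \<in> Poly_Mapping.keys e")
    case True
    then have "Poly_Mapping.lookup e j \<in> D" unfolding D_def using that by blast
    then show ?thesis using B by blast
  qed (use B in \<open>simp add: in_keys_iff\<close>)
  have keys_m: "Poly_Mapping.keys e \<subseteq> {..<m}" if "i \<le> N" "e \<in> Poly_Mapping.keys (f i)" for i e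
    using f that unfolding rational_map_def mp_in_def by blast
  \<comment> \<open>Kronecker substitution turns the monomial \<open>e\<close> into
    \<open>s ^ code e\<close>. All exponents are below the base \<open>B\<close>, so distinct
    monomials of one \<open>f i\<close> receive distinct codes and cannot cancel.\<close>
  define code where "code e = (\<Sum>j<m. Poly_Mapping.lookup e j * B ^ j)" for e :: "nat \<Rightarrow>\<^sub>0 nat"
  have code_inj: "e = e'" if "i \<le> N" "e \<in> Poly_Mapping.keys (f i)" "e' \<in> Poly_Mapping.keys (f i)" "code e = code e'" for i e e'
  proof (rule poly_mapping_eqI)
    fix j
    show "Poly_Mapping.lookup e j = Poly_Mapping.lookup e' j"
    proof (cases "j < m")
      case True
      then show ?thesis
        using digits_inj[of m "Poly_Mapping.lookup e" B "Poly_Mapping.lookup e'"] less_B that unfolding code_def by blast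
    next
      case False
      then have "j \<notin> Poly_Mapping.keys e" "j \<notin> Poly_Mapping.keys e'" using keys_m that by auto
      then show ?thesis by (simp add: in_keys_iff)
    qed
  qed
  define t where "t s = (\<lambda>j. if j < m then s ^ (B ^ j) else 0)" for s :: "'k alg_closure"
  define G where "G i = (\<Sum>e\<in>Poly_Mapping.keys (f i). monom (to_ac (Poly_Mapping.lookup (f i) e)) (code e))" for i
  define c where "c i r = (\<Sum>e\<in>Poly_Mapping.keys (f i). if code e = r then Poly_Mapping.lookup (f i) e else 0)" for i r
  have monom_t: "mp_monom e (t s) = s ^ code e" if "Poly_Mapping.keys e \<subseteq> {..<m}" for e s
  proof -
    have "mp_monom e (t s) = (\<Prod>j<m. t s j ^ Poly_Mapping.lookup e j)"
      by (rule mp_monom_superset) (use that in auto)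
    also have "\<dots> = (\<Prod>j<m. s ^ (Poly_Mapping.lookup e j * B ^ j))"
      by (intro prod.cong) (auto simp: t_def power_mult[symmetric] mult.commute)
    finally show ?thesis by (simp add: code_def power_sum)
  qed
  have G: "poly (G i) s = mp_eval (mp_ac (f i)) (t s)" if "i \<le> N" for i s
    unfolding G_def mp_eval_ac poly_sum poly_monom using keys_m[OF that] by (intro sum.cong) (auto simp: monom_t)
  have coeff_G: "coeff (G i) r = to_ac (c i r)" for i r
    unfolding G_def c_def coeff_sum to_ac_sum by (intro sum.cong) auto
  have "\<exists>r. \<exists>i\<le>N. c i r \<noteq> 0"
  proof -
    obtain i where i: "i \<le> N" "f i \<noteq> 0" using f unfolding rational_map_def by blast
    then obtain e where e: "e \<in> Poly_Mapping.keys (f i)" by fastforce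
    have "c i (code e) = (\<Sum>e'\<in>Poly_Mapping.keys (f i). if e' = e then Poly_Mapping.lookup (f i) e' else 0)"
      unfolding c_def using code_inj[OF i(1) _ e] by (intro sum.cong) auto
    then have "c i (code e) = Poly_Mapping.lookup (f i) e" using e by simp
    then have "c i (code e) \<noteq> 0" using e by (simp add: in_keys_iff)
    then show ?thesis using i(1) by blast
  qed
  \<comment> \<open>The least order at \<open>s = 0\<close> among all coordinates. After division by
    \<open>s ^ r\<close> the value at 0 is the nonzero vector of the \<open>c i r\<close>, which are
    coefficients in \<open>k\<close>.\<close>
  then obtain r where r: "\<exists>i\<le>N. c i r \<noteq> 0" "\<And>k. k < r \<Longrightarrow> \<not> (\<exists>i\<le>N. c i k \<noteq> 0)"
    using exists_least_iff[of "\<lambda>r. \<exists>i\<le>N. c i r \<noteq> 0"] by blast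
  define H where "H i = poly_shift r (G i)" for i
  have GH: "G i = monom 1 r * H i" if "i \<le> N" for i
    by (rule poly_eqI) (use r(2) that in \<open>auto simp: coeff_monom_mult H_def coeff_poly_shift coeff_G\<close>)
  define h where "h s = (\<lambda>i. if i \<le> N then poly (H i) s else 0)" for s
  have map_t: "rational_map_at N f (t s) = (\<lambda>i. s ^ r * h s i)" for s
    by (auto simp: rational_map_at_def h_def G[symmetric] GH poly_monom)
  have h0: "mp_eval (mp_ac F) (h s) = 0" if "s \<noteq> 0" for s
  proof -
    have "t s \<in> affine_points m" by (simp add: t_def affine_points_def)
    from van[OF this] have "(s ^ r) ^ d * mp_eval (mp_ac F) (h s) = 0"
      unfolding map_t by (subst mp_eval_scale[symmetric]) (use F in \<open>simp_all add: mp_homogeneous_def\<close>)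
    then show ?thesis using that by simp
  qed
  have "(\<lambda>s. h s i) \<in> PU" for i
    unfolding h_def using poly_in_PU[of "H i"] by (cases "i \<le> N") (simp_all add: polyfuns.const)
  then have "(\<lambda>s. mp_eval (mp_ac F) (h s)) \<in> PU" by (rule PV_subst[OF mp_eval_PV])
  then have "mp_eval (mp_ac F) (h 0) = 0" by (rule PU_eq_0[of _ "{0}"]) (use h0 in auto)
  moreover have "h 0 = (\<lambda>i. to_ac (if i \<le> N then c i r else 0))"
    by (auto simp: h_def poly_0_coeff_0 H_def coeff_poly_shift coeff_G)
  ultimately have "mp_eval F (\<lambda>i. if i \<le> N then c i r else 0) = 0" by (simp add: mp_eval_ac_to_ac)
  moreover have "(\<lambda>i. if i \<le> N then c i r else 0) \<in> proj_points N" using r(1) by (auto simp: proj_points_def)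
  ultimately show ?thesis unfolding hypersurface_points_def by blast
qed

text \<open>A monomial of degree three is split into three variables, repetitions allowed, and the
  Leibniz rule for \<open>dmonom\<close> identifies \<open>A\<close> in coordinate directions with
  the formal partial derivatives.\<close>

lemma cubic_form:
  fixes Q :: "'k::field mpoly"
  assumes "mp_in {..N} Q" "mp_homogeneous 3 Q"
  obtains ia ja ka where "cubic N (Poly_Mapping.keys Q) ia ja ka"
    "\<And>x. cubic.F (Poly_Mapping.keys Q) (\<lambda>e. to_ac (Poly_Mapping.lookup Q e)) ia ja ka x = mp_eval (mp_ac Q) x"
    "\<And>x l. cubic.A (Poly_Mapping.keys Q) (\<lambda>e. to_ac (Poly_Mapping.lookup Q e)) ia ja ka x (\<lambda>i. if i = l then 1 else 0)
       = mp_eval (mp_ac (mp_pderiv l Q)) x"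
proof -
  have "\<forall>e\<in>Poly_Mapping.keys Q. \<exists>a b c. e = Poly_Mapping.single a 1 + (Poly_Mapping.single b 1 + Poly_Mapping.single c 1)
      \<and> {a, b, c} \<subseteq> Poly_Mapping.keys e"
    using assms(2) cubic_exponent unfolding mp_homogeneous_def by blast
  then obtain ia ja ka where i: "\<forall>e\<in>Poly_Mapping.keys Q.
      e = Poly_Mapping.single (ia e) 1 + (Poly_Mapping.single (ja e) 1 + Poly_Mapping.single (ka e) 1)
      \<and> {ia e, ja e, ka e} \<subseteq> Poly_Mapping.keys e"
    by metis
  have "cubic N (Poly_Mapping.keys Q) ia ja ka"
    by standard (use i assms(1) in \<open>unfold mp_in_def, blast\<close>)
  then interpret cubic N "Poly_Mapping.keys Q" "\<lambda>e. to_ac (Poly_Mapping.lookup Q e)" ia ja ka .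
  have m: "mp_monom e x = x (ia e) * x (ja e) * x (ka e)"
    and d: "dmonom l e x = (if ia e = l then 1 else 0) * x (ja e) * x (ka e) + x (ia e) * (if ja e = l then 1 else 0) * x (ka e)
      + x (ia e) * x (ja e) * (if ka e = l then 1 else 0)"
    if "e \<in> Poly_Mapping.keys Q" for e l and x :: "nat \<Rightarrow> 'k alg_closure"
  proof -
    have e: "e = Poly_Mapping.single (ia e) 1 + (Poly_Mapping.single (ja e) 1 + Poly_Mapping.single (ka e) 1)"
      using i that by blast
    show "mp_monom e x = x (ia e) * x (ja e) * x (ka e)"
      by (subst e) (simp only: mp_monom_add mp_monom_single mult.assoc)
    show "dmonom l e x = (if ia e = l then 1 else 0) * x (ja e) * x (ka e) + x (ia e) * (if ja e = l then 1 else 0) * x (ka e)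
      + x (ia e) * x (ja e) * (if ka e = l then 1 else 0)"
      by (subst e) (simp only: mp_monom_add mp_monom_single dmonom_add dmonom_single distrib_left mult.assoc add.assoc)
  qed
  show thesis
  proof (rule that)
    show "cubic N (Poly_Mapping.keys Q) ia ja ka" by unfold_locales
    show "F x = mp_eval (mp_ac Q) x" for x
      unfolding F_def mp_eval_ac by (intro sum.cong) (simp_all add: m)
    show "A x (\<lambda>i. if i = l then 1 else 0) = mp_eval (mp_ac (mp_pderiv l Q)) x" for x l
      unfolding A_def mp_eval_pderiv by (intro sum.cong refl) (simp only: d)
  qed
qed

lemma unirational_of_point:
  fixes Q :: "'k::field mpoly"
  assumes N: "N \<ge> 3" and Q: "hypersurface_eq N 3 Q" "smooth_hypersurface N Q" and p: "p \<in> hypersurface_points N Q"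
  shows "unirational_hypersurface N Q"
proof -
  have Q': "mp_in {..N} Q" "mp_homogeneous 3 Q" using Q(1) by (simp_all add: hypersurface_eq_def)
  obtain ia ja ka where c: "cubic N (Poly_Mapping.keys Q) ia ja ka"
    and F: "\<And>x. cubic.F (Poly_Mapping.keys Q) (\<lambda>e. to_ac (Poly_Mapping.lookup Q e)) ia ja ka x = mp_eval (mp_ac Q) x"
    and A: "\<And>x l. cubic.A (Poly_Mapping.keys Q) (\<lambda>e. to_ac (Poly_Mapping.lookup Q e)) ia ja ka x (\<lambda>i. if i = l then 1 else 0)
       = mp_eval (mp_ac (mp_pderiv l Q)) x"
    by (rule cubic_form[OF Q']) blast
  interpret cubic N "Poly_Mapping.keys Q" "\<lambda>e. to_ac (Poly_Mapping.lookup Q e)" ia ja ka by (rule c)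
  interpret smooth_cubic N "Poly_Mapping.keys Q" "\<lambda>e. to_ac (Poly_Mapping.lookup Q e)" ia ja ka
  proof
    fix x :: "nat \<Rightarrow> 'k alg_closure" assume x: "F x = 0" "nz x"
    define y where "y = (\<lambda>i. if i \<le> N then x i else 0)"
    have "F y = F x" by (rule F_cong) (simp add: y_def)
    then have "y \<in> hypersurface_points N (mp_ac Q)"
      using x by (auto simp: hypersurface_points_def proj_points_def F[symmetric] y_def nz_def)
    then obtain l where "mp_eval (mp_ac (mp_pderiv l Q)) y \<noteq> 0"
      using Q(2) unfolding smooth_hypersurface_def by blast
    then have "A y (\<lambda>i. if i = l then 1 else 0) \<noteq> 0" by (simp only: A) simp
    moreover have "A y v = A x v" for v by (rule A_cong) (simp_all add: y_def)
    ultimately show "\<exists>v. A x v \<noteq> 0" by metis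
  qed (rule N)
  define p' where "p' = (\<lambda>i. to_ac (p i))"
  have p': "F p' = 0" "nz p'"
    using p by (auto simp: F p'_def mp_eval_ac_to_ac hypersurface_points_def proj_points_def nz_def)
  have S: "(\<lambda>e. to_ac (Poly_Mapping.lookup Q e)) ` Poly_Mapping.keys Q \<subseteq> range to_ac"
    "0 \<in> range (to_ac :: 'k \<Rightarrow> _)" "1 \<in> range (to_ac :: 'k \<Rightarrow> _)" "- 1 \<in> range (to_ac :: 'k \<Rightarrow> _)"
    "\<And>i. i \<le> N \<Longrightarrow> p' i \<in> range to_ac"
    using rangeI[of to_ac "0 :: 'k"] rangeI[of to_ac "1 :: 'k"] rangeI[of to_ac "- 1 :: 'k"] by (auto simp: p'_def)
  obtain m and z :: "(nat \<Rightarrow> 'k alg_closure) \<Rightarrow> nat \<Rightarrow> 'k alg_closure" where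
    z: "\<And>i. (\<lambda>\<tau>. z \<tau> i) \<in> polyfuns ((\<lambda>n \<tau>. \<tau> n) ` {..<m}) (range to_ac)"
    and zX: "\<And>\<tau>. F (z \<tau>) = 0" and z_out: "\<And>\<tau> i. i > N \<Longrightarrow> z \<tau> i = 0"
    and dense: "\<forall>d G x. homog d G \<longrightarrow> (\<forall>x y. (\<forall>i\<le>N. x i = y i) \<longrightarrow> G x = G y) \<longrightarrow>
      (\<forall>\<tau>. G (z \<tau>) = 0) \<longrightarrow> F x = 0 \<longrightarrow> G x = 0"
  proof goal_cases
    case 1
    show ?case by (rule dense_parametrisation[OF p' S], assumption) (rule 1)
  qed
  have "\<forall>i. \<exists>q. mp_in {..<m} q \<and> (\<forall>\<tau>. z \<tau> i = mp_eval (mp_ac q) \<tau>)"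
    using polyfuns_mpoly[OF z] by blast
  then obtain f where f: "\<And>i. mp_in {..<m} (f i)" "\<And>\<tau> i. z \<tau> i = mp_eval (mp_ac (f i)) \<tau>" by metis
  have map_z: "rational_map_at N f \<tau> = z \<tau>" for \<tau>
    using z_out f(2) by (auto simp: rational_map_at_def)
  have nz_proj: "z \<tau> \<in> proj_points N \<longleftrightarrow> nz (z \<tau>)" for \<tau>
    using z_out by (auto simp: proj_points_def nz_def)
  \<comment> \<open>Density applied to a coordinate that is nonzero at the rational point excludes
    the zero parametrisation.\<close>
  obtain \<tau>1 where t1: "nz (z \<tau>1)"
  proof (rule ccontr)
    assume "\<not> thesis"
    then have "\<And>\<tau>. \<not> nz (z \<tau>)" using that by blast
    then have z0: "z \<tau> i = 0" if "i \<le> N" for \<tau> i using that unfolding nz_def by blast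
    obtain i where i: "i \<le> N" "p' i \<noteq> 0" using p'(2) by (auto simp: nz_def)
    have "homog 1 (\<lambda>x :: nat \<Rightarrow> 'k alg_closure. x i)" by (simp add: homog_def PV_coord)
    moreover have "\<forall>x y. (\<forall>i\<le>N. x i = y i) \<longrightarrow> x i = (y i :: 'k alg_closure)" using i(1) by simp
    ultimately have "p' i = 0" using dense[rule_format, of 1 "\<lambda>x. x i" p'] z0[OF i(1)] p'(1) by simp
    then show False using i(2) by simp
  qed
  have "rational_map m N f"
    unfolding rational_map_def
  proof
    obtain i where "i \<le> N" "z \<tau>1 i \<noteq> 0" using t1 by (auto simp: nz_def)
    then show "\<exists>i\<le>N. f i \<noteq> 0" using f(2)[of \<tau>1 i] by (intro exI[of _ i]) auto
  qed (use f in blast)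
  moreover have "rational_map_image m N f \<subseteq> hypersurface_points N (mp_ac Q)"
    using zX by (auto simp: rational_map_image_def hypersurface_points_def map_z F)
  moreover have "hypersurface_points N (mp_ac Q) \<subseteq> zariski_closure N (rational_map_image m N f)"
  proof
    fix x assume "x \<in> hypersurface_points N (mp_ac Q)"
    then have x: "x \<in> proj_points N" "F x = 0" by (simp_all add: hypersurface_points_def F)
    have "mp_eval G x = 0" if G: "mp_in {..N} G" "mp_homogeneous d G"
      and van: "\<forall>y\<in>rational_map_image m N f. mp_eval G y = 0" for G d
    proof -
      have nz_van: "mp_eval G (z \<tau>) = 0" if "nz (z \<tau>)" for \<tau>
      proof -
        define \<tau>' where "\<tau>' = (\<lambda>j. if j < m then \<tau> j else 0)"
        have "mp_in {..<m} (mp_ac (f i))" for i using f(1)[of i] by (simp add: mp_in_def)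
        then have "z \<tau> = z \<tau>'"
          unfolding f(2) by (intro ext mp_eval_cong[of "{..<m}"]) (auto simp: \<tau>'_def)
        moreover have "\<tau>' \<in> affine_points m" by (simp add: affine_points_def \<tau>'_def)
        ultimately have "z \<tau> \<in> rational_map_image m N f"
          using that nz_proj[of \<tau>] unfolding rational_map_image_def map_z by blast
        then show ?thesis using van by blast
      qed
      \<comment> \<open>Where the map is undefined, \<open>z \<tau>\<close> is the zero vector. A
        form of degree 0 need not vanish there automatically, so its value is compared with the one
        at the image point \<open>z \<tau>1\<close>.\<close>
      have van': "mp_eval G (z \<tau>) = 0" for \<tau>
      proof (cases "nz (z \<tau>)")
        case False
        then have "z \<tau> i = 0" for i using z_out[of i \<tau>] unfolding nz_def by (cases "i \<le> N") auto
        then have "z \<tau> = (\<lambda>i. 0 * z \<tau>1 i)" by (simp add: fun_eq_iff)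
        then have "mp_eval G (z \<tau>) = 0 ^ d * mp_eval G (z \<tau>1)" by (simp only: mp_eval_scale[OF G(2)])
        then show ?thesis using nz_van[OF t1] by simp
      qed (rule nz_van)
      have h: "homog d (mp_eval G)" by (simp add: homog_def mp_eval_PV mp_eval_scale[OF G(2)])
      have loc: "\<forall>x y. (\<forall>i\<le>N. x i = y i) \<longrightarrow> mp_eval G x = mp_eval G y"
        by (intro allI impI mp_eval_cong[OF G(1)]) simp
      show ?thesis
        by (rule dense[THEN spec, THEN spec, THEN spec, THEN mp, THEN mp, THEN mp, THEN mp, OF h loc _ x(2)])
          (rule allI, rule van')
    qed
    then show "x \<in> zariski_closure N (rational_map_image m N f)"
      unfolding zariski_closure_def using x(1) by blast
  qed
  ultimately show ?thesis unfolding unirational_hypersurface_def by blast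
qed

lemma mp_eval_homogeneous_0:
  assumes "mp_homogeneous d p" "d > 0" "\<And>i. x i = 0" shows "mp_eval p x = 0"
proof -
  have "mp_eval p (\<lambda>i. 0 * x i) = 0 ^ d * mp_eval p x" by (rule mp_eval_scale[OF assms(1)])
  moreover have "(\<lambda>i. 0 * x i) = x" using assms(3) by auto
  ultimately show ?thesis using assms(2) by (metis mult_zero_left power_0_left not_gr_zero)
qed

theorem theorem1:
  fixes F :: "('k::field) mpoly" and n :: nat
  assumes "n \<ge> 2"
    and "hypersurface_eq (n + 1) 3 F"
    and "smooth_hypersurface (n + 1) F"
  shows "unirational_hypersurface (n + 1) F \<longleftrightarrow> hypersurface_points (n + 1) F \<noteq> {}"
proof
  assume "unirational_hypersurface (n + 1) F"
  then obtain m f where f: "rational_map m (n + 1) f"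
    "rational_map_image m (n + 1) f \<subseteq> hypersurface_points (n + 1) (mp_ac F)"
    unfolding unirational_hypersurface_def by blast
  have h: "mp_homogeneous 3 F" using assms(2) by (simp add: hypersurface_eq_def)
  show "hypersurface_points (n + 1) F \<noteq> {}"
  proof (rule parametrised_point[OF h f(1)])
    fix t :: "nat \<Rightarrow> 'k alg_closure" assume t: "t \<in> affine_points m"
    let ?x = "rational_map_at (n + 1) f t"
    have out: "?x i = 0" if "i > n + 1" for i using that by (simp add: rational_map_at_def)
    show "mp_eval (mp_ac F) ?x = 0"
    proof (cases "?x \<in> proj_points (n + 1)")
      case True
      then show ?thesis using t f(2) unfolding rational_map_image_def hypersurface_points_def by blast
    next
      case False
      then have "?x i = 0" for i using out unfolding proj_points_def by (cases "i \<le> n + 1") auto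
      moreover have "mp_homogeneous 3 (mp_ac F)" using h by (simp add: mp_homogeneous_def)
      ultimately show ?thesis using mp_eval_homogeneous_0[of 3 "mp_ac F" ?x] by simp
    qed
  qed
next
  assume "hypersurface_points (n + 1) F \<noteq> {}"
  then obtain p where "p \<in> hypersurface_points (n + 1) F" by blast
  then show "unirational_hypersurface (n + 1) F"
    using assms by (intro unirational_of_point) auto
qed

end
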